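(* Let $\Omega\subset\mathbb{R}^{d+1}$ be the closure of an open, connected, bounded $C^2$-domain, and let $r\in\mathbb{N}$. For any $0<q\le p\le\infty$ there are constants $C,c_0>0$ such that for every $f\in L^p(\Omega)$, $$\omega_\Omega^r(f,t;A_0)_p\le C\,\tau_r(f,c_0t)_{p,q},\qquad 0<t\le1,$$ where $C$ and $c_0$ are independent of $f$ and $t$.
   Context: Here $d\ge 1$, $\|\cdot\|$ is the Euclidean norm, $|E|$ is Lebesgue measure, $e_1,\dots,e_{d+1}$ is the standard basis of $\mathbb{R}^{d+1}$, points of $\mathbb{R}^{d+1}$ are written $(x,y)$ with $x\in\mathbb{R}^d$, $y\in\mathbb{R}$, and $\Gamma=\partial\Omega$. For $p<\infty$, $L^p(\Omega)$ is the Lebesgue space; $L^\infty(\Omega)$ means $C(\Omega)$ with the uniform norm. $C^2$-domain: a bounded domain for which there are $\delta>0$, $M>0$ and a finite cover of the boundary by connected open sets $U_1,\dots,U_J$ such that (i) every $x$ in the domain with distance $<\delta$ to the boundary lies in some $U_j$ with $\mathrm{dist}(x,\partial U_j)>\delta$; (ii) for each $j$ there is a Cartesian coordinate system $(\xi_{j,1},\dots,\xi_{j,d+1})$ in $U_j$ in which the part of the domain in $U_j$ is given by $\xi_{j,d+1}\le f_j(\xi_{j,1},\dots,\xi_{j,d})$ with $f_j\in C^2(\mathbb{R}^d)$ and $\max_{i,k}\|\partial_i\partial_kf_j\|_\infty\le M$. Differences: $\triangle_\xi^r f(\eta)=\sum_{j=0}^r(-1)^{r+j}\binom rj f(\eta+j\xi)$;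 $\triangle_\xi^r(f,\Omega,\eta)=\triangle_\xi^rf(\eta)$ if the segment $[\eta,\eta+r\xi]\subset\Omega$, and $=0$ otherwise. Average (Ivanov) modulus: $\rho_\Omega(\xi,\eta)=\|\xi-\eta\|+|\sqrt{\mathrm{dist}(\xi,\Gamma)}-\sqrt{\mathrm{dist}(\eta,\Gamma)}|$, $U(\xi,t)=\{\eta\in\Omega:\rho_\Omega(\xi,\eta)\le t\}$; $w_r(f,\xi,\delta)_q=\bigl(|U(\xi,\delta)|^{-1}\int_{U(\xi,\delta)}|\triangle^r_{(\eta-\xi)/r}(f,\Omega,\xi)|^q\,d\eta\bigr)^{1/q}$ for $0<q<\infty$, $w_r(f,\xi,\delta)_\infty=\sup_{\eta\in U(\xi,\delta)}|\triangle^r_{(\eta-\xi)/r}(f,\Omega,\xi)|$, and $\tau_r(f,\delta)_{p,q}=\|w_r(f,\cdot,\delta)_q\|_{L^p(\Omega)}$ for $0<q\le p\le\infty$. Ditzian–Totik part: for a unit vector $e$ and $\xi\in\Omega$, $\varphi_\Omega(e,\xi)=\max\{\sqrt{l_1l_2}: l_1,l_2\ge0,\ [\xi-l_1e,\xi+l_2e]\subset\Omega\}$; $\omega^r_{\Omega,\varphi}(f,t;e)_p=\sup_{|h|\le\min\{t,1\}}\|\triangle^r_{h\varphi_\Omega(e,\cdot)e}(f,\Omega,\cdot)\|_{L^p(\Omega)}$ and $\omega^r_{\Omega,\varphi}(f,t)_p=\max_{1\le j\le d+1}\omega^r_{\Omega,\varphi}(f,t;e_j)_p$. Domains of special type: $G$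 is an upward $x_{d+1}$-domain with base size $b>0$ and parameter $L\ge1$ if $G=\zeta+\{(x,y):x\in(-b,b)^d,\ g(x)-Lb<y\le g(x)\}$ with $\zeta\in\mathbb{R}^{d+1}$, $g\in C^2(\mathbb{R}^d)$; it is always assumed that $L\ge 4\sqrt d\max_{x\in[-2b,2b]^d}\|\nabla g(x)\|+1$. Put $G^*=\zeta+\{(x,y):x\in(-2b,2b)^d,\ \min_{u\in[-2b,2b]^d}g(u)-4Lb<y\le g(x)\}$, $\partial'G=\zeta+\{(x,g(x)):x\in(-b,b)^d\}$, $\partial'G^*=\zeta+\{(x,g(x)):x\in(-2b,2b)^d\}$. Let $\sigma_j$ interchange the $j$-th and $(d+1)$-th coordinates and $\tau_j$ change the sign of the $j$-th coordinate. $G$ is an upward $x_j$-domain if $\sigma_j(G)$ is an upward $x_{d+1}$-domain, and a downward $x_j$-domain if $\tau_j(G)$ is an upward $x_j$-domain; $G^*,\partial'G,\partial'G^*$ are defined by transporting through these maps. A domain of special type is an upward or downward $x_j$-domain for some $1\le j\le d+1$. A domain of special type $G\subset\Omega$ is attached to $\Gamma$ if $\overline{G^*}\cap\Gamma=\overline{\partial'G^*}$ and there is an open rectangular box $Q$ (sides parallel to the axes) with $G^*=Q\cap\Omega$. Tangential part: $A_0>1$ is a fixed parameter. If $G\subset\Omega$ is an upward $x_{d+1}$-domain with $\zeta=0$, that is, $G=\{(x,y):x\in(-b,b)^d,\ g(x)-Lb<y\le g(x)\}$ with $b>0$, $g\in C^2(\mathbb{R}^d)$ and $L\ge 4\sqrt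 d\max_{x\in[-2b,2b]^d}\|\nabla g(x)\|+1$, put $\xi_j(u)=e_j+\partial_jg(u)e_{d+1}$ ($1\le j\le d$), $G^t=\{\xi\in G:\mathrm{dist}(\xi,\partial'G)\ge A_0t^2\}$, $I_x(tb)=\{u\in(-b,b)^d:\|u-x\|\le tb\}$, and for $0<t\le1$ $$\widetilde\omega^r_G(f,t;A_0)_p=\sup_{0<s\le t,\ 1\le j\le d}\Bigl(\int_{G^t}\Bigl[\frac1{(bt)^d}\int_{I_x(tb)}|\triangle^r_{s\xi_j(u)}(f,\Omega,(x,y))|^p\,du\Bigr]dx\,dy\Bigr)^{1/p}$$ (with $L^\infty$-norms replacing the $L^p$-norms when $p=\infty$). For a general domain of special type, $\widetilde\omega^r_G(f,t;A_0)_p=\widetilde\omega^r_{T(G)}(f\circ T^{-1},t;A_0)_p$ (with $\Omega$ replaced by $T(\Omega)$), $T$ being a composition of a translation and the maps $\sigma_j,\tau_j$ taking $G$ to an upward $x_{d+1}$-domain with $\zeta=0$. Fix domains of special type $G_1,\dots,G_{m_0}\subset\Omega$ attached to $\Gamma$ that cover $\Gamma$ (such a finite cover exists). Then $\omega^r_\Omega(f,t;A_0)_p=\omega^r_{\Omega,\varphi}(f,t)_p+\sum_{j=1}^{m_0}\widetilde\omega^r_{G_j}(f,t;A_0)_p$. *)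

theory Defs
  imports "HOL-Analysis.Analysis"
begin

text \<open>Points of \<open>\<real>\<^sup>d\<^sup>+\<^sup>1\<close> are pairs \<open>(x, y)\<close> with \<open>x \<in> \<real>\<^sup>d\<close>, \<open>d = CARD('d)\<close>; the
  inner product, the norm and \<open>lebesgue\<close> on this product type are the Euclidean ones.
  Coordinates are indexed by \<open>'d option\<close>, where \<open>None\<close> is the last coordinate \<open>d + 1\<close>.\<close>

type_synonym 'd pt = "(real ^ 'd) \<times> real"

fun basis_vec :: "'d::finite option \<Rightarrow> 'd pt" where
  "basis_vec None = (0, 1)"
| "basis_vec (Some i) = (axis i 1, 0)"

fun coord_swap :: "'d::finite option \<Rightarrow> 'd pt \<Rightarrow> 'd pt" where
  "coord_swap None (x, y) = (x, y)"
| "coord_swap (Some i) (x, y) = ((\<chi> k. if k = i then y else x $ k), x $ i)"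

fun coord_flip :: "'d::finite option \<Rightarrow> 'd pt \<Rightarrow> 'd pt" where
  "coord_flip None (x, y) = (x, - y)"
| "coord_flip (Some i) (x, y) = ((\<chi> k. if k = i then - (x $ k) else x $ k), y)"

definition partial :: "'d::finite \<Rightarrow> (real ^ 'd \<Rightarrow> real) \<Rightarrow> real ^ 'd \<Rightarrow> real" where
  "partial i g u = frechet_derivative g (at u) (axis i 1)"

definition grad :: "(real ^ 'd::finite \<Rightarrow> real) \<Rightarrow> real ^ 'd \<Rightarrow> real ^ 'd" where
  "grad g u = (\<chi> i. partial i g u)"

definition C2_fun :: "(real ^ 'd::finite \<Rightarrow> real) \<Rightarrow> bool" where
  "C2_fun g \<longleftrightarrow> g differentiable_on UNIV \<and>
     (\<forall>i. partial i g differentiable_on UNIV \<and>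
          (\<forall>k. continuous_on UNIV (partial k (partial i g))))"

text \<open>The predicate is meant for the closed set \<open>\<Omega>\<close>: for an open set the inequality
  \<open>\<xi>\<^sub>d\<^sub>+\<^sub>1 \<le> f(\<xi>\<^sub>1, \<dots>, \<xi>\<^sub>d)\<close> would have to be strict.
  A Cartesian coordinate system is \<open>\<xi> \<mapsto> R (\<xi> - c)\<close> with an origin \<open>c\<close> and an orthogonal \<open>R\<close>.\<close>

definition C2_domain :: "'d::finite pt set \<Rightarrow> bool" where
  "C2_domain \<Omega> \<longleftrightarrow> bounded \<Omega> \<and>
     (\<exists>\<delta>>0. \<exists>M>0. \<exists>\<U>. finite \<U> \<and> frontier \<Omega> \<subseteq> \<Union>\<U> \<and>
        (\<forall>U\<in>\<U>. open U \<and> connected U) \<and>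
        (\<forall>x\<in>\<Omega>. infdist x (frontier \<Omega>) < \<delta> \<longrightarrow> (\<exists>U\<in>\<U>. x \<in> U \<and> infdist x (frontier U) > \<delta>)) \<and>
        (\<forall>U\<in>\<U>. \<exists>(R :: 'd pt \<Rightarrow> 'd pt) c (f :: real ^ 'd \<Rightarrow> real).
            orthogonal_transformation R \<and> C2_fun f \<and>
            (\<forall>i k u. \<bar>partial i (partial k f) u\<bar> \<le> M) \<and>
            \<Omega> \<inter> U = {\<xi> \<in> U. snd (R (\<xi> - c)) \<le> f (fst (R (\<xi> - c)))}))"

definition epow :: "ennreal \<Rightarrow> real \<Rightarrow> ennreal" where
  "epow x a = (if x = \<infinity> then \<infinity> else ennreal (enn2real x powr a))"

text \<open>For \<open>p = \<infinity>\<close> the norm is the uniform norm (a supremum, not an essential supremum),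
  and \<open>L\<^sup>\<infinity>(\<Omega>)\<close> is \<open>C(\<Omega>)\<close>.  Functions are total; only their values on \<open>\<Omega>\<close> are ever used.\<close>

definition Lp_norm :: "ennreal \<Rightarrow> 'a::euclidean_space set \<Rightarrow> ('a \<Rightarrow> ennreal) \<Rightarrow> ennreal" where
  "Lp_norm p S F = (if p = \<infinity> then (SUP x\<in>S. F x)
     else epow (\<integral>\<^sup>+x\<in>S. epow (F x) (enn2real p) \<partial>lebesgue) (1 / enn2real p))"

definition Lp_space :: "ennreal \<Rightarrow> 'a::euclidean_space set \<Rightarrow> ('a \<Rightarrow> real) set" where
  "Lp_space p \<Omega> = (if p = \<infinity> then {f. continuous_on \<Omega> f}
     else {f \<in> borel_measurable (lebesgue_on \<Omega>). Lp_norm p \<Omega> (\<lambda>x. ennreal \<bar>f x\<bar>) < \<infinity>})"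

definition fdiff :: "nat \<Rightarrow> 'a::real_vector \<Rightarrow> ('a \<Rightarrow> real) \<Rightarrow> 'a \<Rightarrow> real" where
  "fdiff r \<xi> f \<eta> = (\<Sum>j=0..r. (-1) ^ (r + j) * real (r choose j) * f (\<eta> + real j *\<^sub>R \<xi>))"

definition fdiff_on :: "nat \<Rightarrow> 'a::real_vector \<Rightarrow> ('a \<Rightarrow> real) \<Rightarrow> 'a set \<Rightarrow> 'a \<Rightarrow> real" where
  "fdiff_on r \<xi> f \<Omega> \<eta> =
     (if closed_segment \<eta> (\<eta> + real r *\<^sub>R \<xi>) \<subseteq> \<Omega> then fdiff r \<xi> f \<eta> else 0)"


section \<open>Average (Ivanov) moduli\<close>

definition rho :: "'a::euclidean_space set \<Rightarrow> 'a \<Rightarrow> 'a \<Rightarrow> real" where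
  "rho \<Omega> \<xi> \<eta> = norm (\<xi> - \<eta>)
     + \<bar>sqrt (infdist \<xi> (frontier \<Omega>)) - sqrt (infdist \<eta> (frontier \<Omega>))\<bar>"

definition rho_ball :: "'a::euclidean_space set \<Rightarrow> 'a \<Rightarrow> real \<Rightarrow> 'a set" where
  "rho_ball \<Omega> \<xi> t = {\<eta> \<in> \<Omega>. rho \<Omega> \<xi> \<eta> \<le> t}"

definition local_modulus ::
  "'a::euclidean_space set \<Rightarrow> nat \<Rightarrow> ('a \<Rightarrow> real) \<Rightarrow> 'a \<Rightarrow> real \<Rightarrow> ennreal \<Rightarrow> ennreal" where
  "local_modulus \<Omega> r f \<xi> \<delta> q =
     (let D = (\<lambda>\<eta>. ennreal \<bar>fdiff_on r ((\<eta> - \<xi>) /\<^sub>R real r) f \<Omega> \<xi>\<bar>); U = rho_ball \<Omega> \<xi> \<delta> in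
      if q = \<infinity> then (SUP \<eta>\<in>U. D \<eta>)
      else epow ((\<integral>\<^sup>+\<eta>\<in>U. epow (D \<eta>) (enn2real q) \<partial>lebesgue) / emeasure lebesgue U)
             (1 / enn2real q))"

definition avg_modulus ::
  "'a::euclidean_space set \<Rightarrow> nat \<Rightarrow> ('a \<Rightarrow> real) \<Rightarrow> real \<Rightarrow> ennreal \<Rightarrow> ennreal \<Rightarrow> ennreal" where
  "avg_modulus \<Omega> r f \<delta> p q = Lp_norm p \<Omega> (\<lambda>\<xi>. local_modulus \<Omega> r f \<xi> \<delta> q)"


section \<open>Ditzian--Totik part\<close>

text \<open>For compact \<open>\<Omega>\<close> and \<open>\<xi> \<in> \<Omega>\<close> the supremum is attained.\<close>

definition phi :: "'a::euclidean_space set \<Rightarrow> 'a \<Rightarrow> 'a \<Rightarrow> real" where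
  "phi \<Omega> e \<xi> = Sup {sqrt (l1 * l2) |l1 l2. 0 \<le> l1 \<and> 0 \<le> l2 \<and>
     closed_segment (\<xi> - l1 *\<^sub>R e) (\<xi> + l2 *\<^sub>R e) \<subseteq> \<Omega>}"

definition DT_modulus_dir ::
  "'a::euclidean_space set \<Rightarrow> nat \<Rightarrow> ('a \<Rightarrow> real) \<Rightarrow> real \<Rightarrow> 'a \<Rightarrow> ennreal \<Rightarrow> ennreal" where
  "DT_modulus_dir \<Omega> r f t e p = (SUP h\<in>{h. \<bar>h\<bar> \<le> min t 1}.
     Lp_norm p \<Omega> (\<lambda>\<xi>. ennreal \<bar>fdiff_on r ((h * phi \<Omega> e \<xi>) *\<^sub>R e) f \<Omega> \<xi>\<bar>))"

definition DT_modulus ::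
  "'d::finite pt set \<Rightarrow> nat \<Rightarrow> ('d pt \<Rightarrow> real) \<Rightarrow> real \<Rightarrow> ennreal \<Rightarrow> ennreal" where
  "DT_modulus \<Omega> r f t p = (MAX j\<in>UNIV. DT_modulus_dir \<Omega> r f t (basis_vec j) p)"


section \<open>Domains of special type\<close>

definition cube :: "real \<Rightarrow> (real ^ 'd::finite) set" where
  "cube b = box (\<chi> i. - b) (\<chi> i. b)"

definition ccube :: "real \<Rightarrow> (real ^ 'd::finite) set" where
  "ccube b = cbox (\<chi> i. - b) (\<chi> i. b)"

text \<open>The data of a domain of special type.  The domain points along coordinate \<open>sd_axis\<close>,
  upward or downward; the remaining data \<open>\<zeta>, b, L, g\<close> describe its transported copy, which
  is an upward \<open>x\<^sub>d\<^sub>+\<^sub>1\<close>-domain.\<close>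

datatype ('d::finite) special_data = Special_Data
  (sd_axis: "'d option") (sd_down: bool)
  (sd_shift: "'d pt") (sd_base: real) (sd_param: real) (sd_graph: "real ^ 'd \<Rightarrow> real")

text \<open>A set \<open>G\<close> is an upward \<open>x\<^sub>j\<close>-domain if \<open>\<sigma>\<^sub>j(G)\<close> is an upward \<open>x\<^sub>d\<^sub>+\<^sub>1\<close>-domain, and a downward
  \<open>x\<^sub>j\<close>-domain if \<open>\<sigma>\<^sub>j(\<tau>\<^sub>j(G))\<close> is one.\<close>

definition sd_orient :: "'d::finite special_data \<Rightarrow> 'd pt \<Rightarrow> 'd pt" where
  "sd_orient S =
     (if sd_down S then coord_swap (sd_axis S) \<circ> coord_flip (sd_axis S) else coord_swap (sd_axis S))"

definition sd_transport :: "'d::finite special_data \<Rightarrow> 'd pt set \<Rightarrow> 'd pt set" where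
  "sd_transport S A = sd_orient S -` ((+) (sd_shift S) ` A)"

definition sd_ok :: "'d::finite special_data \<Rightarrow> bool" where
  "sd_ok S \<longleftrightarrow> 0 < sd_base S \<and> 1 \<le> sd_param S \<and> C2_fun (sd_graph S) \<and>
     sd_param S \<ge>
       4 * sqrt (real CARD('d)) * (SUP x\<in>ccube (2 * sd_base S). norm (grad (sd_graph S) x)) + 1"

definition sd_set :: "'d::finite special_data \<Rightarrow> 'd pt set" where
  "sd_set S = sd_transport S {(x, y). x \<in> cube (sd_base S) \<and>
     sd_graph S x - sd_param S * sd_base S < y \<and> y \<le> sd_graph S x}"

definition sd_set_star :: "'d::finite special_data \<Rightarrow> 'd pt set" where
  "sd_set_star S = sd_transport S {(x, y). x \<in> cube (2 * sd_base S) \<and>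
     (INF u\<in>ccube (2 * sd_base S). sd_graph S u) - 4 * sd_param S * sd_base S < y \<and>
     y \<le> sd_graph S x}"

definition sd_bdry :: "'d::finite special_data \<Rightarrow> 'd pt set" where
  "sd_bdry S = sd_transport S {(x, y). x \<in> cube (sd_base S) \<and> y = sd_graph S x}"

definition sd_bdry_star :: "'d::finite special_data \<Rightarrow> 'd pt set" where
  "sd_bdry_star S = sd_transport S {(x, y). x \<in> cube (2 * sd_base S) \<and> y = sd_graph S x}"

definition sd_attached :: "'d::finite pt set \<Rightarrow> 'd special_data \<Rightarrow> bool" where
  "sd_attached \<Omega> S \<longleftrightarrow>
     closure (sd_set_star S) \<inter> frontier \<Omega> = closure (sd_bdry_star S) \<and>
     (\<exists>a c. sd_set_star S = box a c \<inter> \<Omega>)"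


section \<open>Tangential part\<close>

inductive coord_map :: "('d::finite pt \<Rightarrow> 'd pt) \<Rightarrow> bool" where
  coord_map_id: "coord_map id"
| coord_map_translation: "coord_map T \<Longrightarrow> coord_map ((+) v \<circ> T)"
| coord_map_swap: "coord_map T \<Longrightarrow> coord_map (coord_swap j \<circ> T)"
| coord_map_flip: "coord_map T \<Longrightarrow> coord_map (coord_flip j \<circ> T)"

definition sd_standard :: "'d::finite special_data \<Rightarrow> bool" where
  "sd_standard S \<longleftrightarrow> sd_ok S \<and> sd_axis S = None \<and> \<not> sd_down S \<and> sd_shift S = 0"

text \<open>\<open>T\<close> takes the domain \<open>G\<close> to the upward \<open>x\<^sub>d\<^sub>+\<^sub>1\<close>-domain \<open>H\<close> with \<open>\<zeta> = 0\<close>.  Such a \<open>T\<close> is not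
  unique (coordinates of \<open>\<real>\<^sup>d\<close> may be permuted or reflected), and the tangential modulus depends
  on it; so \<open>T\<close> and \<open>H\<close> are kept as parameters.\<close>

definition straightens ::
  "('d::finite pt \<Rightarrow> 'd pt) \<Rightarrow> 'd special_data \<Rightarrow> 'd special_data \<Rightarrow> bool" where
  "straightens T G H \<longleftrightarrow> coord_map T \<and> sd_standard H \<and> T ` sd_set G = sd_set H"

definition tangent_vec :: "(real ^ 'd::finite \<Rightarrow> real) \<Rightarrow> 'd \<Rightarrow> real ^ 'd \<Rightarrow> 'd pt" where
  "tangent_vec g j u = basis_vec (Some j) + partial j g u *\<^sub>R basis_vec None"

definition tang_region :: "'d::finite special_data \<Rightarrow> real \<Rightarrow> real \<Rightarrow> 'd pt set" where
  "tang_region H A0 t = {\<xi> \<in> sd_set H. infdist \<xi> (sd_bdry H) \<ge> A0 * t\<^sup>2}"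

definition base_ball :: "real \<Rightarrow> real ^ 'd::finite \<Rightarrow> real \<Rightarrow> (real ^ 'd) set" where
  "base_ball b x \<rho> = {u \<in> cube b. norm (u - x) \<le> \<rho>}"

definition tang_modulus_std ::
  "'d::finite pt set \<Rightarrow> 'd special_data \<Rightarrow> nat \<Rightarrow> ('d pt \<Rightarrow> real) \<Rightarrow> real \<Rightarrow> real \<Rightarrow> ennreal
     \<Rightarrow> ennreal" where
  "tang_modulus_std \<Omega> H r f t A0 p =
     (let b = sd_base H;
          D = (\<lambda>s j \<xi> u. ennreal \<bar>fdiff_on r (s *\<^sub>R tangent_vec (sd_graph H) j u) f \<Omega> \<xi>\<bar>) in
      SUP s\<in>{0<..t}. SUP j\<in>UNIV.
        if p = \<infinity> then (SUP \<xi>\<in>tang_region H A0 t. SUP u\<in>base_ball b (fst \<xi>) (t * b). D s j \<xi> u)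
        else epow (\<integral>\<^sup>+\<xi>\<in>tang_region H A0 t.
               ((\<integral>\<^sup>+u\<in>base_ball b (fst \<xi>) (t * b). epow (D s j \<xi> u) (enn2real p) \<partial>lebesgue)
                  / ennreal ((b * t) ^ CARD('d))) \<partial>lebesgue) (1 / enn2real p))"

definition tang_modulus ::
  "'d::finite pt set \<Rightarrow> ('d pt \<Rightarrow> 'd pt) \<Rightarrow> 'd special_data \<Rightarrow> nat \<Rightarrow> ('d pt \<Rightarrow> real)
     \<Rightarrow> real \<Rightarrow> real \<Rightarrow> ennreal \<Rightarrow> ennreal" where
  "tang_modulus \<Omega> T H r f t A0 p = tang_modulus_std (T ` \<Omega>) H r (f \<circ> inv T) t A0 p"

text \<open>The family \<open>G\<^sub>1, \<dots>, G\<^sub>m\<close> of domains of special type enters through \<open>straightens (T j) (G j) (H j)\<close>.\<close>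

definition full_modulus ::
  "'d::finite pt set \<Rightarrow> nat \<Rightarrow> (nat \<Rightarrow> 'd pt \<Rightarrow> 'd pt) \<Rightarrow> (nat \<Rightarrow> 'd special_data) \<Rightarrow> nat
     \<Rightarrow> ('d pt \<Rightarrow> real) \<Rightarrow> real \<Rightarrow> real \<Rightarrow> ennreal \<Rightarrow> ennreal" where
  "full_modulus \<Omega> m T H r f t A0 p =
     DT_modulus \<Omega> r f t p + (\<Sum>j=1..m. tang_modulus \<Omega> (T j) (H j) r f t A0 p)"

end

theory Submission
  imports Defs
begin
text \<open>
  A boundary point of a \<open>C\<^sup>2\<close>-domain is touched by an interior and an exterior ball of uniform
  radius.  Hence
  \<open>d(\<xi> + w) = d(\<xi>) - n \<bullet> w + O(\<bar>w\<bar>\<^sup>2)\<close> for the distance \<open>d\<close> to the boundary, where the unit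
  normal \<open>n\<close> at the foot of \<open>\<xi>\<close> is Lipschitz in \<open>\<xi>\<close>.  Summing
  \<open>(-1)\<^sup>i\<^sup>+\<^sup>j C(r,i) C(r,j) f(\<xi> + i h + i j s)\<close> in the two possible orders expresses
  \<open>\<triangle>\<^sub>h\<^sup>r f(\<xi>)\<close> through \<open>\<triangle>\<^sub>i\<^sub>s\<^sup>r f(\<xi> + i h)\<close> and \<open>\<triangle>\<^sub>h\<^sub>+\<^sub>j\<^sub>s\<^sup>r f(\<xi>)\<close> with \<open>i, j \<ge> 1\<close>.  If \<open>s\<close> points
  inwards by a multiple of \<open>t\<^sup>2\<close>, which absorbs the curvature of the boundary, all these differences
  stay in \<open>\<Omega>\<close>, and \<open>s\<close> may range over a set comparable to the \<open>\<rho>\<^sub>\<Omega>\<close>-balls at the points \<open>\<xi> + i h\<close>.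
  Averaging over \<open>s\<close> bounds \<open>\<bar>\<triangle>\<^sub>h\<^sup>r f(\<xi>)\<bar>\<close> by local moduli at the points \<open>\<xi> + (k/N) h\<close>, as soon as
  \<open>\<bar>h\<bar> = O(t)\<close> and \<open>\<surd>d\<close> varies by \<open>O(t)\<close> along the step.  Both the Ditzian--Totik steps
  \<open>h \<phi>\<^sub>\<Omega>(e, \<xi>) e\<close> and the tangential steps \<open>s \<xi>\<^sub>j(u)\<close> have this property.  It remains to integrate in
  \<open>\<xi>\<close>: on a chord the map \<open>\<xi> \<mapsto> \<xi> + c \<phi>\<^sub>\<Omega>(e, \<xi>) e\<close> expands distances by a factor at least \<open>1/2\<close>, and
  in the tangential case the integrand is translated for each fixed \<open>u\<close>.
\<close>

section \<open>Domains with interior and exterior balls\<close>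

definition touching_normal :: "real \<Rightarrow> 'a::euclidean_space set \<Rightarrow> 'a \<Rightarrow> 'a \<Rightarrow> bool" where
  "touching_normal R \<Omega> z n \<longleftrightarrow>
     norm n = 1 \<and> ball (z - R *\<^sub>R n) R \<subseteq> \<Omega> \<and> ball (z + R *\<^sub>R n) R \<inter> \<Omega> = {}"

definition ball_domain :: "real \<Rightarrow> 'a::euclidean_space set \<Rightarrow> bool" where
  "ball_domain R \<Omega> \<longleftrightarrow> compact \<Omega> \<and> \<Omega> \<noteq> {} \<and> 0 < R \<and> (\<forall>z\<in>frontier \<Omega>. \<exists>n. touching_normal R \<Omega> z n)"

abbreviation bdist :: "'a::euclidean_space set \<Rightarrow> 'a \<Rightarrow> real" where
  "bdist \<Omega> x \<equiv> infdist x (frontier \<Omega>)"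

definition foot_normal :: "real \<Rightarrow> 'a::euclidean_space set \<Rightarrow> 'a \<Rightarrow> 'a \<Rightarrow> bool" where
  "foot_normal R \<Omega> x n \<longleftrightarrow> touching_normal R \<Omega> (x + bdist \<Omega> x *\<^sub>R n) n"

lemma disjoint_balls_dist:
  fixes x y :: "'a::euclidean_space"
  assumes "ball x a \<inter> ball y b = {}" "0 < a" "0 < b"
  shows "a + b \<le> dist x y"
proof (rule ccontr)
  assume *: "\<not> a + b \<le> dist x y"
  define m where "m = x + (a / (a+b)) *\<^sub>R (y - x)"
  have "dist x m = (a/(a+b)) * dist x y"
    using assms unfolding m_def dist_norm by (simp add: norm_minus_commute)
  also have "\<dots> < (a/(a+b)) * (a + b)" using * assms by (intro mult_strict_left_mono) auto
  also have "\<dots> = a" using assms by simp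
  finally have 1: "m \<in> ball x a" by simp
  have "y - m = (1 - a/(a+b)) *\<^sub>R (y - x)" by (simp add: m_def algebra_simps)
  also have "1 - a/(a+b) = b/(a+b)" using assms by (simp add: field_simps)
  finally have "dist y m = (b/(a+b)) * dist x y"
    using assms unfolding dist_norm by (simp add: norm_minus_commute)
  also have "\<dots> < (b/(a+b)) * (a + b)" using * assms by (intro mult_strict_left_mono) auto
  also have "\<dots> = b" using assms by simp
  finally show False using 1 assms by auto
qed

lemma frontier_compact_nonempty:
  fixes \<Omega> :: "'a::euclidean_space set"
  assumes "compact \<Omega>" "\<Omega> \<noteq> {}" shows "frontier \<Omega> \<noteq> {}"
  using assms frontier_not_empty[of \<Omega>] compact_imp_bounded not_bounded_UNIV by blast

lemma ball_bdist_subset: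
  fixes \<Omega> :: "'a::euclidean_space set"
  assumes "x \<in> \<Omega>" "\<rho> \<le> bdist \<Omega> x" shows "ball x \<rho> \<subseteq> \<Omega>"
proof (rule ccontr)
  assume "\<not> ball x \<rho> \<subseteq> \<Omega>"
  then obtain y where y: "y \<in> ball x \<rho>" "y \<notin> \<Omega>" by blast
  then have "ball x \<rho> \<inter> frontier \<Omega> \<noteq> {}"
    using assms(1) by (intro connected_Int_frontier)
      (auto simp: disjoint_iff intro!: exI[of _ x] order_le_less_trans[OF zero_le_dist[of x y]])
  then obtain z where "dist x z < \<rho>" "z \<in> frontier \<Omega>" by auto
  with infdist_le[of z "frontier \<Omega>" x] assms show False by auto
qed

lemma bdist_ge_ball:
  fixes \<Omega> :: "'a::euclidean_space set"
  assumes "ball x \<rho> \<subseteq> \<Omega>" "frontier \<Omega> \<noteq> {}" shows "\<rho> \<le> bdist \<Omega> x"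
proof -
  have "ball x \<rho> \<subseteq> interior \<Omega>" using assms by (simp add: interior_maximal)
  then have "\<rho> \<le> dist x z" if "z \<in> frontier \<Omega>" for z
    using that by (metis DiffD2 frontier_def mem_ball not_le subsetD)
  then show ?thesis using assms(2) unfolding infdist_def by (auto intro!: cINF_greatest)
qed

lemma bdist_le_outside:
  fixes \<Omega> :: "'a::euclidean_space set"
  assumes "x \<in> \<Omega>" "ball c R \<inter> \<Omega> = {}" "0 < R"
  shows "bdist \<Omega> x \<le> dist x c - R"
proof -
  have c: "c \<notin> \<Omega>" using assms(2,3) by (metis centre_in_ball disjoint_iff)
  have "closed_segment x c \<inter> frontier \<Omega> \<noteq> {}"
    using assms(1) c by (intro connected_Int_frontier) auto
  then obtain z where z: "z \<in> closed_segment x c" "z \<in> frontier \<Omega>" by auto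
  have "R \<le> dist c z"
  proof (rule ccontr)
    assume "\<not> R \<le> dist c z"
    then have "z \<in> ball c R" by simp
    moreover have "z \<in> closure \<Omega>" using z by (auto simp: frontier_def)
    ultimately show False using assms(2)
      by (metis disjoint_iff open_Int_closure_eq_empty open_ball)
  qed
  moreover have "dist x c = dist x z + dist z c" using z between between_mem_segment by blast
  ultimately show ?thesis using infdist_le[OF z(2), of x] by (simp add: dist_commute)
qed

context
  fixes R :: real and \<Omega> :: "'a::euclidean_space set"
  assumes bd: "ball_domain R \<Omega>"
begin

lemma bd_facts: "compact \<Omega>" "closed \<Omega>" "\<Omega> \<noteq> {}" "0 < R" "frontier \<Omega> \<noteq> {}" "frontier \<Omega> \<subseteq> \<Omega>"
  using bd frontier_compact_nonempty[of \<Omega>]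
  by (auto simp: ball_domain_def compact_imp_closed frontier_subset_closed)

lemma foot_normal_exists:
  assumes x: "x \<in> \<Omega>" shows "\<exists>n. foot_normal R \<Omega> x n"
proof -
  obtain z where z: "z \<in> frontier \<Omega>" "bdist \<Omega> x = dist x z"
    using infdist_attains_inf[of "frontier \<Omega>"] bd_facts by (metis frontier_closed)
  obtain n where n: "touching_normal R \<Omega> z n" using bd z unfolding ball_domain_def by auto
  define d where "d = bdist \<Omega> x"
  have dz: "norm (x - z) = d" by (simp add: d_def z dist_norm)
  have "z = x + d *\<^sub>R n"
  proof (cases "d = 0")
    case True then show ?thesis using z d_def by simp
  next
    case False
    then have d0: "d > 0" using d_def infdist_nonneg[of x "frontier \<Omega>"] by linarith
    have "ball x d \<subseteq> \<Omega>" using ball_bdist_subset[OF x, of d] by (simp add: d_def)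
    then have "ball x d \<inter> ball (z + R *\<^sub>R n) R = {}" using n unfolding touching_normal_def by blast
    then have ge: "d + R \<le> norm ((z + R *\<^sub>R n) - x)"
      using disjoint_balls_dist[of x d "z + R *\<^sub>R n" R] d0 bd_facts(4)
      by (metis dist_commute dist_norm)
    have nn: "norm n = 1" using n by (simp add: touching_normal_def)
    have "norm ((z - x) + R *\<^sub>R n) = norm (z - x) + norm (R *\<^sub>R n)"
    proof (rule antisym[OF norm_triangle_ineq])
      show "norm (z - x) + norm (R *\<^sub>R n) \<le> norm ((z - x) + R *\<^sub>R n)"
        using ge dz nn bd_facts by (simp add: norm_minus_commute algebra_simps)
    qed
    then have "norm (z - x) *\<^sub>R (R *\<^sub>R n) = norm (R *\<^sub>R n) *\<^sub>R (z - x)"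
      by (metis norm_triangle_eq)
    then have "R *\<^sub>R (d *\<^sub>R n) = R *\<^sub>R (z - x)"
      using nn dz bd_facts(4) by (simp add: norm_minus_commute mult.commute)
    then have "d *\<^sub>R n = z - x" using bd_facts(4) by (metis less_irrefl real_vector.scale_left_imp_eq)
    then show ?thesis by (simp add: algebra_simps)
  qed
  then show ?thesis using n unfolding foot_normal_def d_def by metis
qed

lemma touching_normal_close:
  assumes 1: "touching_normal R \<Omega> z1 n1" and 2: "touching_normal R \<Omega> z2 n2"
  shows "norm (n1 - n2) \<le> norm (z1 - z2) / R"
proof -
  have R: "R > 0" by (rule bd_facts)
  have n: "norm n1 = 1" "norm n2 = 1" using 1 2 by (auto simp: touching_normal_def)
  have A: "ball (z1 - R *\<^sub>R n1) R \<inter> ball (z2 + R *\<^sub>R n2) R = {}"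
    using 1 2 unfolding touching_normal_def by blast
  have B: "ball (z2 - R *\<^sub>R n2) R \<inter> ball (z1 + R *\<^sub>R n1) R = {}"
    using 1 2 unfolding touching_normal_def by blast
  define a where "a = z1 - z2"
  define m where "m = R *\<^sub>R (n1 + n2)"
  have "2 * R \<le> norm (a - m)" "2 * R \<le> norm (a + m)"
    using disjoint_balls_dist[OF A R R] disjoint_balls_dist[OF B R R]
    by (auto simp: dist_norm a_def m_def algebra_simps norm_minus_commute)
  then have "(2*R)^2 + (2*R)^2 \<le> (norm (a - m))^2 + (norm (a+m))^2"
    using R by (intro add_mono power_mono) auto
  also have "\<dots> = 2 * (norm a)^2 + 2 * (norm m)^2"
    by (simp add: power2_norm_eq_inner inner_diff inner_add inner_commute)
  also have "(norm m)^2 = R^2 * (4 - (norm (n1 - n2))^2)"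
  proof -
    have "(norm (n1 + n2))^2 + (norm (n1-n2))^2 = 2*(norm n1)^2 + 2 * (norm n2)^2"
      by (simp add: power2_norm_eq_inner inner_diff inner_add inner_commute)
    then have "(norm (n1 + n2))^2 = 4 - (norm (n1-n2))^2" using n by simp
    then show ?thesis using R by (simp add: m_def power_mult_distrib)
  qed
  finally have "R^2 * (norm (n1 - n2))^2 \<le> (norm a)^2"
    by (simp add: algebra_simps power_mult_distrib)
  then have "(R * norm (n1 - n2))^2 \<le> (norm a)^2" by (simp add: power_mult_distrib)
  then have "R * norm (n1 - n2) \<le> norm a" using power2_le_imp_le norm_ge_zero by blast
  then show ?thesis using R by (simp add: field_simps a_def)
qed

lemma foot_normal_unit: "foot_normal R \<Omega> x n \<Longrightarrow> norm n = 1"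
  by (simp add: foot_normal_def touching_normal_def)

lemma bdist_lipschitz: "\<bar>bdist \<Omega> x - bdist \<Omega> y\<bar> \<le> norm (x - y)"
  using infdist_triangle_abs[of x "frontier \<Omega>" y] by (simp add: dist_norm)

lemma foot_normal_close:
  assumes 1: "foot_normal R \<Omega> x n" and 2: "foot_normal R \<Omega> y m" and d: "bdist \<Omega> y \<le> R/2"
  shows "norm (n - m) \<le> 4 / R * norm (x - y)"
proof -
  have R: "R > 0" by (rule bd_facts)
  let ?dx = "bdist \<Omega> x" and ?dy = "bdist \<Omega> y"
  have "R * norm (n - m) \<le> norm ((x + ?dx *\<^sub>R n) - (y + ?dy *\<^sub>R m))"
    using touching_normal_close[OF 1[unfolded foot_normal_def] 2[unfolded foot_normal_def]] R
    by (simp add: field_simps)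
  also have "(x + ?dx *\<^sub>R n) - (y + ?dy *\<^sub>R m) = (x - y) + ((?dx - ?dy) *\<^sub>R n + ?dy *\<^sub>R (n - m))"
    by (simp add: algebra_simps)
  also have "norm \<dots> \<le> norm (x - y) + (norm ((?dx - ?dy) *\<^sub>R n) + norm (?dy *\<^sub>R (n - m)))"
    by (meson norm_triangle_ineq order_trans add_left_mono)
  also have "\<dots> \<le> norm (x - y) + (norm (x - y) + R/2 * norm (n - m))"
    using bdist_lipschitz[of x y] foot_normal_unit[OF 1] d infdist_nonneg[of y]
      mult_right_mono[OF d norm_ge_zero[of "n - m"]]
    by (intro add_mono order_refl) auto
  finally show ?thesis using R by (simp add: field_simps)
qed

lemma foot_normal_lower:
  assumes x: "foot_normal R \<Omega> x n" and d: "bdist \<Omega> x \<le> R/2"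
    and w: "0 \<le> bdist \<Omega> x - n \<bullet> w - (norm w)^2 / R"
  shows "x + w \<in> \<Omega>" "bdist \<Omega> x - n \<bullet> w - (norm w)^2 / R \<le> bdist \<Omega> (x + w)"
proof -
  have R: "R > 0" by (rule bd_facts)
  define a where "a = R - bdist \<Omega> x"
  have a: "R/2 \<le> a" "a > 0" using d R by (auto simp: a_def)
  define c where "c = x + bdist \<Omega> x *\<^sub>R n - R *\<^sub>R n"
  have B: "ball c R \<subseteq> \<Omega>" using x unfolding foot_normal_def touching_normal_def c_def by blast
  have n: "n \<bullet> n = 1" using foot_normal_unit[OF x] by (simp add: norm_eq_1)
  have "(dist c (x + w))^2 = (norm (w + a *\<^sub>R n))^2"
    unfolding dist_norm c_def a_def by (subst norm_minus_commute) (simp add: algebra_simps)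
  also have "\<dots> = (norm w)^2 + 2 * a * (n \<bullet> w) + a^2"
    unfolding power2_norm_eq_inner using n
    by (simp add: inner_add inner_commute power2_eq_square algebra_simps)
  also have "\<dots> \<le> (a + n \<bullet> w + (norm w)^2 / R)^2"
  proof -
    have "R * (norm w)^2 \<le> (2*a) * (norm w)^2" using a R by (intro mult_right_mono) auto
    then have "(norm w)^2 \<le> 2 * a * ((norm w)^2 / R)" using R by (simp add: field_simps)
    moreover have "0 \<le> (n \<bullet> w + (norm w)^2/R)^2" by simp
    ultimately show ?thesis by (simp add: power2_eq_square algebra_simps)
  qed
  finally have *: "(dist c (x + w))^2 \<le> (a + n \<bullet> w + (norm w)^2 / R)^2" .
  have "0 \<le> a + n \<bullet> w + (norm w)^2 / R"
  proof -
    have nw: "\<bar>n \<bullet> w\<bar> \<le> norm w" using Cauchy_Schwarz_ineq2[of n w] foot_normal_unit[OF x] by simp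
    have "0 \<le> (norm w - R/2)^2 / R" using R by simp
    also have "\<dots> = (norm w)^2 / R - norm w + R/4" using R by (simp add: power2_eq_square field_simps)
    finally show ?thesis using nw a R by linarith
  qed
  then have **: "dist c (x + w) \<le> a + n \<bullet> w + (norm w)^2 / R"
    using * power2_le_imp_le by blast
  define e where "e = bdist \<Omega> x - n \<bullet> w - (norm w)^2 / R"
  have ce: "dist c (x + w) + e \<le> R" using ** by (simp add: e_def a_def)
  have "ball (x + w) e \<subseteq> ball c R"
    using ce by (intro subsetI) (smt (verit) dist_commute dist_triangle mem_ball)
  then have "ball (x + w) e \<subseteq> \<Omega>" using B by simp
  then show "bdist \<Omega> x - n \<bullet> w - (norm w)^2 / R \<le> bdist \<Omega> (x + w)"
    using bdist_ge_ball bd_facts(5) e_def by blast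
  have "closure (ball c R) \<subseteq> \<Omega>" using B bd_facts(2) by (simp add: closure_minimal)
  moreover have "x + w \<in> cball c R" using ce w by (simp add: e_def)
  ultimately show "x + w \<in> \<Omega>" using R by auto
qed

lemma foot_normal_upper:
  assumes x: "foot_normal R \<Omega> x n" and d: "bdist \<Omega> x \<le> R/2" and w: "x + w \<in> \<Omega>"
  shows "bdist \<Omega> (x + w) \<le> bdist \<Omega> x - n \<bullet> w + (norm w)^2 / R"
proof -
  have R: "R > 0" by (rule bd_facts)
  define a where "a = R + bdist \<Omega> x"
  have a: "a \<ge> R" using infdist_nonneg[of x "frontier \<Omega>"] by (simp add: a_def)
  define c where "c = x + bdist \<Omega> x *\<^sub>R n + R *\<^sub>R n"
  have B: "ball c R \<inter> \<Omega> = {}" using x unfolding foot_normal_def touching_normal_def c_def by blast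
  have n: "n \<bullet> n = 1" using foot_normal_unit[OF x] by (simp add: norm_eq_1)
  have "(dist (x + w) c)^2 = (norm (w - a *\<^sub>R n))^2"
    unfolding dist_norm c_def a_def by (simp add: algebra_simps)
  also have "\<dots> = (norm w)^2 - 2 * a * (n \<bullet> w) + a^2"
    unfolding power2_norm_eq_inner using n
    by (simp add: inner_diff inner_commute power2_eq_square algebra_simps)
  also have "\<dots> \<le> (a - n \<bullet> w + (norm w)^2 / R)^2"
  proof -
    have "R * (norm w)^2 \<le> (2*a) * (norm w)^2" using a R by (intro mult_right_mono) auto
    then have "(norm w)^2 \<le> 2 * a * ((norm w)^2 / R)" using R by (simp add: field_simps)
    moreover have "0 \<le> (- (n \<bullet> w) + (norm w)^2/R)^2" by simp
    ultimately show ?thesis by (simp add: power2_eq_square algebra_simps)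
  qed
  finally have *: "(dist (x + w) c)^2 \<le> (a - n \<bullet> w + (norm w)^2 / R)^2" .
  have "0 \<le> a - n \<bullet> w + (norm w)^2 / R"
  proof -
    have nw: "\<bar>n \<bullet> w\<bar> \<le> norm w" using Cauchy_Schwarz_ineq2[of n w] foot_normal_unit[OF x] by simp
    have "0 \<le> (norm w - R/2)^2 / R" using R by simp
    also have "\<dots> = (norm w)^2 / R - norm w + R/4" using R by (simp add: power2_eq_square field_simps)
    finally show ?thesis using nw a R by linarith
  qed
  then have "dist (x + w) c \<le> a - n \<bullet> w + (norm w)^2 / R"
    using * power2_le_imp_le by blast
  then show ?thesis using bdist_le_outside[OF w B R] by (simp add: a_def)
qed

lemma foot_normal_inner:
  assumes x: "foot_normal R \<Omega> x n" and d: "bdist \<Omega> x \<le> R/2" and w: "x + w \<in> \<Omega>"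
  shows "\<bar>bdist \<Omega> (x + w) - bdist \<Omega> x + n \<bullet> w\<bar> \<le> (norm w)^2 / R"
proof (cases "0 \<le> bdist \<Omega> x - n \<bullet> w - (norm w)^2 / R")
  case True
  then show ?thesis using foot_normal_upper[OF assms] foot_normal_lower(2)[OF x d True] by linarith
next
  case False
  then show ?thesis using foot_normal_upper[OF assms] infdist_nonneg[of "x+w" "frontier \<Omega>"] by linarith
qed

end

lemma sqrt_diff_le:
  fixes A B C h :: real
  assumes "0 \<le> A" "0 \<le> B" "0 \<le> h" "0 \<le> C" and AB: "\<bar>A - B\<bar> \<le> C * h * (sqrt B + h)"
  shows "\<bar>sqrt A - sqrt B\<bar> \<le> (2 * C + 1) * h"
proof (cases "h = 0 \<or> (A = 0 \<and> B = 0)")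
  case True then show ?thesis using assms by auto
next
  case False
  then have h: "h > 0" and s: "sqrt A + sqrt B > 0" using assms
    by (auto simp: less_le add_nonneg_eq_0_iff)
  have e: "\<bar>sqrt A - sqrt B\<bar> * (sqrt A + sqrt B) = \<bar>A - B\<bar>"
  proof -
    have "(sqrt A - sqrt B) * (sqrt A + sqrt B) = A - B" using assms by (simp add: algebra_simps)
    then show ?thesis using s by (metis abs_mult abs_of_pos)
  qed
  show ?thesis
  proof (cases "h \<le> sqrt B")
    case True
    have "\<bar>sqrt A - sqrt B\<bar> * sqrt B \<le> \<bar>A - B\<bar>"
      unfolding e[symmetric] using assms by (intro mult_left_mono) auto
    also have "\<dots> \<le> C * h * (sqrt B + sqrt B)" using AB True assms
      by (meson add_left_mono mult_left_mono mult_nonneg_nonneg order_trans)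
    finally have "\<bar>sqrt A - sqrt B\<bar> * sqrt B \<le> (2 * C * h) * sqrt B" by (simp add: algebra_simps)
    moreover have "sqrt B > 0" using True h by linarith
    ultimately have "\<bar>sqrt A - sqrt B\<bar> \<le> 2 * C * h" by (rule mult_right_le_imp_le)
    then show ?thesis using h by (simp add: algebra_simps)
  next
    case False
    have "\<bar>sqrt A - sqrt B\<bar>^2 \<le> \<bar>sqrt A - sqrt B\<bar> * (sqrt A + sqrt B)"
    proof -
      have "\<bar>sqrt A - sqrt B\<bar> \<le> sqrt A + sqrt B"
        using real_sqrt_ge_zero[OF assms(1)] real_sqrt_ge_zero[OF assms(2)] by linarith
      then show ?thesis unfolding power2_eq_square by (intro mult_left_mono) auto
    qed
    also have "\<dots> \<le> C * h * (sqrt B + h)" using e AB by simp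
    also have "\<dots> \<le> C * h * (h + h)" using False assms by (intro mult_left_mono) auto
    also have "\<dots> \<le> ((2 * C + 1) * h)^2"
    proof -
      have "0 \<le> (4 * C^2 + 2 * C + 1) * (h * h)" using assms by (intro mult_nonneg_nonneg) auto
      then show ?thesis by (simp add: power2_eq_square algebra_simps)
    qed
    finally show ?thesis using assms by (meson mult_nonneg_nonneg add_nonneg_nonneg zero_le_one power2_le_imp_le zero_le_numeral)
  qed
qed

lemma epow_mono: "0 \<le> a \<Longrightarrow> x \<le> y \<Longrightarrow> epow x a \<le> epow y a"
  unfolding epow_def
  by (auto simp: top_unique intro!: powr_mono2 ennreal_leI enn2real_mono simp: less_top)

lemma epow_ennreal [simp]: "0 \<le> x \<Longrightarrow> epow (ennreal x) a = ennreal (x powr a)"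
  by (simp add: epow_def)

lemma epow_top [simp]: "epow top a = top"
  by (simp add: epow_def)

lemma epow_0 [simp]: "epow 0 a = 0"
  by (simp add: epow_def)

lemma epow_inverse:
  assumes "0 < a" shows "epow (epow x a) (1 / a) = x" "epow (epow x (1 / a)) a = x"
  using assms by (cases x; simp add: powr_powr)+

lemma epow_mult:
  assumes "0 < a" shows "epow (x * y) a = epow x a * epow y a"
proof (cases "x = top \<or> y = top")
  case True
  have z: "epow z a = 0 \<longleftrightarrow> z = 0" for z using assms by (cases z) auto
  have "epow (top * z) a = top * epow z a" for z
    by (cases "z = 0") (simp_all add: ennreal_top_mult z)
  then show ?thesis using True by (metis mult.commute epow_top)
next
  case False
  then show ?thesis by (cases x; cases y) (auto simp: ennreal_mult[symmetric] powr_mult)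
qed

lemma measurable_epow [measurable]:
  assumes [measurable]: "f \<in> borel_measurable M" shows "(\<lambda>x. epow (f x) a) \<in> borel_measurable M"
  unfolding epow_def by measurable

lemma sum_le_card_mult:
  fixes x :: "'i \<Rightarrow> ennreal"
  assumes "finite I" "I \<noteq> {}" shows "\<exists>k\<in>I. sum x I \<le> of_nat (card I) * x k"
proof -
  obtain k where k: "k \<in> I" "x k = Max (x ` I)"
    using assms Max_in[of "x ` I"] by fastforce
  have "sum x I \<le> (\<Sum>i\<in>I. x k)" using assms k by (intro sum_mono) auto
  also have "\<dots> = of_nat (card I) * x k" by simp
  finally show ?thesis using k(1) by blast
qed

lemma closed_segment_mem: "closed_segment a b = (\<lambda>u. a + u *\<^sub>R (b - a)) ` {0..1::real}"
  by (auto simp: closed_segment_image_interval algebra_simps)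

lemma closed_segments_subset:
  fixes \<Omega> :: "'a::euclidean_space set"
  assumes "closed \<Omega>" shows "closed {p. closed_segment (fst p) (snd p) \<subseteq> \<Omega>}"
proof -
  have "{p. closed_segment (fst p) (snd p) \<subseteq> \<Omega>} =
      (\<Inter>u\<in>{0..1::real}. (\<lambda>p. fst p + u *\<^sub>R (snd p - fst p)) -` \<Omega>)"
    by (auto simp: closed_segment_mem)
  also have "closed \<dots>"
    by (intro closed_INT ballI closed_vimage assms continuous_intros)
  finally show ?thesis .
qed

lemma measurable_segment_pred [measurable]:
  fixes \<Omega> :: "'a::euclidean_space set"
  assumes \<Omega>: "closed \<Omega>" and [measurable]: "F \<in> borel_measurable M" "G \<in> borel_measurable M"
  shows "Measurable.pred M (\<lambda>x. closed_segment (F x) (G x) \<subseteq> \<Omega>)"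
proof -
  have [measurable]: "{p. closed_segment (fst p) (snd p) \<subseteq> \<Omega>} \<in> sets borel"
    using closed_segments_subset[OF \<Omega>] by simp
  have "Measurable.pred M (\<lambda>x. (F x, G x) \<in> {p. closed_segment (fst p) (snd p) \<subseteq> \<Omega>})"
    by measurable
  then show ?thesis by simp
qed

lemma measurable_fdiff_on:
  fixes \<Omega> :: "'a::euclidean_space set"
  assumes \<Omega>: "closed \<Omega>" and [measurable]: "f \<in> borel_measurable borel"
    "F \<in> borel_measurable M" "V \<in> borel_measurable M"
  shows "(\<lambda>x. fdiff_on r (V x) f \<Omega> (F x)) \<in> borel_measurable M"
proof -
  note [measurable] = measurable_segment_pred[OF \<Omega>]
  show ?thesis unfolding fdiff_on_def fdiff_def by measurable
qed

lemma nn_integral_lborel_affine: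
  fixes g :: "'a::euclidean_space \<Rightarrow> ennreal"
  assumes [measurable]: "g \<in> borel_measurable borel" and c: "c \<noteq> 0"
  shows "(\<integral>\<^sup>+x. g x \<partial>lborel) = ennreal (\<bar>c\<bar> ^ DIM('a)) * (\<integral>\<^sup>+x. g (t + c *\<^sub>R x) \<partial>lborel)"
  by (subst lborel_affine[OF c, of t])
     (simp add: nn_integral_density nn_integral_distr nn_integral_cmult)

lemma nn_integral_lborel_translate:
  fixes g :: "'a::euclidean_space \<Rightarrow> ennreal"
  assumes [measurable]: "g \<in> borel_measurable borel"
  shows "(\<integral>\<^sup>+x. g (t + x) \<partial>lborel) = (\<integral>\<^sup>+x. g x \<partial>lborel)"
  using nn_integral_lborel_affine[OF assms, of 1 t] by simp

lemma emeasure_affine_image: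
  fixes Z :: "'a::euclidean_space set"
  assumes Z: "compact Z" and c: "0 < c"
  shows "emeasure lborel ((\<lambda>x. t + c *\<^sub>R x) ` Z) = ennreal (c ^ DIM('a)) * emeasure lborel Z"
proof -
  let ?I = "(\<lambda>x. t + c *\<^sub>R x) ` Z"
  have "compact ?I" using Z by (intro compact_continuous_image continuous_intros)
  then have m: "?I \<in> sets borel" "Z \<in> sets borel" using Z by (auto intro: borel_compact)
  have "emeasure lborel ?I = (\<integral>\<^sup>+x. indicator ?I x \<partial>lborel)" using m by simp
  also have "\<dots> = ennreal (c ^ DIM('a)) * (\<integral>\<^sup>+x. indicator ?I (t + c *\<^sub>R x) \<partial>lborel)"
    using nn_integral_lborel_affine[of "indicator ?I" c t] m c by simp
  also have "(\<lambda>x. indicator ?I (t + c *\<^sub>R x)) = (indicator Z :: 'a \<Rightarrow> ennreal)"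
    using c by (auto simp: indicator_def fun_eq_iff)
  finally show ?thesis using m by simp
qed

section \<open>Admissible perturbations of a difference\<close>

definition slab :: "'a::euclidean_space \<Rightarrow> real \<Rightarrow> real \<Rightarrow> 'a set" where
  "slab n a b = {w. norm w \<le> a \<and> \<bar>n \<bullet> w\<bar> \<le> b}"

lemma compact_slab: "compact (slab n a b)"
proof -
  have "slab n a b = cball 0 a \<inter> {w. \<bar>n \<bullet> w\<bar> \<le> b}" by (auto simp: slab_def)
  moreover have "closed {w. \<bar>n \<bullet> w\<bar> \<le> b}"
    by (intro closed_Collect_le continuous_intros)
  ultimately show ?thesis by (simp add: compact_Int_closed)
qed

lemma ball_subset_slab:
  fixes n :: "'a::euclidean_space"
  assumes "norm n = 1" "e \<le> a" "e \<le> b" shows "ball 0 e \<subseteq> slab n a b"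
proof
  fix w :: 'a assume "w \<in> ball 0 e"
  moreover have "\<bar>n \<bullet> w\<bar> \<le> norm w" using Cauchy_Schwarz_ineq2[of n w] assms by simp
  ultimately show "w \<in> slab n a b" using assms by (auto simp: slab_def)
qed

lemma rho_add: "rho \<Omega> x (x + w) = norm w + \<bar>sqrt (bdist \<Omega> x) - sqrt (bdist \<Omega> (x + w))\<bar>"
  by (simp add: rho_def)

text \<open>The inward component \<open>5 r\<^sup>2 \<tau>\<^sup>2 / R\<close> of \<open>s\<close> outweighs both the rotation of the normal along the step
  \<open>a h\<close> and the quadratic error at \<open>c s\<close>.  The bound is linear in \<open>c\<close>, so it also works for \<open>c\<close> near 0, where
  \<open>\<xi> + a h\<close> may lie on the boundary.\<close>

lemma deeper_points:
  fixes r :: nat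
  assumes bd: "ball_domain R \<Omega>" and n: "foot_normal R \<Omega> \<xi> n" and D: "bdist \<Omega> \<xi> \<le> R/4"
    and \<tau>: "0 < \<tau>" "real r * \<tau> \<le> R/4" and r: "1 \<le> r" and h: "norm h \<le> \<tau>" and s: "norm s \<le> \<tau>"
    and ns: "n \<bullet> s \<le> - (5 * r^2 / R * \<tau>^2)" and a: "a \<in> {0..real r}" and c: "c \<in> {0..(real r)^2}"
    and y: "\<xi> + a *\<^sub>R h \<in> \<Omega>"
  shows "\<xi> + a *\<^sub>R h + c *\<^sub>R s \<in> \<Omega>"
    and "\<bar>bdist \<Omega> (\<xi> + a *\<^sub>R h + c *\<^sub>R s) - bdist \<Omega> (\<xi> + a *\<^sub>R h)\<bar>
          \<le> r^2 * (\<bar>n \<bullet> s\<bar> + 5 * r^2 / R * \<tau>^2)"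
proof -
  have R: "R > 0" using bd_facts[OF bd] by simp
  let ?y = "\<xi> + a *\<^sub>R h"
  obtain m where m: "foot_normal R \<Omega> ?y m" using foot_normal_exists[OF bd y] by auto
  have ah: "norm (a *\<^sub>R h) \<le> r * \<tau>" using a h \<tau> by (auto intro!: mult_mono)
  have Dy: "bdist \<Omega> ?y \<le> R/2"
    using bdist_lipschitz[OF bd, of ?y \<xi>] ah D \<tau> by auto
  have "norm (n - m) \<le> 4 / R * norm (a *\<^sub>R h)"
    using foot_normal_close[OF bd n m Dy] by simp
  also have "\<dots> \<le> 4 / R * (r * \<tau>)" using ah R by (intro mult_left_mono) auto
  finally have nm: "norm (n - m) \<le> 4 / R * (r * \<tau>)" .
  have "\<bar>(m - n) \<bullet> s\<bar> \<le> norm (n - m) * norm s"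
    using Cauchy_Schwarz_ineq2[of "m - n" s] by (simp add: norm_minus_commute)
  also have "\<dots> \<le> (4 / R * (r * \<tau>)) * \<tau>" using nm s \<tau> R by (intro mult_mono) auto
  finally have ms: "\<bar>m \<bullet> s - n \<bullet> s\<bar> \<le> 4 * r / R * \<tau>^2"
    by (simp add: inner_diff_left power2_eq_square algebra_simps)
  have rr: "real r \<le> (real r)^2" using r by (simp add: power2_eq_square)
  have cs: "c * (norm s)^2 / R \<le> r^2 / R * \<tau>^2"
  proof -
    have "c * (norm s)^2 \<le> r^2 * \<tau>^2" using c s \<tau> by (intro mult_mono power_mono) auto
    then show ?thesis using R by (simp add: divide_right_mono)
  qed
  have k: "4 * r / R * \<tau>^2 + r^2 / R * \<tau>^2 \<le> 5 * r^2 / R * \<tau>^2"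
  proof -
    have "(4 * r + r^2) * (\<tau>^2 / R) \<le> (5 * r^2) * (\<tau>^2 / R)"
      using rr R by (intro mult_right_mono) auto
    then show ?thesis by (simp add: add_divide_distrib algebra_simps)
  qed
  have e: "m \<bullet> (c *\<^sub>R s) + (norm (c *\<^sub>R s))^2 / R = c * (m \<bullet> s + c * (norm s)^2 / R)"
    by (simp add: power_mult_distrib power2_eq_square algebra_simps)
  have "c * (m \<bullet> s + c * (norm s)^2 / R) \<le> 0"
  proof (rule mult_nonneg_nonpos)
    have aux: "\<lbrakk>\<bar>M - N\<bar> \<le> A; C \<le> B; A + B \<le> K; N \<le> -K\<rbrakk> \<Longrightarrow> M + C \<le> 0" for M N A B C K :: real
      by linarith
    show "m \<bullet> s + c * (norm s)^2 / R \<le> 0" by (rule aux[OF ms cs k ns])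
  qed (use c in auto)
  then have low: "0 \<le> bdist \<Omega> ?y - m \<bullet> (c *\<^sub>R s) - (norm (c *\<^sub>R s))^2 / R"
    using e infdist_nonneg[of ?y "frontier \<Omega>"] by linarith
  show in\<Omega>: "?y + c *\<^sub>R s \<in> \<Omega>" using foot_normal_lower[OF bd m Dy low] by simp
  have "\<bar>bdist \<Omega> (?y + c *\<^sub>R s) - bdist \<Omega> ?y\<bar> \<le> \<bar>m \<bullet> (c *\<^sub>R s)\<bar> + (norm (c *\<^sub>R s))^2 / R"
    using foot_normal_inner[OF bd m Dy in\<Omega>] by linarith
  also have "\<dots> = c * (\<bar>m \<bullet> s\<bar> + c * (norm s)^2 / R)"
    using c by (simp add: abs_mult power_mult_distrib power2_eq_square algebra_simps)
  also have "\<dots> \<le> r^2 * (\<bar>n \<bullet> s\<bar> + 5 * r^2 / R * \<tau>^2)"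
  proof (rule mult_mono)
    have aux: "\<lbrakk>\<bar>M - N\<bar> \<le> A; C \<le> B; A + B \<le> K\<rbrakk> \<Longrightarrow> \<bar>M\<bar> + C \<le> \<bar>N\<bar> + K" for M N A B C K :: real
      by linarith
    show "\<bar>m \<bullet> s\<bar> + c * (norm s)^2 / R \<le> \<bar>n \<bullet> s\<bar> + 5 * r^2 / R * \<tau>^2" by (rule aux[OF ms cs k])
  qed (use c R in auto)
  finally show "\<bar>bdist \<Omega> (?y + c *\<^sub>R s) - bdist \<Omega> ?y\<bar> \<le> r^2 * (\<bar>n \<bullet> s\<bar> + 5 * r^2 / R * \<tau>^2)" .
qed

text \<open>The vectors \<open>s \<in> z + Z\<close> keep all differences in \<open>fdiff_perturb_le\<close> below inside \<open>\<Omega>\<close>, while \<open>Z\<close> is,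
  up to the dilation \<open>l\<close>, at least as large as the \<open>rho_ball\<close>s over which the local moduli average.\<close>

definition perturbations ::
  "'a::euclidean_space set \<Rightarrow> nat \<Rightarrow> 'a \<Rightarrow> 'a \<Rightarrow> real \<Rightarrow> real \<Rightarrow> 'a \<Rightarrow> 'a set \<Rightarrow> bool" where
  "perturbations \<Omega> r \<xi> h \<delta> l z Z \<longleftrightarrow> compact Z \<and> (\<exists>e>0. ball 0 e \<subseteq> Z) \<and>
     (\<forall>s\<in>(+) z ` Z.
        (\<forall>a\<in>{0..real r}. \<forall>c\<in>{0..(real r)^2}. \<xi> + a *\<^sub>R h + c *\<^sub>R s \<in> \<Omega>) \<and>
        (\<forall>i\<in>{1..r}. rho \<Omega> (\<xi> + real i *\<^sub>R h) (\<xi> + real i *\<^sub>R h + (real r * real i) *\<^sub>R s) \<le> \<delta>) \<and>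
        (\<forall>j\<in>{1..r}. rho \<Omega> \<xi> (\<xi> + real r *\<^sub>R (h + real j *\<^sub>R s)) \<le> \<delta>)) \<and>
     (\<forall>i\<le>r. rho_ball \<Omega> (\<xi> + real i *\<^sub>R h) \<delta> \<subseteq> (\<lambda>w. \<xi> + real i *\<^sub>R h + l *\<^sub>R w) ` Z)"

lemma perturbationsI:
  fixes r :: nat and \<tau> \<delta> A E l e :: real
  assumes r: "1 \<le> r" and Z: "compact Z" "0 < e" "ball 0 e \<subseteq> Z" and l: "0 < l"
    and \<tau>: "0 \<le> \<tau>" and h: "norm h \<le> \<tau>" and A: "0 \<le> A"
    and path: "\<And>i. i \<le> r \<Longrightarrow> \<bar>sqrt (bdist \<Omega> (\<xi> + real i *\<^sub>R h)) - sqrt (bdist \<Omega> \<xi>)\<bar> \<le> A * \<tau>"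
    and s: "\<And>w. w \<in> Z \<Longrightarrow> norm (z + w) \<le> \<tau>"
    and pts: "\<And>w a c. w \<in> Z \<Longrightarrow> a \<in> {0..real r} \<Longrightarrow> c \<in> {0..(real r)^2} \<Longrightarrow> \<xi> + a *\<^sub>R h + c *\<^sub>R (z + w) \<in> \<Omega>"
    and E: "\<And>w i c. w \<in> Z \<Longrightarrow> i \<le> r \<Longrightarrow> c \<in> {0..(real r)^2} \<Longrightarrow>
       \<bar>sqrt (bdist \<Omega> (\<xi> + real i *\<^sub>R h + c *\<^sub>R (z + w))) - sqrt (bdist \<Omega> (\<xi> + real i *\<^sub>R h))\<bar> \<le> E * \<tau>"
    and B: "\<And>i w. i \<le> r \<Longrightarrow> \<xi> + real i *\<^sub>R h + w \<in> rho_ball \<Omega> (\<xi> + real i *\<^sub>R h) \<delta> \<Longrightarrow> (1/l) *\<^sub>R w \<in> Z"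
    and \<delta>: "(2 * r^2 + E + A) * \<tau> \<le> \<delta>"
  shows "perturbations \<Omega> r \<xi> h \<delta> l z Z"
  unfolding perturbations_def
proof (intro conjI ballI allI impI)
  show "compact Z" "\<exists>e>0. ball 0 e \<subseteq> Z" using Z by auto
  have rr: "real r \<le> (real r)^2" using r by (simp add: power2_eq_square)
  fix s' assume "s' \<in> (+) z ` Z"
  then obtain w where w: "w \<in> Z" "s' = z + w" by auto
  show "\<xi> + a *\<^sub>R h + c *\<^sub>R s' \<in> \<Omega>" if "a \<in> {0..real r}" "c \<in> {0..(real r)^2}" for a c
    using pts[OF w(1) that] w by simp
  show "rho \<Omega> (\<xi> + real i *\<^sub>R h) (\<xi> + real i *\<^sub>R h + (real r * real i) *\<^sub>R s') \<le> \<delta>" if "i \<in> {1..r}" for i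
  proof -
    have c: "real r * real i \<in> {0..(real r)^2}" using that by (auto simp: power2_eq_square intro: mult_left_mono)
    have "norm ((real r * real i) *\<^sub>R s') \<le> r^2 * \<tau>" using c s[OF w(1)] w(2) \<tau>
      by (simp only: norm_scaleR) (intro mult_mono, auto)
    moreover have "r^2 * \<tau> \<le> 2 * r^2 * \<tau>" "0 \<le> A * \<tau>" using \<tau> A by auto
    ultimately show ?thesis
      unfolding rho_add using E[OF w(1) _ c] w(2) that \<delta> by (fastforce simp: algebra_simps)
  qed
  show "rho \<Omega> \<xi> (\<xi> + real r *\<^sub>R (h + real j *\<^sub>R s')) \<le> \<delta>" if "j \<in> {1..r}" for j
  proof -
    have c: "real r * real j \<in> {0..(real r)^2}" using that by (auto simp: power2_eq_square intro: mult_left_mono)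
    have e: "real r *\<^sub>R (h + real j *\<^sub>R s') = real r *\<^sub>R h + (real r * real j) *\<^sub>R s'" by (simp add: algebra_simps)
    have 1: "norm ((real r * real j) *\<^sub>R s') \<le> r^2 * \<tau>" using c s[OF w(1)] w(2) \<tau>
      by (simp only: norm_scaleR) (intro mult_mono, auto)
    have "norm (real r *\<^sub>R h) \<le> r * \<tau>" using h by (simp add: mult_left_mono)
    also have "\<dots> \<le> r^2 * \<tau>" using rr \<tau> by (intro mult_right_mono) auto
    finally have 2: "norm (real r *\<^sub>R h + (real r * real j) *\<^sub>R s') \<le> 2 * r^2 * \<tau>"
      using 1 norm_triangle_ineq[of "real r *\<^sub>R h" "(real r * real j) *\<^sub>R s'"] by linarith
    have 3: "\<bar>sqrt (bdist \<Omega> (\<xi> + real r *\<^sub>R h)) - sqrt (bdist \<Omega> \<xi>)\<bar> \<le> A * \<tau>" using path[of r] by simp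
    have 4: "\<bar>sqrt (bdist \<Omega> (\<xi> + real r *\<^sub>R h + (real r * real j) *\<^sub>R s')) - sqrt (bdist \<Omega> (\<xi> + real r *\<^sub>R h))\<bar> \<le> E * \<tau>"
      using E[OF w(1) order_refl c] w(2) by simp
    show ?thesis unfolding e rho_add using 2 3 4 \<delta> by (simp add: algebra_simps)
  qed
next
  fix i assume i: "i \<le> r"
  show "rho_ball \<Omega> (\<xi> + real i *\<^sub>R h) \<delta> \<subseteq> (\<lambda>w. \<xi> + real i *\<^sub>R h + l *\<^sub>R w) ` Z"
  proof
    fix \<eta> assume \<eta>: "\<eta> \<in> rho_ball \<Omega> (\<xi> + real i *\<^sub>R h) \<delta>"
    define w where "w = \<eta> - (\<xi> + real i *\<^sub>R h)"
    have "(1/l) *\<^sub>R w \<in> Z" using B[OF i, of w] \<eta> by (simp add: w_def)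
    moreover have "\<eta> = \<xi> + real i *\<^sub>R h + l *\<^sub>R ((1/l) *\<^sub>R w)" using l by (simp add: w_def)
    ultimately show "\<eta> \<in> (\<lambda>w. \<xi> + real i *\<^sub>R h + l *\<^sub>R w) ` Z" by blast
  qed
qed

lemma perturbations_exist:
  fixes r :: nat
  assumes r: "1 \<le> r" and R: "0 < R"
  shows "\<exists>\<tau>0::real. 0 < \<tau>0 \<and> \<tau>0 \<le> 1 \<and> (\<forall>C2\<ge>0. \<exists>c l::real. 0 < c \<and> 0 < l \<and>
    (\<forall>(\<Omega>::'a::euclidean_space set) \<xi> h \<tau>. ball_domain R \<Omega> \<longrightarrow> 0 < \<tau> \<longrightarrow> \<tau> \<le> \<tau>0 \<longrightarrow> norm h \<le> \<tau> \<longrightarrow>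
      (\<forall>a\<in>{0..real r}. \<xi> + a *\<^sub>R h \<in> \<Omega>) \<longrightarrow>
      (\<forall>i\<le>r. \<bar>sqrt (bdist \<Omega> (\<xi> + real i *\<^sub>R h)) - sqrt (bdist \<Omega> \<xi>)\<bar> \<le> C2 * \<tau>) \<longrightarrow>
      (\<exists>z Z. perturbations \<Omega> r \<xi> h (c * \<tau>) l z Z)))"
proof -
  define \<tau>0 where "\<tau>0 = min 1 (R / (20 * r^2))"
  have r1: "1 \<le> real r" and r2: "1 \<le> (real r)^2" and rr: "real r \<le> (real r)^2"
    using r by (auto simp: power2_eq_square intro!: mult_ge1_I)
  define K where "K = 5 * r^2 / R"
  define \<kappa> where "\<kappa> = 1 / (4 * (sqrt R + 2))"
  have K: "K > 0" using R r by (simp add: K_def)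
  have sR: "sqrt R > 0" using R by simp
  have \<kappa>: "0 < \<kappa>" "\<kappa> \<le> 1/4" "\<kappa> * (sqrt R + 1) \<le> 1/4"
    using sR by (auto simp: \<kappa>_def field_simps add_pos_pos)
  show ?thesis
  proof (rule exI[of _ \<tau>0], intro conjI allI impI)
    show "0 < \<tau>0" "\<tau>0 \<le> 1" using R r by (auto simp: \<tau>0_def)
    fix C2 :: real assume C2: "0 \<le> C2"
    define E where "E = 2 * (r^2 * (2*K + 2) * (1 + C2)) + 1 + (2 * (4 * r^2 / sqrt R) + 1)"
    define c where "c = 2 * r^2 + E + C2"
    define C3 where "C3 = c * (2 + 2 * C2 + c) + c^2 / R + 4 * r * c / R"
    define l where "l = (c + C3) / \<kappa>"
    have E0: "E > 0" using K C2 R sR by (auto simp: E_def intro!: add_nonneg_pos add_pos_nonneg)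
    have c0: "c > 0" using E0 C2 r2 by (simp add: c_def)
    have C30: "C3 \<ge> 0" using c0 C2 R by (simp add: C3_def)
    have l0: "l > 0" using c0 C30 \<kappa> by (simp add: l_def)
    show "\<exists>c l. 0 < c \<and> 0 < l \<and>
    (\<forall>(\<Omega>::'a set) \<xi> h \<tau>. ball_domain R \<Omega> \<longrightarrow> 0 < \<tau> \<longrightarrow> \<tau> \<le> \<tau>0 \<longrightarrow> norm h \<le> \<tau> \<longrightarrow>
      (\<forall>a\<in>{0..real r}. \<xi> + a *\<^sub>R h \<in> \<Omega>) \<longrightarrow>
      (\<forall>i\<le>r. \<bar>sqrt (bdist \<Omega> (\<xi> + real i *\<^sub>R h)) - sqrt (bdist \<Omega> \<xi>)\<bar> \<le> C2 * \<tau>) \<longrightarrow>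
      (\<exists>z Z. perturbations \<Omega> r \<xi> h (c * \<tau>) l z Z))"
    proof (rule exI[of _ c], rule exI[of _ l], intro conjI allI impI)
      show "0 < c" "0 < l" by fact+
      fix \<Omega> :: "'a set" and \<xi> h and \<tau> :: real
      assume bd: "ball_domain R \<Omega>" and \<tau>: "0 < \<tau>" "\<tau> \<le> \<tau>0" and h: "norm h \<le> \<tau>"
        and path: "\<forall>a\<in>{0..real r}. \<xi> + a *\<^sub>R h \<in> \<Omega>"
        and sq: "\<forall>i\<le>r. \<bar>sqrt (bdist \<Omega> (\<xi> + real i *\<^sub>R h)) - sqrt (bdist \<Omega> \<xi>)\<bar> \<le> C2 * \<tau>"
      have \<tau>1: "\<tau> \<le> 1" using \<tau> by (simp add: \<tau>0_def)
      have r2\<tau>: "r^2 * \<tau> \<le> R / 20"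
        using \<tau> r by (simp add: \<tau>0_def field_simps)
      have r\<tau>: "r * \<tau> \<le> R / 20" using r2\<tau> mult_right_mono[OF rr, of \<tau>] \<tau> unfolding of_nat_power by linarith
      have \<xi>: "\<xi> \<in> \<Omega>" using bspec[OF path, of 0] by simp
      let ?D = "bdist \<Omega> \<xi>"
      have D0: "?D \<ge> 0" by (rule infdist_nonneg)
      show "\<exists>z Z. perturbations \<Omega> r \<xi> h (c * \<tau>) l z Z"
      proof (cases "?D \<le> R/4")
        case True
        obtain n where n: "foot_normal R \<Omega> \<xi> n" using foot_normal_exists[OF bd \<xi>] by auto
        have n1: "norm n = 1" using foot_normal_unit[OF bd n] .
        then have nn: "n \<bullet> n = 1" by (simp add: norm_eq_1)
        define P where "P = sqrt ?D + \<tau>"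
        have P: "P \<ge> \<tau>" "P > 0" using D0 \<tau> by (auto simp: P_def intro: add_nonneg_pos)
        have PR: "P \<le> sqrt R + 1" unfolding P_def using True R \<tau>1
          by (intro add_mono real_sqrt_le_mono) auto
        define \<beta> where "\<beta> = \<kappa> * \<tau> * P"
        have \<beta>: "\<beta> > 0" using \<kappa> \<tau> P by (simp add: \<beta>_def)
        define z where "z = - (K * \<tau>^2 + \<beta>) *\<^sub>R n"
        define Z where "Z = slab n (\<kappa> * \<tau>) \<beta>"
        have ns: "n \<bullet> (z + w) \<le> - (K * \<tau>^2)" "\<bar>n \<bullet> (z + w)\<bar> \<le> K * \<tau>^2 + 2 * \<beta>" if "w \<in> Z" for w
        proof -
          have e: "n \<bullet> (z + w) = n \<bullet> w - (K * \<tau>^2 + \<beta>)" by (simp add: z_def inner_add_right nn)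
          have "\<bar>n \<bullet> w\<bar> \<le> \<beta>" using that by (simp add: Z_def slab_def)
          moreover have "0 \<le> K * \<tau>^2" using K by simp
          ultimately show "n \<bullet> (z + w) \<le> - (K * \<tau>^2)" "\<bar>n \<bullet> (z + w)\<bar> \<le> K * \<tau>^2 + 2 * \<beta>"
            unfolding e by linarith+
        qed
        have K\<tau>: "K * \<tau>^2 \<le> \<tau> / 4"
        proof -
          have "K * \<tau> \<le> 1/4" using r2\<tau> R by (simp add: K_def field_simps)
          then have "(K * \<tau>) * \<tau> \<le> 1/4 * \<tau>" using \<tau> by (intro mult_right_mono) auto
          then show ?thesis by (simp add: power2_eq_square)
        qed
        have \<beta>\<tau>: "\<beta> \<le> \<tau> / 4"
        proof -
          have "\<kappa> * P \<le> 1/4" using mult_left_mono[OF PR, of \<kappa>] \<kappa> by linarith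
          then have "(\<kappa> * P) * \<tau> \<le> 1/4 * \<tau>" using \<tau> by (intro mult_right_mono) auto
          then show ?thesis by (simp add: \<beta>_def algebra_simps)
        qed
        have s: "norm (z + w) \<le> \<tau>" if "w \<in> Z" for w
        proof -
          have "0 \<le> K * \<tau>^2" using K by simp
          then have "norm z = K * \<tau>^2 + \<beta>" using n1 \<beta> unfolding z_def norm_scaleR n1
            by (simp only: abs_minus_cancel mult_1_right abs_of_nonneg add_nonneg_nonneg less_imp_le)
          moreover have "norm w \<le> \<kappa> * \<tau>" using that by (simp add: Z_def slab_def)
          then have "norm w \<le> \<tau>/4" using mult_right_mono[OF \<kappa>(2), of \<tau>] \<tau> by linarith
          ultimately show ?thesis using norm_triangle_ineq[of z w] K\<tau> \<beta>\<tau> \<tau> by linarith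
        qed
        have dp: "\<xi> + a *\<^sub>R h + c' *\<^sub>R (z + w) \<in> \<Omega>"
          "\<bar>bdist \<Omega> (\<xi> + a *\<^sub>R h + c' *\<^sub>R (z + w)) - bdist \<Omega> (\<xi> + a *\<^sub>R h)\<bar>
            \<le> r^2 * (\<bar>n \<bullet> (z + w)\<bar> + K * \<tau>^2)"
          if "w \<in> Z" "a \<in> {0..real r}" "c' \<in> {0..(real r)^2}" for w a c'
        proof -
          have r4: "real r * \<tau> \<le> R / 4" using r\<tau> R by linarith
          have y: "\<xi> + a *\<^sub>R h \<in> \<Omega>" using path that(2) by blast
          note d = deeper_points[OF bd n True \<tau>(1) r4 r h s[OF that(1)] ns(1)[OF that(1), unfolded K_def] that(2,3) y]
          show "\<xi> + a *\<^sub>R h + c' *\<^sub>R (z + w) \<in> \<Omega>" by (rule d(1))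
          show "\<bar>bdist \<Omega> (\<xi> + a *\<^sub>R h + c' *\<^sub>R (z + w)) - bdist \<Omega> (\<xi> + a *\<^sub>R h)\<bar>
            \<le> r^2 * (\<bar>n \<bullet> (z + w)\<bar> + K * \<tau>^2)" unfolding K_def by (rule d(2))
        qed
        have sqi: "sqrt ?D \<le> sqrt (bdist \<Omega> (\<xi> + real i *\<^sub>R h)) + C2 * \<tau>"
          "sqrt (bdist \<Omega> (\<xi> + real i *\<^sub>R h)) \<le> sqrt ?D + C2 * \<tau>" if "i \<le> r" for i
          using sq that by fastforce+
        have \<tau>P: "\<tau>^2 \<le> \<tau> * P" using P \<tau> by (simp add: power2_eq_square)
        show ?thesis
        proof (intro exI[of _ z] exI[of _ Z] perturbationsI[where e = "min (\<kappa> * \<tau>) \<beta>" and \<tau> = \<tau> and E = E and A = C2])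
          show "ball 0 (min (\<kappa> * \<tau>) \<beta>) \<subseteq> Z" unfolding Z_def by (rule ball_subset_slab) (auto simp: n1)
          show "\<bar>sqrt (bdist \<Omega> (\<xi> + real i *\<^sub>R h + c' *\<^sub>R (z + w))) - sqrt (bdist \<Omega> (\<xi> + real i *\<^sub>R h))\<bar> \<le> E * \<tau>"
            if A: "w \<in> Z" "i \<le> r" "c' \<in> {0..(real r)^2}" for w i c'
          proof -
            let ?d = "bdist \<Omega> (\<xi> + real i *\<^sub>R h)"
            define E1 where "E1 = r^2 * (2*K + 2)"
            have E1: "E1 \<ge> 0" using K by (simp add: E1_def)
            have \<kappa>1: "\<kappa> * (\<tau> * P) \<le> \<tau> * P" using \<kappa> \<tau> P by (intro mult_left_le_one_le) auto
            have "\<bar>bdist \<Omega> (\<xi> + real i *\<^sub>R h + c' *\<^sub>R (z + w)) - ?d\<bar> \<le> r^2 * (\<bar>n \<bullet> (z + w)\<bar> + K * \<tau>^2)"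
              using A by (intro dp) auto
            also have "\<dots> \<le> r^2 * (K * (\<tau>*P) + 2 * (\<kappa> * (\<tau> * P)) + K * (\<tau> * P))"
            proof -
              have "\<beta> = \<kappa> * (\<tau> * P)" "K * \<tau>^2 \<le> K * (\<tau> * P)"
                using mult_left_mono[OF \<tau>P, of K] K by (auto simp: \<beta>_def)
              then have "\<bar>n \<bullet> (z + w)\<bar> + K * \<tau>^2 \<le> K * (\<tau>*P) + 2 * (\<kappa> * (\<tau> * P)) + K * (\<tau> * P)"
                using ns(2)[OF A(1)] by linarith
              then show ?thesis by (intro mult_left_mono) auto
            qed
            also have "\<dots> \<le> r^2 * (K * (\<tau>*P) + 2 * (\<tau> * P) + K * (\<tau> * P))"
              using \<kappa>1 by (intro mult_left_mono) auto
            also have "\<dots> = E1 * (\<tau> * P)" by (simp add: E1_def algebra_simps)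
            also have "\<dots> \<le> E1 * (\<tau> * ((1 + C2) * (sqrt ?d + \<tau>)))"
            proof -
              have "P \<le> sqrt ?d + C2 * \<tau> + \<tau>" using sqi(1)[OF A(2)] by (simp add: P_def)
              also have "\<dots> \<le> (1 + C2) * (sqrt ?d + \<tau>)"
                using C2 infdist_nonneg[of "\<xi> + real i *\<^sub>R h" "frontier \<Omega>"] by (simp add: algebra_simps)
              finally show ?thesis using E1 \<tau> by (intro mult_left_mono) auto
            qed
            also have "\<dots> = (E1 * (1 + C2)) * \<tau> * (sqrt ?d + \<tau>)" by (simp add: algebra_simps)
            finally have "\<bar>sqrt (bdist \<Omega> (\<xi> + real i *\<^sub>R h + c' *\<^sub>R (z + w))) - sqrt ?d\<bar> \<le> (2 * (E1 * (1 + C2)) + 1) * \<tau>"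
              using E1 C2 \<tau> by (intro sqrt_diff_le infdist_nonneg) auto
            also have "\<dots> \<le> E * \<tau>" using \<tau> sR by (intro mult_right_mono) (auto simp: E_def E1_def)
            finally show ?thesis .
          qed
          show "(1 / l) *\<^sub>R w \<in> Z"
            if i: "i \<le> r" and A: "\<xi> + real i *\<^sub>R h + w \<in> rho_ball \<Omega> (\<xi> + real i *\<^sub>R h) (c * \<tau>)" for i w
          proof -
            let ?y = "\<xi> + real i *\<^sub>R h"
            let ?d = "bdist \<Omega> ?y" and ?d' = "bdist \<Omega> (?y + w)"
            have w\<Omega>: "?y + w \<in> \<Omega>" and w1: "norm w \<le> c * \<tau>"
              and w2: "\<bar>sqrt ?d' - sqrt ?d\<bar> \<le> c * \<tau>"
              using A norm_ge_zero[of w] unfolding rho_ball_def mem_Collect_eq rho_add by linarith+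
            have y\<Omega>: "?y \<in> \<Omega>" using path i by auto
            obtain m where m: "foot_normal R \<Omega> ?y m" using foot_normal_exists[OF bd y\<Omega>] by auto
            have ih: "norm (real i *\<^sub>R h) \<le> r * \<tau>" using i h \<tau> by (auto intro!: mult_mono)
            have dR: "?d \<le> R/2" using bdist_lipschitz[OF bd, of ?y \<xi>] ih True r\<tau> R by auto
            have d0: "?d \<ge> 0" "?d' \<ge> 0" by (auto intro: infdist_nonneg)
            have "\<bar>?d' - ?d\<bar> = \<bar>sqrt ?d' - sqrt ?d\<bar> * (sqrt ?d' + sqrt ?d)"
            proof -
              have "?d' - ?d = (sqrt ?d' - sqrt ?d) * (sqrt ?d' + sqrt ?d)" using d0 by (simp add: algebra_simps)
              then show ?thesis using d0 by (metis abs_mult abs_of_nonneg add_nonneg_nonneg real_sqrt_ge_zero)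
            qed
            also have "\<dots> \<le> (c * \<tau>) * ((2 + 2 * C2 + c) * P)"
            proof (rule mult_mono[OF w2])
              have "sqrt ?d' + sqrt ?d \<le> 2 * sqrt ?D + 2 * C2 * \<tau> + c * \<tau>"
                using w2 sqi(2)[OF i] by linarith
              also have "\<dots> \<le> 2 * P + 2 * C2 * P + c * P"
                using P C2 c0 \<tau> by (intro add_mono mult_left_mono) (auto simp: P_def)
              finally show "sqrt ?d' + sqrt ?d \<le> (2 + 2 * C2 + c) * P" by (simp add: algebra_simps)
            qed (use c0 \<tau> d0 in auto)
            finally have 1: "\<bar>?d' - ?d\<bar> \<le> c * (2 + 2 * C2 + c) * (\<tau> * P)" by (simp add: algebra_simps)
            have "(norm w)^2 \<le> (c * \<tau>)^2" using w1 by (intro power_mono) auto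
            also have "\<dots> \<le> c^2 * (\<tau> * P)" using \<tau>P by (simp add: power_mult_distrib mult_left_mono)
            finally have 2: "(norm w)^2 / R \<le> c^2 / R * (\<tau> * P)" using R by (simp add: field_simps)
            have 3: "\<bar>m \<bullet> w\<bar> \<le> c * (2 + 2 * C2 + c) * (\<tau> * P) + c^2 / R * (\<tau> * P)"
              using foot_normal_inner[OF bd m dR w\<Omega>] 1 2 by linarith
            have "norm (n - m) \<le> 4 / R * norm (\<xi> - ?y)" by (rule foot_normal_close[OF bd n m dR])
            also have "\<dots> \<le> 4 / R * (r * \<tau>)" using ih R by (intro mult_left_mono) auto
            finally have nm: "norm (n - m) \<le> 4 / R * (r * \<tau>)" .
            have "\<bar>(n - m) \<bullet> w\<bar> \<le> norm (n - m) * norm w" by (rule Cauchy_Schwarz_ineq2)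
            also have "\<dots> \<le> (4 / R * (r * \<tau>)) * (c * \<tau>)" using nm w1 c0 \<tau> R by (intro mult_mono) auto
            also have "\<dots> = (4 * r * c / R) * \<tau>^2" by (simp add: power2_eq_square)
            also have "\<dots> \<le> (4 * r * c / R) * (\<tau> * P)" using \<tau>P c0 R by (intro mult_left_mono) auto
            finally have "\<bar>n \<bullet> w\<bar> \<le> C3 * (\<tau> * P)"
              using 3 unfolding C3_def by (simp add: inner_diff_left algebra_simps)
            also have "\<dots> \<le> (c + C3) * (\<tau> * P)" using c0 \<tau> P by (intro mult_right_mono) auto
            also have "\<dots> = l * \<beta>" using \<kappa> by (simp add: l_def \<beta>_def)
            finally have nw: "\<bar>n \<bullet> w\<bar> \<le> l * \<beta>" .
            have "norm w \<le> (c + C3) * \<tau>" using w1 mult_right_mono[of c "c + C3" \<tau>] C30 \<tau> by linarith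
            also have "\<dots> = l * (\<kappa> * \<tau>)" using \<kappa> by (simp add: l_def)
            finally show ?thesis using nw l0 by (simp add: Z_def slab_def field_simps abs_mult)
          qed
          show "(2 * r^2 + E + C2) * \<tau> \<le> c * \<tau>" by (simp add: c_def)
        qed (use r l0 \<tau> h C2 sq s dp \<kappa> \<beta> in \<open>auto simp: Z_def compact_slab\<close>)
      next
        case False
        have deep: "bdist \<Omega> (\<xi> + a *\<^sub>R h) \<ge> R/16" if "a \<in> {0..real r}" for a
        proof -
          have "norm (a *\<^sub>R h) \<le> r * \<tau>" using that h \<tau> by (auto intro!: mult_mono)
          then show ?thesis using bdist_lipschitz[OF bd, of "\<xi> + a *\<^sub>R h" \<xi>] False r\<tau> R by auto
        qed
        have cw: "norm (c' *\<^sub>R w) \<le> r^2 * \<tau>" if "w \<in> cball 0 \<tau>" "c' \<in> {0..(real r)^2}" for c' and w :: 'a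
          using that \<tau> by (auto intro!: mult_mono)
        show ?thesis
        proof (rule exI[of _ 0], rule exI[of _ "cball 0 \<tau>"], rule perturbationsI[where e = \<tau> and \<tau> = \<tau> and E = E and A = C2])
          show "\<xi> + a *\<^sub>R h + c' *\<^sub>R (0 + w) \<in> \<Omega>" if A: "w \<in> cball 0 \<tau>" "a \<in> {0..real r}" "c' \<in> {0..(real r)^2}" for w a c'
          proof -
            have "\<xi> + a *\<^sub>R h + c' *\<^sub>R (0 + w) \<in> ball (\<xi> + a *\<^sub>R h) (R/16)"
              using cw[OF A(1,3)] r2\<tau> R by (simp add: dist_norm)
            then show ?thesis using ball_bdist_subset[OF _ deep[OF A(2)]] path A by blast
          qed
          show "\<bar>sqrt (bdist \<Omega> (\<xi> + real i *\<^sub>R h + c' *\<^sub>R (0 + w))) - sqrt (bdist \<Omega> (\<xi> + real i *\<^sub>R h))\<bar> \<le> E * \<tau>"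
            if A: "w \<in> cball 0 \<tau>" "i \<le> r" "c' \<in> {0..(real r)^2}" for w i c'
          proof -
            let ?d = "bdist \<Omega> (\<xi> + real i *\<^sub>R h)"
            have "R/16 \<le> ?d" using A by (intro deep) auto
            then have "sqrt (R/16) \<le> sqrt ?d" by (rule real_sqrt_le_mono)
            then have d: "sqrt R / 4 \<le> sqrt ?d" by (simp add: real_sqrt_divide)
            have "\<bar>bdist \<Omega> (\<xi> + real i *\<^sub>R h + c' *\<^sub>R (0 + w)) - ?d\<bar> \<le> r^2 * \<tau>"
              using bdist_lipschitz[OF bd, of "\<xi> + real i *\<^sub>R h + c' *\<^sub>R (0 + w)" "\<xi> + real i *\<^sub>R h"] cw[OF A(1,3)] by simp
            also have "\<dots> = (4 * r^2 / sqrt R) * \<tau> * (sqrt R / 4)" using sR by simp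
            also have "\<dots> \<le> (4 * r^2 / sqrt R) * \<tau> * (sqrt ?d + \<tau>)"
              using d sR \<tau> by (intro mult_left_mono) auto
            finally have "\<bar>sqrt (bdist \<Omega> (\<xi> + real i *\<^sub>R h + c' *\<^sub>R (0 + w))) - sqrt ?d\<bar> \<le> (2 * (4 * r^2 / sqrt R) + 1) * \<tau>"
              using \<tau> sR by (intro sqrt_diff_le infdist_nonneg) auto
            also have "\<dots> \<le> E * \<tau>" using \<tau> K C2 by (intro mult_right_mono) (auto simp: E_def)
            finally show ?thesis .
          qed
          show "(1 / l) *\<^sub>R w \<in> cball 0 \<tau>"
            if i: "i \<le> r" and A: "\<xi> + real i *\<^sub>R h + w \<in> rho_ball \<Omega> (\<xi> + real i *\<^sub>R h) (c * \<tau>)" for i w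
          proof -
            have "norm w \<le> c * \<tau>" using A unfolding rho_ball_def by (auto simp: rho_add)
            also have "\<dots> \<le> l * \<tau>"
            proof (rule mult_right_mono)
              have "c * \<kappa> \<le> c + C3" using \<kappa> c0 C30 mult_left_mono[of \<kappa> 1 c] by linarith
              then show "c \<le> l" using \<kappa> by (simp add: l_def field_simps)
            qed (use \<tau> in auto)
            finally show ?thesis using l0 by (simp add: field_simps)
          qed
          show "(2 * r^2 + E + C2) * \<tau> \<le> c * \<tau>" by (simp add: c_def)
        qed (use r l0 \<tau> h C2 sq in auto)
      qed
    qed
  qed
qed

section \<open>Differences bounded by local averages\<close>

lemma fdiff_double_sum:
  fixes f :: "'a::real_vector \<Rightarrow> real"
  assumes r: "1 \<le> r"
  shows "(-1)^r * fdiff r h f \<xi> =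
    (\<Sum>i=1..r. (-1)^(r+i) * real (r choose i) * fdiff r (real i *\<^sub>R s) f (\<xi> + real i *\<^sub>R h)) -
    (\<Sum>j=1..r. (-1)^(r+j) * real (r choose j) * fdiff r (h + real j *\<^sub>R s) f \<xi>)"
proof -
  define b where "b i = (-1)^(r+i) * real (r choose i)" for i
  have split: "sum g {0..r} = g 0 + sum g {1..r}" for g :: "nat \<Rightarrow> real"
    by (simp add: sum.atLeast_Suc_atMost)
  have b0: "b 0 = (-1)^r" by (simp add: b_def)
  have sb: "(\<Sum>i=0..r. b i) = 0"
  proof -
    have "(\<Sum>i\<le>r. (-1)^i * real (r choose i)) = 0" using r by (intro choose_alternating_sum) auto
    then have "(-1)^r * (\<Sum>i\<le>r. (-1)^i * real (r choose i)) = 0" by simp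
    then show ?thesis by (simp add: b_def sum_distrib_left power_add atLeast0AtMost mult.assoc)
  qed
  have "(\<Sum>i=0..r. b i * fdiff r (real i *\<^sub>R s) f (\<xi> + real i *\<^sub>R h))
      = (\<Sum>i=0..r. \<Sum>j=0..r. b i * b j * f (\<xi> + real i *\<^sub>R h + real j *\<^sub>R real i *\<^sub>R s))"
    by (simp add: fdiff_def b_def sum_distrib_left mult.assoc)
  also have "\<dots> = (\<Sum>j=0..r. \<Sum>i=0..r. b i * b j * f (\<xi> + real i *\<^sub>R h + real j *\<^sub>R real i *\<^sub>R s))"
    by (rule sum.swap)
  also have "\<dots> = (\<Sum>j=0..r. b j * fdiff r (h + real j *\<^sub>R s) f \<xi>)"
    unfolding fdiff_def b_def[symmetric] sum_distrib_left
    by (intro sum.cong refl) (simp add: algebra_simps)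
  finally have "b 0 * fdiff r (real 0 *\<^sub>R s) f (\<xi> + real 0 *\<^sub>R h)
      + (\<Sum>i=1..r. b i * fdiff r (real i *\<^sub>R s) f (\<xi> + real i *\<^sub>R h))
      = b 0 * fdiff r (h + real 0 *\<^sub>R s) f \<xi> + (\<Sum>j=1..r. b j * fdiff r (h + real j *\<^sub>R s) f \<xi>)"
    unfolding split .
  moreover have "fdiff r (real 0 *\<^sub>R s) f (\<xi> + real 0 *\<^sub>R h) = 0"
    using sb by (simp add: fdiff_def b_def[symmetric] sum_distrib_right[symmetric])
  ultimately show ?thesis by (simp add: b0 b_def)
qed

lemma choose_abs_le: "\<bar>(-1)^(r+i) * real (r choose i)\<bar> \<le> 2^r"
proof -
  have "real (r choose i) \<le> real (2^r)" by (simp only: of_nat_le_iff binomial_le_pow2)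
  then show ?thesis by (simp add: abs_mult)
qed

lemma fdiff_perturb_le:
  fixes f :: "'a::real_vector \<Rightarrow> real"
  assumes r: "1 \<le> r"
  shows "\<bar>fdiff r h f \<xi>\<bar> \<le> 2^r * ((\<Sum>i=1..r. \<bar>fdiff r (real i *\<^sub>R s) f (\<xi> + real i *\<^sub>R h)\<bar>)
    + (\<Sum>j=1..r. \<bar>fdiff r (h + real j *\<^sub>R s) f \<xi>\<bar>))"
proof -
  have b: "\<bar>\<Sum>i=1..r. (-1)^(r+i) * real (r choose i) * g i\<bar> \<le> 2^r * (\<Sum>i=1..r. \<bar>g i\<bar>)" for g
  proof -
    have "\<bar>\<Sum>i=1..r. (-1)^(r+i) * real (r choose i) * g i\<bar> \<le> (\<Sum>i=1..r. \<bar>(-1)^(r+i) * real (r choose i) * g i\<bar>)"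
      by (rule sum_abs)
    also have "\<dots> \<le> (\<Sum>i=1..r. 2^r * \<bar>g i\<bar>)"
      unfolding abs_mult[of _ "g _"] by (intro sum_mono mult_right_mono choose_abs_le) auto
    finally show ?thesis by (simp add: sum_distrib_left)
  qed
  have "\<bar>fdiff r h f \<xi>\<bar> = \<bar>(-1)^r * fdiff r h f \<xi>\<bar>" by (simp add: abs_mult)
  then show ?thesis unfolding fdiff_double_sum[OF r, of h f \<xi> s]
    using b[of "\<lambda>i. fdiff r (real i *\<^sub>R s) f (\<xi> + real i *\<^sub>R h)"] b[of "\<lambda>j. fdiff r (h + real j *\<^sub>R s) f \<xi>"]
    by (simp add: distrib_left)
qed

definition ldiff :: "'a::euclidean_space set \<Rightarrow> nat \<Rightarrow> ('a \<Rightarrow> real) \<Rightarrow> 'a \<Rightarrow> 'a \<Rightarrow> ennreal" where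
  "ldiff \<Omega> r f x \<eta> = ennreal \<bar>fdiff_on r ((\<eta> - x) /\<^sub>R real r) f \<Omega> x\<bar>"

lemma local_modulus_top: "local_modulus \<Omega> r f x \<delta> \<infinity> = (SUP \<eta>\<in>rho_ball \<Omega> x \<delta>. ldiff \<Omega> r f x \<eta>)"
  by (simp add: local_modulus_def ldiff_def)

lemma local_modulus_fin: "q \<noteq> \<infinity> \<Longrightarrow> local_modulus \<Omega> r f x \<delta> q =
   epow ((\<integral>\<^sup>+\<eta>\<in>rho_ball \<Omega> x \<delta>. epow (ldiff \<Omega> r f x \<eta>) (enn2real q) \<partial>lborel)
      / emeasure lebesgue (rho_ball \<Omega> x \<delta>)) (1 / enn2real q)"
  by (simp add: local_modulus_def ldiff_def nn_integral_completion Let_def)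

lemma measurable_ldiff:
  fixes \<Omega> :: "'a::euclidean_space set"
  assumes "closed \<Omega>" "f \<in> borel_measurable borel" and [measurable]: "F \<in> borel_measurable M" "G \<in> borel_measurable M"
  shows "(\<lambda>x. ldiff \<Omega> r f (F x) (G x)) \<in> borel_measurable M"
  unfolding ldiff_def
  by (intro measurable_ennreal[THEN measurable_compose_rev] borel_measurable_abs measurable_fdiff_on[OF assms(1,2)])
     measurable

lemma ldiff_eq:
  assumes "1 \<le> r" and "\<And>u. u \<in> {0..1} \<Longrightarrow> x + (real r * u) *\<^sub>R v \<in> \<Omega>"
  shows "ldiff \<Omega> r f x (x + real r *\<^sub>R v) = ennreal \<bar>fdiff r v f x\<bar>"
proof -
  have "closed_segment x (x + real r *\<^sub>R v) \<subseteq> \<Omega>"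
    using assms(2) by (auto simp: closed_segment_mem mult.commute)
  then show ?thesis using assms(1) by (simp add: ldiff_def fdiff_on_def)
qed

lemma closed_rho_ball:
  fixes \<Omega> :: "'a::euclidean_space set"
  assumes "closed \<Omega>" shows "closed (rho_ball \<Omega> x \<delta>)"
proof -
  have "rho_ball \<Omega> x \<delta> = \<Omega> \<inter> {\<eta>. rho \<Omega> x \<eta> \<le> \<delta>}" by (auto simp: rho_ball_def)
  moreover have "closed {\<eta>. rho \<Omega> x \<eta> \<le> \<delta>}"
    unfolding rho_def by (intro closed_Collect_le continuous_intros)
  ultimately show ?thesis using assms by auto
qed

lemma local_modulus_mass:
  fixes \<Omega> :: "'a::euclidean_space set"
  assumes q: "0 < q" "q \<noteq> \<infinity>" and fin: "emeasure lborel (rho_ball \<Omega> x \<delta>) < \<infinity>" and \<Omega>: "closed \<Omega>"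
  shows "(\<integral>\<^sup>+\<eta>\<in>rho_ball \<Omega> x \<delta>. epow (ldiff \<Omega> r f x \<eta>) (enn2real q) \<partial>lborel)
    \<le> emeasure lborel (rho_ball \<Omega> x \<delta>) * epow (local_modulus \<Omega> r f x \<delta> q) (enn2real q)"
proof -
  let ?U = "rho_ball \<Omega> x \<delta>"
  let ?I = "\<integral>\<^sup>+\<eta>\<in>?U. epow (ldiff \<Omega> r f x \<eta>) (enn2real q) \<partial>lborel"
  have U: "?U \<in> sets borel" using closed_rho_ball[OF \<Omega>] by auto
  have q0: "enn2real q > 0" using q by (simp add: enn2real_positive_iff less_top)
  have e: "epow (local_modulus \<Omega> r f x \<delta> q) (enn2real q) = ?I / emeasure lborel ?U"
    unfolding local_modulus_fin[OF q(2)] epow_inverse(2)[OF q0] using U by simp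
  show ?thesis
  proof (cases "emeasure lborel ?U = 0")
    case True
    have "?I = (\<integral>\<^sup>+(\<eta>::'a). 0 \<partial>lborel)"
    proof (rule nn_integral_cong_AE)
      have "?U \<in> null_sets lborel" using True U by (auto simp: null_sets_def)
      then have "AE \<eta> in lborel. \<eta> \<notin> ?U" by (rule AE_not_in)
      then show "AE \<eta> in lborel. epow (ldiff \<Omega> r f x \<eta>) (enn2real q) * indicator ?U \<eta> = 0"
        by eventually_elim auto
    qed
    then show ?thesis by simp
  next
    case False
    have "emeasure lborel ?U * (?I / emeasure lborel ?U) = ?I"
      using False fin by (simp add: ennreal_times_divide mult_divide_eq_ennreal mult.commute[of "emeasure lborel ?U"])
    then show ?thesis unfolding e by simp
  qed
qed

lemma perturb_estimate:
  fixes \<Omega> :: "'a::euclidean_space set"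
  assumes \<Omega>: "closed \<Omega>" and r: "1 \<le> r" and l: "0 < l"
    and P: "perturbations \<Omega> r \<xi> h \<delta> l z Z" and f: "f \<in> borel_measurable borel" and q: "0 < q"
  shows "\<exists>i\<le>r. ennreal \<bar>fdiff r h f \<xi>\<bar>
     \<le> ennreal (2^r * real (2*r)) * epow (ennreal (l ^ DIM('a)) * of_nat (2*r)) (1 / enn2real q)
        * local_modulus \<Omega> r f (\<xi> + real i *\<^sub>R h) \<delta> q"
proof -
  let ?S = "(+) z ` Z"
  let ?W = "\<lambda>i. local_modulus \<Omega> r f (\<xi> + real i *\<^sub>R h) \<delta> q"
  let ?x = "\<lambda>i. \<xi> + real i *\<^sub>R h"
  obtain e where Z: "compact Z" "0 < e" "ball 0 e \<subseteq> Z" using P by (auto simp: perturbations_def)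
  have pts: "\<And>s a c. s \<in> ?S \<Longrightarrow> a \<in> {0..real r} \<Longrightarrow> c \<in> {0..(real r)^2} \<Longrightarrow> \<xi> + a *\<^sub>R h + c *\<^sub>R s \<in> \<Omega>"
    and rho1: "\<And>s i. s \<in> ?S \<Longrightarrow> i \<in> {1..r} \<Longrightarrow> rho \<Omega> (?x i) (?x i + (real r * real i) *\<^sub>R s) \<le> \<delta>"
    and rho2: "\<And>s j. s \<in> ?S \<Longrightarrow> j \<in> {1..r} \<Longrightarrow> rho \<Omega> \<xi> (\<xi> + real r *\<^sub>R (h + real j *\<^sub>R s)) \<le> \<delta>"
    and U: "\<And>i. i \<le> r \<Longrightarrow> rho_ball \<Omega> (?x i) \<delta> \<subseteq> (\<lambda>w. ?x i + l *\<^sub>R w) ` Z"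
    using P unfolding perturbations_def by blast+
  define base :: "bool \<times> nat \<Rightarrow> nat" where "base k = (if fst k then snd k else 0)" for k
  define off :: "bool \<times> nat \<Rightarrow> 'a" where "off k = (if fst k then 0 else real r *\<^sub>R h)" for k
  define g where "g k s = ldiff \<Omega> r f (?x (base k)) (?x (base k) + off k + (real r * real (snd k)) *\<^sub>R s)" for k s
  let ?I = "(UNIV :: bool set) \<times> {1..r}"
  have I: "finite ?I" "?I \<noteq> {}" "card ?I = 2 * r" using r by (auto simp: card_cartesian_product)
  have base: "base k \<le> r" if "k \<in> ?I" for k using that by (auto simp: base_def)
  have gU: "?x (base k) + off k + (real r * real (snd k)) *\<^sub>R s \<in> rho_ball \<Omega> (?x (base k)) \<delta>"
    if k: "k \<in> ?I" and s: "s \<in> ?S" for k s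
  proof -
    obtain b i where ki: "k = (b, i)" "i \<in> {1..r}" using k by auto
    have c: "real r * real i \<in> {0..(real r)^2}" using ki by (auto simp: power2_eq_square intro: mult_left_mono)
    show ?thesis
      using pts[OF s, of "real i", OF _ c] pts[OF s, of "real r", OF _ c] rho1[OF s ki(2)] rho2[OF s ki(2)] ki
      by (cases b) (auto simp: rho_ball_def base_def off_def algebra_simps)
  qed
  have main: "ennreal \<bar>fdiff r h f \<xi>\<bar> \<le> ennreal (2^r) * (\<Sum>k\<in>?I. g k s)" if s: "s \<in> ?S" for s
  proof -
    have g1: "g (True, i) s = ennreal \<bar>fdiff r (real i *\<^sub>R s) f (?x i)\<bar>" if i: "i \<in> {1..r}" for i
    proof -
      have "?x i + (real r * u) *\<^sub>R real i *\<^sub>R s \<in> \<Omega>" if "u \<in> {0..1}" for u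
      proof -
        have "u * (real r * real i) \<le> 1 * (real r * real r)" using that i by (intro mult_mono) auto
        then show ?thesis using pts[OF s, of "real i" "real r * u * real i"] i that by (auto simp: power2_eq_square ac_simps)
      qed
      from ldiff_eq[OF r this, of f] show ?thesis by (simp add: g_def base_def off_def)
    qed
    have g2: "g (False, j) s = ennreal \<bar>fdiff r (h + real j *\<^sub>R s) f \<xi>\<bar>" if j: "j \<in> {1..r}" for j
    proof -
      have "\<xi> + (real r * u) *\<^sub>R (h + real j *\<^sub>R s) \<in> \<Omega>" if u: "u \<in> {0..1}" for u
      proof -
        have "u * (real r * real j) \<le> 1 * (real r * real r)" using u j by (intro mult_mono) auto
        moreover have "real r * u \<le> r" using u by (simp add: mult_left_le)
        ultimately show ?thesis using pts[OF s, of "real r * u" "real r * u * real j"] j u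
          by (auto simp: power2_eq_square algebra_simps)
      qed
      from ldiff_eq[OF r this, of f] show ?thesis by (simp add: g_def base_def off_def algebra_simps)
    qed
    have "(\<Sum>k\<in>?I. g k s) = (\<Sum>b\<in>UNIV. \<Sum>i=1..r. g (b, i) s)" by (simp add: sum.cartesian_product)
    also have "\<dots> = ennreal ((\<Sum>i=1..r. \<bar>fdiff r (real i *\<^sub>R s) f (?x i)\<bar>) + (\<Sum>j=1..r. \<bar>fdiff r (h + real j *\<^sub>R s) f \<xi>\<bar>))"
      by (simp add: UNIV_bool g1 g2 sum_nonneg add.commute)
    finally have "ennreal (2^r) * (\<Sum>k\<in>?I. g k s) = ennreal (2^r * ((\<Sum>i=1..r. \<bar>fdiff r (real i *\<^sub>R s) f (?x i)\<bar>) + (\<Sum>j=1..r. \<bar>fdiff r (h + real j *\<^sub>R s) f \<xi>\<bar>)))"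
      by (simp add: ennreal_mult')
    then show ?thesis using fdiff_perturb_le[OF r, of h f \<xi> s] by (simp add: ennreal_leI)
  qed
  have main': "\<exists>k\<in>?I. ennreal \<bar>fdiff r h f \<xi>\<bar> \<le> ennreal (2^r * real (2*r)) * g k s" if s: "s \<in> ?S" for s
  proof -
    obtain k where k: "k \<in> ?I" "(\<Sum>k\<in>?I. g k s) \<le> of_nat (2 * r) * g k s"
      using sum_le_card_mult[OF I(1,2), of "\<lambda>k. g k s"] I(3) by auto
    have "ennreal \<bar>fdiff r h f \<xi>\<bar> \<le> ennreal (2^r) * (of_nat (2 * r) * g k s)"
      using main[OF s] mult_left_mono[OF k(2), of "ennreal (2^r)"] by (meson order_trans zero_le)
    then show ?thesis using k(1) by (auto intro!: bexI[of _ k] simp: ennreal_mult ennreal_of_nat_eq_real_of_nat mult.assoc)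
  qed
  show ?thesis
  proof (cases "q = \<infinity>")
    case True
    have z: "z \<in> ?S" using Z by (force intro!: image_eqI[of _ _ 0])
    obtain k where k: "k \<in> ?I" "ennreal \<bar>fdiff r h f \<xi>\<bar> \<le> ennreal (2^r * real (2*r)) * g k z"
      using main'[OF z] by auto
    have "g k z \<le> ?W (base k)" unfolding g_def True local_modulus_top
      by (rule SUP_upper[OF gU[OF k(1) z]])
    moreover have "epow (ennreal (l ^ DIM('a)) * of_nat (2*r)) (1 / enn2real q) = 1"
    proof -
      have "ennreal (l ^ DIM('a)) * of_nat (2*r) = ennreal (l ^ DIM('a) * real (2*r))"
        using l by (simp add: ennreal_mult ennreal_of_nat_eq_real_of_nat)
      moreover have "l ^ DIM('a) * real (2*r) > 0" using l r by simp
      ultimately show ?thesis using True l r by simp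
    qed
    moreover have "ennreal \<bar>fdiff r h f \<xi>\<bar> \<le> ennreal (2^r * real (2*r)) * ?W (base k)"
      by (rule order_trans[OF k(2) mult_left_mono[OF calculation(1)]]) simp
    ultimately show ?thesis using base[OF k(1)] by (intro exI[of _ "base k"]) simp
  next
    case False
    let ?q = "enn2real q" and ?n = "DIM('a)"
    have q0: "?q > 0" using q False by (simp add: enn2real_positive_iff less_top)
    let ?C = "ennreal (2^r * real (2*r))"
    have mS: "?S \<in> sets borel" using Z by (auto intro!: borel_compact compact_translation)
    have mg [measurable]: "g k \<in> borel_measurable borel" for k
      unfolding g_def by (intro measurable_ldiff[OF \<Omega> f]) measurable
    have eS: "emeasure lborel ?S = emeasure lborel Z"
      using emeasure_affine_image[OF Z(1), of 1 z] by simp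
    have Sfin: "emeasure lborel Z < \<infinity>"
      using Z(1) by (meson emeasure_compact_finite)
    have Spos: "emeasure lborel Z \<noteq> 0"
    proof
      assume "emeasure lborel Z = 0"
      then have "Z \<in> null_sets lborel" using Z by (auto simp: null_sets_def intro: borel_compact)
      then have "negligible Z" by (simp add: negligible_iff_null_sets null_sets_completionI)
      then have "negligible (ball (0::'a) e)" using Z negligible_subset by blast
      then show False using Z(2) by (simp add: open_not_negligible)
    qed
    have int1: "(\<integral>\<^sup>+s\<in>?S. epow (g k s) ?q \<partial>lborel) \<le> ennreal (l^?n) * emeasure lborel Z * epow (?W (base k)) ?q"
      if k: "k \<in> ?I" for k
    proof -
      let ?y = "?x (base k)"
      let ?U = "rho_ball \<Omega> ?y \<delta>"
      have mU [measurable]: "?U \<in> sets borel" using closed_rho_ball[OF \<Omega>] by auto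
      have "compact ((\<lambda>w. ?y + l *\<^sub>R w) ` Z)"
        using Z(1) by (intro compact_continuous_image continuous_intros)
      then have "(\<lambda>w. ?y + l *\<^sub>R w) ` Z \<in> sets lborel" by (simp add: borel_compact)
      from emeasure_mono[OF U[OF base[OF k]] this]
      have Ule: "emeasure lborel ?U \<le> ennreal (l^?n) * emeasure lborel Z"
        unfolding emeasure_affine_image[OF Z(1) l] .
      also have "\<dots> < \<infinity>" using Sfin by (simp add: ennreal_mult_less_top)
      finally have Ufin: "emeasure lborel ?U < \<infinity>" .
      have ml [measurable]: "ldiff \<Omega> r f ?y \<in> borel_measurable borel"
        by (rule measurable_ldiff[OF \<Omega> f]) auto
      define c where "c = real r * real (snd k)"
      have c1: "c \<ge> 1" using k r by (auto simp: c_def intro!: mult_ge1_I)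
      have "(\<integral>\<^sup>+s\<in>?S. epow (g k s) ?q \<partial>lborel)
          \<le> (\<integral>\<^sup>+s. epow (ldiff \<Omega> r f ?y ((?y + off k) + c *\<^sub>R s)) ?q * indicator ?U ((?y + off k) + c *\<^sub>R s) \<partial>lborel)"
        using gU[OF k] by (intro nn_integral_mono) (auto simp: indicator_def g_def c_def)
      also have "\<dots> \<le> ennreal (\<bar>c\<bar>^?n) * \<dots>"
      proof -
        have "1 \<le> \<bar>c\<bar>^?n" using c1 by (intro one_le_power) auto
        then have "ennreal 1 \<le> ennreal (\<bar>c\<bar>^?n)" by (rule ennreal_leI)
        then have "1 * x \<le> ennreal (\<bar>c\<bar>^?n) * x" for x by (intro mult_right_mono) auto
        then show ?thesis by simp
      qed
      also have "\<dots> = (\<integral>\<^sup>+\<eta>\<in>?U. epow (ldiff \<Omega> r f ?y \<eta>) ?q \<partial>lborel)"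
        using c1 by (intro nn_integral_lborel_affine[symmetric]) auto
      also have "\<dots> \<le> emeasure lborel ?U * epow (?W (base k)) ?q"
        by (rule local_modulus_mass[OF q False Ufin \<Omega>])
      also have "\<dots> \<le> ennreal (l^?n) * emeasure lborel Z * epow (?W (base k)) ?q"
        by (rule mult_right_mono[OF Ule]) simp
      finally show ?thesis .
    qed
    have "emeasure lborel Z * epow (ennreal \<bar>fdiff r h f \<xi>\<bar>) ?q = (\<integral>\<^sup>+s\<in>?S. epow (ennreal \<bar>fdiff r h f \<xi>\<bar>) ?q \<partial>lborel)"
      using mS by (subst nn_integral_cmult_indicator) (simp_all add: eS mult.commute)
    also have "\<dots> \<le> (\<integral>\<^sup>+s. epow ?C ?q * (\<Sum>k\<in>?I. epow (g k s) ?q * indicator ?S s) \<partial>lborel)"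
    proof (intro nn_integral_mono)
      fix s
      show "epow (ennreal \<bar>fdiff r h f \<xi>\<bar>) ?q * indicator ?S s \<le> epow ?C ?q * (\<Sum>k\<in>?I. epow (g k s) ?q * indicator ?S s)"
      proof (cases "s \<in> ?S")
        case True
        then obtain k where k: "k \<in> ?I" "ennreal \<bar>fdiff r h f \<xi>\<bar> \<le> ?C * g k s" using main' by blast
        have "epow (ennreal \<bar>fdiff r h f \<xi>\<bar>) ?q \<le> epow (?C * g k s) ?q" using k q0 by (intro epow_mono) auto
        also have "\<dots> = epow ?C ?q * epow (g k s) ?q" using q0 by (rule epow_mult)
        also have "\<dots> \<le> epow ?C ?q * (\<Sum>k\<in>?I. epow (g k s) ?q)"
          using k(1) by (intro mult_left_mono member_le_sum) auto
        finally show ?thesis using True by simp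
      qed simp
    qed
    also have "\<dots> = epow ?C ?q * (\<Sum>k\<in>?I. \<integral>\<^sup>+s\<in>?S. epow (g k s) ?q \<partial>lborel)"
    proof -
      have m: "(\<lambda>s. epow (g k s) ?q * indicator ?S s) \<in> borel_measurable lborel" for k
        using mS by measurable
      show ?thesis
        unfolding nn_integral_sum[OF m, symmetric]
        by (rule nn_integral_cmult) (intro borel_measurable_sum m)
    qed
    also have "\<dots> \<le> epow ?C ?q * (\<Sum>k\<in>?I. ennreal (l^?n) * emeasure lborel Z * epow (?W (base k)) ?q)"
      using int1 by (intro mult_left_mono sum_mono) auto
    finally have 1: "emeasure lborel Z * epow (ennreal \<bar>fdiff r h f \<xi>\<bar>) ?q
       \<le> epow ?C ?q * (\<Sum>k\<in>?I. ennreal (l^?n) * emeasure lborel Z * epow (?W (base k)) ?q)" .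
    obtain k where k: "k \<in> ?I"
      "(\<Sum>k\<in>?I. ennreal (l^?n) * emeasure lborel Z * epow (?W (base k)) ?q) \<le> of_nat (2*r) * (ennreal (l^?n) * emeasure lborel Z * epow (?W (base k)) ?q)"
      using sum_le_card_mult[OF I(1,2), of "\<lambda>k. ennreal (l^?n) * emeasure lborel Z * epow (?W (base k)) ?q"] I(3) by auto
    have "emeasure lborel Z * epow (ennreal \<bar>fdiff r h f \<xi>\<bar>) ?q
        \<le> epow ?C ?q * (of_nat (2*r) * (ennreal (l^?n) * emeasure lborel Z * epow (?W (base k)) ?q))"
      using 1 mult_left_mono[OF k(2), of "epow ?C ?q"] by (meson order_trans zero_le)
    also have "\<dots> = emeasure lborel Z * (epow ?C ?q * (ennreal (l^?n) * of_nat (2*r)) * epow (?W (base k)) ?q)"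
      by (simp add: ac_simps)
    finally have "epow (ennreal \<bar>fdiff r h f \<xi>\<bar>) ?q \<le> epow ?C ?q * (ennreal (l^?n) * of_nat (2*r)) * epow (?W (base k)) ?q"
      using Spos Sfin by (subst (asm) ennreal_mult_le_mult_iff) auto
    then have "epow (epow (ennreal \<bar>fdiff r h f \<xi>\<bar>) ?q) (1/?q) \<le> epow (epow ?C ?q * (ennreal (l^?n) * of_nat (2*r)) * epow (?W (base k)) ?q) (1/?q)"
      using q0 by (intro epow_mono) auto
    then have "ennreal \<bar>fdiff r h f \<xi>\<bar> \<le> ?C * epow (ennreal (l^?n) * of_nat (2*r)) (1/?q) * ?W (base k)"
      using q0 by (simp only: epow_mult epow_inverse zero_less_divide_1_iff)
    then show ?thesis using base[OF k(1)] by blast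
  qed
qed

lemma fdiff_Suc: "fdiff (Suc r) v f x = fdiff r v f (x + v) - fdiff r v f x"
proof -
  let ?g = "\<lambda>j. f (x + real j *\<^sub>R v)"
  have "fdiff (Suc r) v f x = (\<Sum>j\<le>Suc r. (-1)^(Suc r + j) * real (Suc r choose j) * ?g j)"
    by (simp add: fdiff_def atLeast0AtMost)
  also have "\<dots> = (-1)^(Suc r) * ?g 0 + (\<Sum>j\<le>r. (-1)^(Suc r + Suc j) * real (Suc r choose Suc j) * ?g (Suc j))"
    by (subst sum.atMost_Suc_shift) simp
  also have "(\<Sum>j\<le>r. (-1)^(Suc r + Suc j) * real (Suc r choose Suc j) * ?g (Suc j))
     = (\<Sum>j\<le>r. (-1)^(r+j) * real (r choose j) * ?g (Suc j)) + (\<Sum>j\<le>r. (-1)^(r+j) * real (r choose Suc j) * ?g (Suc j))"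
    unfolding sum.distrib[symmetric] by (intro sum.cong refl) (simp add: algebra_simps)
  also have "(\<Sum>j\<le>r. (-1)^(r+j) * real (r choose j) * ?g (Suc j)) = fdiff r v f (x + v)"
    by (simp add: fdiff_def atLeast0AtMost algebra_simps)
  also have "(\<Sum>j\<le>r. (-1)^(r+j) * real (r choose Suc j) * ?g (Suc j)) = (-1)^r * ?g 0 - fdiff r v f x"
  proof -
    have "fdiff r v f x = (\<Sum>j\<le>Suc r. (-1)^(r+j) * real (r choose j) * ?g j)"
      by (simp add: fdiff_def atLeast0AtMost)
    also have "\<dots> = (-1)^r * ?g 0 + (\<Sum>j\<le>r. (-1)^(r + Suc j) * real (r choose Suc j) * ?g (Suc j))"
      by (subst sum.atMost_Suc_shift) simp
    also have "(\<Sum>j\<le>r. (-1)^(r + Suc j) * real (r choose Suc j) * ?g (Suc j))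
      = - (\<Sum>j\<le>r. (-1)^(r+j) * real (r choose Suc j) * ?g (Suc j))"
      by (simp add: sum_negf)
    finally show ?thesis by simp
  qed
  finally show ?thesis by simp
qed

lemma fdiff_diff: "fdiff r v (\<lambda>y. f (y + w) - f y) x = fdiff r v f (x + w) - fdiff r v f x"
proof -
  have "x + real j *\<^sub>R v + w = x + w + real j *\<^sub>R v" for j by (simp add: algebra_simps)
  then show ?thesis by (simp only: fdiff_def right_diff_distrib sum_subtractf)
qed

lemma fdiff_chop_le:
  assumes "1 \<le> N" "\<And>k. k \<le> r * (N - 1) \<Longrightarrow> \<bar>fdiff r h f (x + real k *\<^sub>R h)\<bar> \<le> B"
  shows "\<bar>fdiff r (real N *\<^sub>R h) f x\<bar> \<le> real N ^ r * B"
  using assms(2)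
proof (induction r arbitrary: f B)
  case 0
  then show ?case by (fastforce simp: fdiff_def)
next
  case (Suc r)
  let ?g = "\<lambda>y. f (y + real N *\<^sub>R h) - f y"
  have tele: "fdiff r h f (y + real M *\<^sub>R h) - fdiff r h f y = (\<Sum>i<M. fdiff (Suc r) h f (y + real i *\<^sub>R h))" for y M
  proof (induction M)
    case (Suc M)
    have "y + real (Suc M) *\<^sub>R h = (y + real M *\<^sub>R h) + h" by (simp add: algebra_simps)
    then show ?case using Suc fdiff_Suc[of r h f "y + real M *\<^sub>R h"] by (simp add: add.assoc)
  qed simp
  have "\<bar>fdiff r (real N *\<^sub>R h) ?g x\<bar> \<le> real N ^ r * (real N * B)"
  proof (rule Suc.IH)
    fix k assume k: "k \<le> r * (N - 1)"
    have "\<bar>fdiff r h ?g (x + real k *\<^sub>R h)\<bar> = \<bar>\<Sum>i<N. fdiff (Suc r) h f (x + real k *\<^sub>R h + real i *\<^sub>R h)\<bar>"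
      unfolding fdiff_diff tele ..
    also have "\<dots> \<le> (\<Sum>i<N. \<bar>fdiff (Suc r) h f (x + real k *\<^sub>R h + real i *\<^sub>R h)\<bar>)" by (rule sum_abs)
    also have "\<dots> \<le> (\<Sum>i<N. B)"
    proof (rule sum_mono)
      fix i assume "i \<in> {..<N}"
      then have "k + i \<le> Suc r * (N - 1)" using k by auto
      from Suc.prems[OF this] show "\<bar>fdiff (Suc r) h f (x + real k *\<^sub>R h + real i *\<^sub>R h)\<bar> \<le> B"
        by (simp add: algebra_simps)
    qed
    finally show "\<bar>fdiff r h ?g (x + real k *\<^sub>R h)\<bar> \<le> real N * B" by simp
  qed
  then show ?case unfolding fdiff_diff fdiff_Suc by (simp add: algebra_simps)
qed

lemma fdiff_chop:
  assumes "1 \<le> N"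
  shows "\<exists>k \<le> r * (N - 1). \<bar>fdiff r h f x\<bar> \<le> real N ^ r * \<bar>fdiff r (h /\<^sub>R real N) f (x + (real k / real N) *\<^sub>R h)\<bar>"
proof -
  let ?F = "\<lambda>k. \<bar>fdiff r (h /\<^sub>R real N) f (x + real k *\<^sub>R (h /\<^sub>R real N))\<bar>"
  let ?K = "{..r * (N-1)}"
  obtain k where k: "k \<in> ?K" "?F k = Max (?F ` ?K)"
    using Max_in[of "?F ` ?K"] by fastforce
  have "\<bar>fdiff r (real N *\<^sub>R (h /\<^sub>R real N)) f x\<bar> \<le> real N ^ r * ?F k"
  proof (rule fdiff_chop_le[OF assms])
    fix j assume "j \<le> r * (N - 1)"
    then show "?F j \<le> ?F k" unfolding k(2) by (intro Max_ge) auto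
  qed
  moreover have "real N *\<^sub>R (h /\<^sub>R real N) = h" using assms by simp
  moreover have "real k *\<^sub>R (h /\<^sub>R real N) = (real k / real N) *\<^sub>R h" by (simp add: divide_inverse)
  ultimately have "\<bar>fdiff r h f x\<bar> \<le> real N ^ r * \<bar>fdiff r (h /\<^sub>R real N) f (x + (real k / real N) *\<^sub>R h)\<bar>"
    by metis
  then show ?thesis using k(1) by blast
qed

lemma local_estimate:
  fixes r :: nat and R K :: real
  assumes r: "1 \<le> r" and R: "0 < R" and K: "0 \<le> K" and q: "0 < q"
  shows "\<exists>(N::nat) (c::real) (C::real). 1 \<le> N \<and> 0 < c \<and> 0 < C \<and>
    (\<forall>(\<Omega>::'a::euclidean_space set) \<xi> h t f. ball_domain R \<Omega> \<longrightarrow> f \<in> borel_measurable borel \<longrightarrow>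
      0 < t \<longrightarrow> t \<le> 1 \<longrightarrow> norm h \<le> K * t \<longrightarrow> (\<forall>a\<in>{0..real r}. \<xi> + a *\<^sub>R h \<in> \<Omega>) \<longrightarrow>
      (\<forall>a\<in>{0..real r}. \<bar>sqrt (bdist \<Omega> (\<xi> + a *\<^sub>R h)) - sqrt (bdist \<Omega> \<xi>)\<bar> \<le> K * t) \<longrightarrow>
      (\<exists>k\<le>r * N. ennreal \<bar>fdiff r h f \<xi>\<bar>
         \<le> ennreal C * local_modulus \<Omega> r f (\<xi> + (real k / real N) *\<^sub>R h) (c * t) q))"
proof -
  obtain \<tau>0 :: real where \<tau>0: "0 < \<tau>0" "\<tau>0 \<le> 1" and ex: "\<And>C2. C2\<ge>0 \<Longrightarrow> \<exists>c l::real. 0 < c \<and> 0 < l \<and>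
    (\<forall>(\<Omega>::'a set) \<xi> h \<tau>. ball_domain R \<Omega> \<longrightarrow> 0 < \<tau> \<longrightarrow> \<tau> \<le> \<tau>0 \<longrightarrow> norm h \<le> \<tau> \<longrightarrow>
      (\<forall>a\<in>{0..real r}. \<xi> + a *\<^sub>R h \<in> \<Omega>) \<longrightarrow>
      (\<forall>i\<le>r. \<bar>sqrt (bdist \<Omega> (\<xi> + real i *\<^sub>R h)) - sqrt (bdist \<Omega> \<xi>)\<bar> \<le> C2 * \<tau>) \<longrightarrow>
      (\<exists>z Z. perturbations \<Omega> r \<xi> h (c * \<tau>) l z Z))"
    using perturbations_exist[OF r R, where 'a='a] by blast
  define N where "N = nat \<lceil>K / \<tau>0\<rceil> + 1"
  have N: "1 \<le> N" "K / \<tau>0 \<le> real N" by (auto simp: N_def) linarith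
  have N0: "real N > 0" using N(1) by simp
  define C2 where "C2 = 2 * K / \<tau>0"
  have C2: "C2 \<ge> 0" using K \<tau>0 by (simp add: C2_def)
  obtain c l where c: "0 < c" "0 < l" and P: "\<And>(\<Omega>::'a set) \<xi> h \<tau>. \<lbrakk>ball_domain R \<Omega>; 0 < \<tau>; \<tau> \<le> \<tau>0; norm h \<le> \<tau>;
      \<forall>a\<in>{0..real r}. \<xi> + a *\<^sub>R h \<in> \<Omega>;
      \<forall>i\<le>r. \<bar>sqrt (bdist \<Omega> (\<xi> + real i *\<^sub>R h)) - sqrt (bdist \<Omega> \<xi>)\<bar> \<le> C2 * \<tau>\<rbrakk> \<Longrightarrow>
      \<exists>z Z. perturbations \<Omega> r \<xi> h (c * \<tau>) l z Z"
    using ex[OF C2] by blast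
  define A where "A = 2^r * real (2*r) * ((l ^ DIM('a) * real (2*r)) powr (1 / enn2real q))"
  have A: "A > 0" using r c by (simp add: A_def)
  have Aeq: "ennreal (2^r * real (2*r)) * epow (ennreal (l ^ DIM('a)) * of_nat (2*r)) (1 / enn2real q) = ennreal A"
  proof -
    have e: "ennreal (l ^ DIM('a)) * of_nat (2*r) = ennreal (l ^ DIM('a) * real (2*r))"
      using c by (simp add: ennreal_mult ennreal_of_nat_eq_real_of_nat)
    have "epow (ennreal (l ^ DIM('a)) * of_nat (2*r)) (1 / enn2real q)
        = ennreal ((l ^ DIM('a) * real (2*r)) powr (1 / enn2real q))"
      unfolding e using c by (intro epow_ennreal) auto
    then show ?thesis unfolding A_def by (simp only:) (rule ennreal_mult[symmetric], auto)
  qed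
  show ?thesis
  proof (rule exI[of _ N], rule exI[of _ "c * \<tau>0"], rule exI[of _ "real N ^ r * A"], intro conjI allI impI)
    show "1 \<le> N" "0 < c * \<tau>0" "0 < real N ^ r * A" using N c \<tau>0 A N0 by auto
    fix \<Omega> :: "'a set" and \<xi> h :: 'a and t :: real and f :: "'a \<Rightarrow> real"
    assume bd: "ball_domain R \<Omega>" and f: "f \<in> borel_measurable borel" and t: "0 < t" "t \<le> 1"
      and h: "norm h \<le> K * t" and path: "\<forall>a\<in>{0..real r}. \<xi> + a *\<^sub>R h \<in> \<Omega>"
      and sq: "\<forall>a\<in>{0..real r}. \<bar>sqrt (bdist \<Omega> (\<xi> + a *\<^sub>R h)) - sqrt (bdist \<Omega> \<xi>)\<bar> \<le> K * t"
    obtain k where k: "k \<le> r * (N - 1)"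
      and le: "\<bar>fdiff r h f \<xi>\<bar> \<le> real N ^ r * \<bar>fdiff r (h /\<^sub>R real N) f (\<xi> + (real k / real N) *\<^sub>R h)\<bar>"
      using fdiff_chop[OF N(1)] by blast
    define x where "x = \<xi> + (real k / real N) *\<^sub>R h"
    define v where "v = h /\<^sub>R real N"
    define \<tau> where "\<tau> = \<tau>0 * t"
    have \<tau>: "0 < \<tau>" "\<tau> \<le> \<tau>0" using \<tau>0 t by (auto simp: \<tau>_def mult_left_le)
    have xa: "x + a *\<^sub>R v = \<xi> + ((real k + a) / real N) *\<^sub>R h" for a
      by (simp add: x_def v_def algebra_simps add_divide_distrib divide_inverse)
    have ka: "(real k + a) / real N \<in> {0..real r}" if "a \<in> {0..real r}" for a
    proof -
      have "real k \<le> real (r * (N - 1))" using k by (simp only: of_nat_le_iff)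
      also have "\<dots> = real r * real N - real r" using N(1) by (simp add: algebra_simps of_nat_diff)
      finally show ?thesis using that N0 by (simp add: field_simps)
    qed
    have "\<exists>z Z. perturbations \<Omega> r x v (c * \<tau>) l z Z"
    proof (rule P[OF bd \<tau>])
      have "norm v = norm h / real N" by (simp add: v_def divide_inverse)
      also have "\<dots> \<le> (K * t) / real N" using h N0 by (simp add: divide_right_mono)
      also have "\<dots> \<le> \<tau>"
      proof -
        have "K \<le> \<tau>0 * real N" using N(2) \<tau>0 by (simp add: field_simps)
        then have "K * t \<le> \<tau>0 * real N * t" using t by (intro mult_right_mono) auto
        then show ?thesis using N0 by (simp add: field_simps \<tau>_def)
      qed
      finally show "norm v \<le> \<tau>" .
      show "\<forall>a\<in>{0..real r}. x + a *\<^sub>R v \<in> \<Omega>" using path ka unfolding xa by blast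
      show "\<forall>i\<le>r. \<bar>sqrt (bdist \<Omega> (x + real i *\<^sub>R v)) - sqrt (bdist \<Omega> x)\<bar> \<le> C2 * \<tau>"
      proof (intro allI impI)
        fix i assume "i \<le> r"
        then have "\<bar>sqrt (bdist \<Omega> (x + real i *\<^sub>R v)) - sqrt (bdist \<Omega> \<xi>)\<bar> \<le> K * t"
          unfolding xa by (intro bspec[OF sq] ka) auto
        moreover have "\<bar>sqrt (bdist \<Omega> x) - sqrt (bdist \<Omega> \<xi>)\<bar> \<le> K * t"
          using bspec[OF sq ka[of 0]] by (simp add: x_def)
        moreover have "C2 * \<tau> = 2 * (K * t)" using \<tau>0 by (simp add: C2_def \<tau>_def)
        ultimately show "\<bar>sqrt (bdist \<Omega> (x + real i *\<^sub>R v)) - sqrt (bdist \<Omega> x)\<bar> \<le> C2 * \<tau>" by linarith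
      qed
    qed
    then obtain z Z where "perturbations \<Omega> r x v (c * \<tau>) l z Z" by blast
    from perturb_estimate[OF bd_facts(2)[OF bd] r c(2) this f q]
    obtain i where i: "i \<le> r" "ennreal \<bar>fdiff r v f x\<bar> \<le> ennreal A * local_modulus \<Omega> r f (x + real i *\<^sub>R v) (c * \<tau>) q"
      unfolding Aeq by blast
    show "\<exists>k\<le>r * N. ennreal \<bar>fdiff r h f \<xi>\<bar>
         \<le> ennreal (real N ^ r * A) * local_modulus \<Omega> r f (\<xi> + (real k / real N) *\<^sub>R h) (c * \<tau>0 * t) q"
    proof (intro exI[of _ "k + i"] conjI)
      have "k + i \<le> r * (N - 1) + r" using k i by linarith
      also have "\<dots> = r * N" using N(1) by (cases N) auto
      finally show "k + i \<le> r * N" .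
      have "ennreal \<bar>fdiff r h f \<xi>\<bar> \<le> ennreal (real N ^ r) * ennreal \<bar>fdiff r v f x\<bar>"
        using le by (simp add: x_def v_def ennreal_mult'[symmetric] ennreal_leI)
      also have "\<dots> \<le> ennreal (real N ^ r) * (ennreal A * local_modulus \<Omega> r f (x + real i *\<^sub>R v) (c * \<tau>) q)"
        using i by (intro mult_left_mono) auto
      finally show "ennreal \<bar>fdiff r h f \<xi>\<bar>
         \<le> ennreal (real N ^ r * A) * local_modulus \<Omega> r f (\<xi> + (real (k + i) / real N) *\<^sub>R h) (c * \<tau>0 * t) q"
        using A by (simp add: xa \<tau>_def ennreal_mult mult.assoc)
    qed
  qed
qed

section \<open>Chords and the Ditzian--Totik step\<close>

text \<open>\<open>l1\<close> and \<open>l2\<close> are the distances from \<open>\<xi>\<close> to the ends of the chord of \<open>\<Omega>\<close> through \<open>\<xi>\<close>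
  in direction \<open>e\<close>.\<close>

definition chord :: "'a::euclidean_space set \<Rightarrow> 'a \<Rightarrow> 'a \<Rightarrow> real \<Rightarrow> real \<Rightarrow> bool" where
  "chord \<Omega> e \<xi> l1 l2 \<longleftrightarrow> 0 \<le> l1 \<and> 0 \<le> l2 \<and> (\<forall>u\<in>{-l1..l2}. \<xi> + u *\<^sub>R e \<in> \<Omega>) \<and>
     (\<forall>b\<ge>0. (\<forall>u\<in>{0..b}. \<xi> + u *\<^sub>R e \<in> \<Omega>) \<longrightarrow> b \<le> l2) \<and>
     (\<forall>a\<ge>0. (\<forall>u\<in>{-a..0}. \<xi> + u *\<^sub>R e \<in> \<Omega>) \<longrightarrow> a \<le> l1) \<and>
     \<xi> + l2 *\<^sub>R e \<in> frontier \<Omega> \<and> \<xi> - l1 *\<^sub>R e \<in> frontier \<Omega>"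

lemma closed_segment_line:
  assumes "a \<le> b"
  shows "closed_segment (\<xi> + a *\<^sub>R e) (\<xi> + b *\<^sub>R e) = (\<lambda>u. \<xi> + u *\<^sub>R e) ` {a..b::real}"
proof -
  have "closed_segment (\<xi> + a *\<^sub>R e) (\<xi> + b *\<^sub>R e) = (\<lambda>u. \<xi> + u *\<^sub>R e) ` closed_segment a b"
    unfolding closed_segment_mem image_image
    by (intro image_cong refl) (simp add: algebra_simps)
  then show ?thesis using assms by (simp add: closed_segment_eq_real_ivl)
qed

lemma ray_end:
  fixes \<Omega> :: "'a::euclidean_space set"
  assumes \<Omega>: "compact \<Omega>" and e: "e \<noteq> 0" and \<xi>: "\<xi> \<in> \<Omega>"
  shows "\<exists>l\<ge>0. (\<forall>u\<in>{0..l}. \<xi> + u *\<^sub>R e \<in> \<Omega>) \<and>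
    (\<forall>b\<ge>0. (\<forall>u\<in>{0..b}. \<xi> + u *\<^sub>R e \<in> \<Omega>) \<longrightarrow> b \<le> l) \<and> \<xi> + l *\<^sub>R e \<in> frontier \<Omega>"
proof -
  define S where "S = {b. 0 \<le> b \<and> (\<forall>u\<in>{0..b}. \<xi> + u *\<^sub>R e \<in> \<Omega>)}"
  have S: "S = {0..} \<inter> (\<lambda>b. (\<xi>, \<xi> + b *\<^sub>R e)) -` {p. closed_segment (fst p) (snd p) \<subseteq> \<Omega>}"
  proof (intro set_eqI iffI)
    fix b
    show "b \<in> S \<Longrightarrow> b \<in> {0..} \<inter> (\<lambda>b. (\<xi>, \<xi> + b *\<^sub>R e)) -` {p. closed_segment (fst p) (snd p) \<subseteq> \<Omega>}"
      using closed_segment_line[of 0 b \<xi> e] unfolding S_def by auto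
    show "b \<in> {0..} \<inter> (\<lambda>b. (\<xi>, \<xi> + b *\<^sub>R e)) -` {p. closed_segment (fst p) (snd p) \<subseteq> \<Omega>} \<Longrightarrow> b \<in> S"
      using closed_segment_line[of 0 b \<xi> e] unfolding S_def by auto
  qed
  have cl: "closed S" unfolding S
    by (intro closed_Int closed_vimage closed_segments_subset compact_imp_closed[OF \<Omega>] continuous_intros)
  obtain B where B: "\<And>x. x \<in> \<Omega> \<Longrightarrow> norm x \<le> B" using \<Omega> compact_imp_bounded bounded_iff by metis
  have "b \<le> 2 * B / norm e" if "b \<in> S" for b
  proof -
    have "norm (b *\<^sub>R e) \<le> norm (\<xi> + b *\<^sub>R e) + norm \<xi>" using norm_triangle_ineq4[of "\<xi> + b *\<^sub>R e" \<xi>] by simp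
    also have "\<dots> \<le> B + B" using that \<xi> B by (intro add_mono) (auto simp: S_def)
    finally show ?thesis using e that by (simp add: field_simps S_def)
  qed
  then have "S \<subseteq> {0..2 * B / norm e}" by (auto simp: S_def)
  then have "bounded S" by (rule bounded_subset[OF bounded_closed_interval])
  then have "compact S" using cl compact_eq_bounded_closed by blast
  moreover have "0 \<in> S" using \<xi> by (simp add: S_def)
  ultimately obtain l where l: "l \<in> S" "\<And>b. b \<in> S \<Longrightarrow> b \<le> l" using compact_attains_sup[of S] by blast
  have "\<xi> + l *\<^sub>R e \<notin> interior \<Omega>"
  proof
    assume "\<xi> + l *\<^sub>R e \<in> interior \<Omega>"
    then obtain d where d: "d > 0" "ball (\<xi> + l *\<^sub>R e) d \<subseteq> \<Omega>" by (auto simp: mem_interior)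
    define b where "b = l + d / (2 * norm e)"
    have "b \<in> S" unfolding S_def
    proof (intro CollectI conjI ballI)
      show "0 \<le> b" using l d by (simp add: b_def S_def)
      fix u assume u: "u \<in> {0..b}"
      show "\<xi> + u *\<^sub>R e \<in> \<Omega>"
      proof (cases "u \<le> l")
        case False
        have "dist (\<xi> + l *\<^sub>R e) (\<xi> + u *\<^sub>R e) = \<bar>u - l\<bar> * norm e"
          by (simp add: dist_norm scaleR_diff_left[symmetric] abs_minus_commute)
        also have "\<dots> \<le> d / (2 * norm e) * norm e" using u False by (intro mult_right_mono) (auto simp: b_def)
        also have "\<dots> < d" using d e by simp
        finally show ?thesis using d by auto
      qed (use l u in \<open>auto simp: S_def\<close>)
    qed
    moreover have "d / (2 * norm e) > 0" using d e by simp
    ultimately show False using l(2)[of b] unfolding b_def by linarith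
  qed
  moreover have "\<xi> + l *\<^sub>R e \<in> \<Omega>" using l by (auto simp: S_def)
  ultimately have "\<xi> + l *\<^sub>R e \<in> frontier \<Omega>" using closure_subset[of \<Omega>] by (auto simp: frontier_def)
  then show ?thesis using l by (auto simp: S_def)
qed

lemma chord_exists:
  fixes \<Omega> :: "'a::euclidean_space set"
  assumes \<Omega>: "compact \<Omega>" and e: "e \<noteq> 0" and \<xi>: "\<xi> \<in> \<Omega>"
  shows "\<exists>l1 l2. chord \<Omega> e \<xi> l1 l2"
proof -
  obtain l2 where l2: "l2\<ge>0" "\<forall>u\<in>{0..l2}. \<xi> + u *\<^sub>R e \<in> \<Omega>"
    "\<forall>b\<ge>0. (\<forall>u\<in>{0..b}. \<xi> + u *\<^sub>R e \<in> \<Omega>) \<longrightarrow> b \<le> l2" "\<xi> + l2 *\<^sub>R e \<in> frontier \<Omega>"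
    using ray_end[OF assms] by blast
  have "-e \<noteq> 0" using e by simp
  obtain l1 where l1: "l1\<ge>0" "\<forall>u\<in>{0..l1}. \<xi> + u *\<^sub>R (-e) \<in> \<Omega>"
    "\<forall>b\<ge>0. (\<forall>u\<in>{0..b}. \<xi> + u *\<^sub>R (-e) \<in> \<Omega>) \<longrightarrow> b \<le> l1" "\<xi> + l1 *\<^sub>R (-e) \<in> frontier \<Omega>"
    using ray_end[OF \<Omega> \<open>-e \<noteq> 0\<close> \<xi>] by blast
  have flip: "(\<forall>u\<in>{-a..0}. \<xi> + u *\<^sub>R e \<in> \<Omega>) \<longleftrightarrow> (\<forall>u\<in>{0..a}. \<xi> + u *\<^sub>R (-e) \<in> \<Omega>)" for a
  proof safe
    fix u assume "\<forall>u\<in>{-a..0}. \<xi> + u *\<^sub>R e \<in> \<Omega>" "u \<in> {0..a}"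
    from bspec[OF this(1), of "-u"] this(2) show "\<xi> + u *\<^sub>R (-e) \<in> \<Omega>" by simp
  next
    fix u assume "\<forall>u\<in>{0..a}. \<xi> + u *\<^sub>R (-e) \<in> \<Omega>" "u \<in> {-a..0}"
    from bspec[OF this(1), of "-u"] this(2) show "\<xi> + u *\<^sub>R e \<in> \<Omega>" by simp
  qed
  have "\<forall>u\<in>{-l1..0}. \<xi> + u *\<^sub>R e \<in> \<Omega>" using l1(2) flip by blast
  then have "\<forall>u\<in>{-l1..l2}. \<xi> + u *\<^sub>R e \<in> \<Omega>" using l2(2) by force
  then have "chord \<Omega> e \<xi> l1 l2" unfolding chord_def flip using l1 l2(1,3,4) by (simp only: scaleR_minus_right) simp
  then show ?thesis by blast
qed

lemma chord_unique:
  assumes "chord \<Omega> e \<xi> l1 l2" "chord \<Omega> e \<xi> m1 m2" shows "l1 = m1" "l2 = m2"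
proof -
  have le: "a1 \<le> b1 \<and> a2 \<le> b2" if "chord \<Omega> e \<xi> a1 a2" "chord \<Omega> e \<xi> b1 b2" for a1 a2 b1 b2
  proof -
    have a: "0 \<le> a1" "0 \<le> a2" and on: "\<forall>u\<in>{-a1..a2}. \<xi> + u *\<^sub>R e \<in> \<Omega>" using that(1) by (auto simp: chord_def)
    have "\<forall>u\<in>{0..a2}. \<xi> + u *\<^sub>R e \<in> \<Omega>" "\<forall>u\<in>{-a1..0}. \<xi> + u *\<^sub>R e \<in> \<Omega>" using on a by auto
    with that(2) a show ?thesis unfolding chord_def by blast
  qed
  show "l1 = m1" "l2 = m2" using le[OF assms] le[OF assms(2,1)] by simp_all
qed

lemma phi_chord:
  fixes \<Omega> :: "'a::euclidean_space set"
  assumes "chord \<Omega> e \<xi> l1 l2" shows "phi \<Omega> e \<xi> = sqrt (l1 * l2)"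
  unfolding phi_def
proof (rule cSup_eq_maximum)
  have seg: "closed_segment (\<xi> - a *\<^sub>R e) (\<xi> + b *\<^sub>R e) = (\<lambda>u. \<xi> + u *\<^sub>R e) ` {-a..b}" if "0 \<le> a" "0 \<le> b" for a b
    using closed_segment_line[of "-a" b \<xi> e] that by simp
  show "sqrt (l1 * l2) \<in> {sqrt (l1 * l2) |l1 l2. 0 \<le> l1 \<and> 0 \<le> l2 \<and> closed_segment (\<xi> - l1 *\<^sub>R e) (\<xi> + l2 *\<^sub>R e) \<subseteq> \<Omega>}"
  proof -
    have l: "0 \<le> l1" "0 \<le> l2" using assms by (simp_all add: chord_def)
    have "closed_segment (\<xi> - l1 *\<^sub>R e) (\<xi> + l2 *\<^sub>R e) \<subseteq> \<Omega>"
      using assms unfolding seg[OF l] chord_def by blast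
    with l show ?thesis by (intro CollectI) metis
  qed
  fix x assume "x \<in> {sqrt (l1 * l2) |l1 l2. 0 \<le> l1 \<and> 0 \<le> l2 \<and> closed_segment (\<xi> - l1 *\<^sub>R e) (\<xi> + l2 *\<^sub>R e) \<subseteq> \<Omega>}"
  then obtain a b where ab: "x = sqrt (a * b)" "0 \<le> a" "0 \<le> b" "closed_segment (\<xi> - a *\<^sub>R e) (\<xi> + b *\<^sub>R e) \<subseteq> \<Omega>" by blast
  then have "\<forall>u\<in>{-a..b}. \<xi> + u *\<^sub>R e \<in> \<Omega>" using seg by auto
  then have "(\<forall>u\<in>{-a..0}. \<xi> + u *\<^sub>R e \<in> \<Omega>) \<and> (\<forall>u\<in>{0..b}. \<xi> + u *\<^sub>R e \<in> \<Omega>)" using ab by auto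
  then have "a \<le> l1" "b \<le> l2" using assms ab unfolding chord_def by blast+
  then show "x \<le> sqrt (l1 * l2)" using ab by (auto intro!: mult_mono)
qed

lemma chord_flip: "chord \<Omega> e \<xi> l1 l2 \<Longrightarrow> chord \<Omega> (-e) \<xi> l2 l1"
proof -
  have flip: "(\<forall>u\<in>{a..b}. \<xi> + u *\<^sub>R (-e) \<in> \<Omega>) \<longleftrightarrow> (\<forall>u\<in>{-b..-a}. \<xi> + u *\<^sub>R e \<in> \<Omega>)" for a b
  proof safe
    fix u assume "\<forall>u\<in>{a..b}. \<xi> + u *\<^sub>R (-e) \<in> \<Omega>" "u \<in> {-b..-a}"
    from bspec[OF this(1), of "-u"] this(2) show "\<xi> + u *\<^sub>R e \<in> \<Omega>" by simp
  next
    fix u assume "\<forall>u\<in>{-b..-a}. \<xi> + u *\<^sub>R e \<in> \<Omega>" "u \<in> {a..b}"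
    from bspec[OF this(1), of "-u"] this(2) show "\<xi> + u *\<^sub>R (-e) \<in> \<Omega>" by simp
  qed
  assume "chord \<Omega> e \<xi> l1 l2" then show ?thesis unfolding chord_def flip by simp
qed

lemma chord_bounded:
  fixes \<Omega> :: "'a::euclidean_space set"
  assumes "chord \<Omega> e \<xi> l1 l2" "closed \<Omega>" "norm e = 1" "\<And>x. x \<in> \<Omega> \<Longrightarrow> norm x \<le> B"
  shows "l1 \<le> 2 * B" "l2 \<le> 2 * B"
proof -
  have x: "\<xi> \<in> \<Omega>" "\<xi> + l2 *\<^sub>R e \<in> \<Omega>" "\<xi> + (-l1) *\<^sub>R e \<in> \<Omega>" "0 \<le> l1" "0 \<le> l2"
  proof -
    have on: "\<forall>u\<in>{-l1..l2}. \<xi> + u *\<^sub>R e \<in> \<Omega>" and l: "0 \<le> l1" "0 \<le> l2"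
      using assms(1) unfolding chord_def by blast+
    show "0 \<le> l1" "0 \<le> l2" by fact+
    show "\<xi> \<in> \<Omega>" "\<xi> + l2 *\<^sub>R e \<in> \<Omega>" "\<xi> + (-l1) *\<^sub>R e \<in> \<Omega>"
      using bspec[OF on, of 0] bspec[OF on, of l2] bspec[OF on, of "-l1"] l by auto
  qed
  have "norm (u *\<^sub>R e) \<le> B + B" if "\<xi> + u *\<^sub>R e \<in> \<Omega>" for u
    using norm_triangle_ineq4[of "\<xi> + u *\<^sub>R e" \<xi>] assms(4)[OF that] assms(4)[OF x(1)] by simp
  from this[OF x(2)] this[OF x(3)] show "l1 \<le> 2 * B" "l2 \<le> 2 * B" using x assms(3) by auto
qed

lemma slope_along_chord:
  fixes \<Omega> :: "'a::euclidean_space set"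
  assumes bd: "ball_domain R \<Omega>" and n: "foot_normal R \<Omega> \<xi> n" and D: "bdist \<Omega> \<xi> \<le> R/2"
    and e: "norm e = 1" and l: "0 \<le> l1" "l1 \<le> B" "0 \<le> l2" "l2 \<le> B" "1 \<le> B"
    and seg: "\<And>u. u \<in> {0..l2} \<Longrightarrow> \<xi> + u *\<^sub>R e \<in> \<Omega>" and Dl: "bdist \<Omega> \<xi> \<le> l2"
  shows "(n \<bullet> e) * sqrt (l1 * l2) \<le> B * (1 + B / R) * sqrt (bdist \<Omega> \<xi>)"
proof (cases "n \<bullet> e \<le> 0 \<or> l2 = 0")
  case True
  have "0 \<le> B * (1 + B / R) * sqrt (bdist \<Omega> \<xi>)"
    using l bd_facts(4)[OF bd] by (intro mult_nonneg_nonneg) (auto simp: infdist_nonneg)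
  moreover have "(n \<bullet> e) * sqrt (l1 * l2) \<le> 0" using True l by (auto intro: mult_nonpos_nonneg)
  ultimately show ?thesis by linarith
next
  case False
  let ?D = "bdist \<Omega> \<xi>"
  define \<alpha> where "\<alpha> = n \<bullet> e"
  have \<alpha>: "\<alpha> > 0" and l2: "l2 > 0" using False l by (auto simp: \<alpha>_def)
  have R: "R > 0" using bd_facts(4)[OF bd] .
  have key: "u * \<alpha> \<le> ?D + u^2 / R" if u: "u \<in> {0..l2}" for u
    using foot_normal_upper[OF bd n D seg[OF u]] infdist_nonneg[of "\<xi> + u *\<^sub>R e" "frontier \<Omega>"] e
    by (simp add: power_mult_distrib \<alpha>_def)
  have "?D \<noteq> 0"
  proof
    assume D0: "?D = 0"
    define u where "u = min l2 (\<alpha> * R / 2)"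
    have u: "u > 0" "u \<in> {0..l2}" "u \<le> \<alpha> * R / 2" using l2 \<alpha> R by (auto simp: u_def)
    have "u * \<alpha> \<le> u * (u / R)" using key[OF u(2)] D0 by (simp add: power2_eq_square)
    then have "\<alpha> \<le> u / R" using u(1) by (simp only: mult_le_cancel_left_pos)
    also have "\<dots> \<le> \<alpha> / 2" using u R by (simp add: field_simps)
    finally show False using \<alpha> by simp
  qed
  then have D0: "?D > 0" using infdist_nonneg[of \<xi> "frontier \<Omega>"] by linarith
  then have s: "sqrt ?D > 0" by simp
  have sB: "sqrt x \<le> B" if "0 \<le> x" "x \<le> B" for x
  proof -
    have "x \<le> B * 1" using that by simp
    also have "\<dots> \<le> B * B" using l by (intro mult_left_mono) auto
    finally have "x \<le> B^2" by (simp add: power2_eq_square)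
    then show ?thesis using l by (simp add: real_le_lsqrt)
  qed
  show ?thesis
  proof (cases "sqrt ?D \<le> l2")
    case True
    have "sqrt ?D * \<alpha> \<le> sqrt ?D * (sqrt ?D * (1 + 1 / R))"
    proof -
      have "sqrt ?D * \<alpha> \<le> ?D + (sqrt ?D)^2 / R" using key[of "sqrt ?D"] True s by simp
      also have "\<dots> = (sqrt ?D)^2 + (sqrt ?D)^2 / R" using D0 by simp
      finally show ?thesis by (simp only: power2_eq_square distrib_left mult.assoc times_divide_eq_right mult_1_right)
    qed
    then have "\<alpha> \<le> sqrt ?D * (1 + 1/R)" using s by (simp only: mult_le_cancel_left_pos)
    also have "\<dots> \<le> sqrt ?D * (1 + B/R)" using R l s by (intro mult_left_mono) (auto simp: divide_right_mono)
    finally have "\<alpha> * sqrt (l1 * l2) \<le> (sqrt ?D * (1 + B/R)) * (sqrt (B * B))"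
      using \<alpha> l R s by (intro mult_mono real_sqrt_le_mono) auto
    then show ?thesis using l by (simp add: \<alpha>_def algebra_simps)
  next
    case False
    have sl: "sqrt l2 > 0" using l2 by simp
    have a: "?D \<le> sqrt ?D * sqrt l2"
    proof -
      have "sqrt ?D * sqrt ?D \<le> sqrt ?D * sqrt l2" using Dl s by (intro mult_left_mono real_sqrt_le_mono) auto
      then show ?thesis using D0 by simp
    qed
    have "l2 * (sqrt l2 * sqrt l2) \<le> sqrt ?D * (B * sqrt l2)"
      using False sB[of l2] l sl s by (intro mult_mono) auto
    then have b: "l2^2 / R \<le> (B / R) * (sqrt ?D * sqrt l2)"
      using l R by (simp add: field_simps power2_eq_square)
    have "(\<alpha> * sqrt l2) * sqrt l2 = l2 * \<alpha>" using l by simp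
    also have "\<dots> \<le> ?D + l2^2 / R" using l by (intro key) auto
    also have "\<dots> \<le> ((1 + B/R) * sqrt ?D) * sqrt l2" using a b by (simp add: algebra_simps)
    finally have "\<alpha> * sqrt l2 \<le> (1 + B/R) * sqrt ?D" using sl by (rule mult_right_le_imp_le)
    then have "(\<alpha> * sqrt l2) * sqrt l1 \<le> ((1 + B/R) * sqrt ?D) * B"
    proof (rule mult_mono)
      show "0 \<le> (1 + B/R) * sqrt ?D" using l R s by (intro mult_nonneg_nonneg add_nonneg_nonneg divide_nonneg_nonneg) auto
    qed (use sB[of l1] l in auto)
    then show ?thesis using l by (simp add: \<alpha>_def real_sqrt_mult algebra_simps)
  qed
qed

lemma bdist_along_chord:
  fixes \<Omega> :: "'a::euclidean_space set"
  assumes bd: "ball_domain R \<Omega>" and B: "\<And>x. x \<in> \<Omega> \<Longrightarrow> norm x \<le> B / 2" "1 \<le> B"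
    and e: "norm e = 1" and ch: "chord \<Omega> e \<xi> l1 l2" and \<rho>: "0 \<le> \<rho>" and h: "0 \<le> h"
    and w: "0 \<le> w" "w \<le> \<rho> * h * sqrt (l1 * l2)" "w \<le> l2"
  shows "\<bar>sqrt (bdist \<Omega> (\<xi> + w *\<^sub>R e)) - sqrt (bdist \<Omega> \<xi>)\<bar>
    \<le> (2 * (\<rho> * (B * (1 + B / R)) + \<rho>^2 * B^2 / R + \<rho> * B / sqrt (R/2)) + 1) * h"
proof -
  let ?D = "bdist \<Omega> \<xi>" and ?\<eta> = "\<xi> + w *\<^sub>R e"
  have R: "R > 0" using bd_facts(4)[OF bd] .
  have D0: "?D \<ge> 0" by (rule infdist_nonneg)
  have cl: "closed \<Omega>" using bd_facts(2)[OF bd] .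
  have l: "0 \<le> l1" "0 \<le> l2" "l1 \<le> B" "l2 \<le> B"
    using ch chord_bounded[OF ch cl e, of "B/2"] B by (auto simp: chord_def)
  have on: "\<And>u. u \<in> {-l1..l2} \<Longrightarrow> \<xi> + u *\<^sub>R e \<in> \<Omega>" using ch by (auto simp: chord_def)
  have in\<Omega>: "?\<eta> \<in> \<Omega>" "\<xi> \<in> \<Omega>" using on[of w] on[of 0] l w by auto
  have Dl: "?D \<le> l1" "?D \<le> l2"
  proof -
    have "\<xi> - l1 *\<^sub>R e \<in> frontier \<Omega>" "\<xi> + l2 *\<^sub>R e \<in> frontier \<Omega>" using ch by (auto simp: chord_def)
    from infdist_le[OF this(1), of \<xi>] infdist_le[OF this(2), of \<xi>] show "?D \<le> l1" "?D \<le> l2"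
      using e l by (auto simp: dist_norm)
  qed
  have sB: "sqrt (l1 * l2) \<le> B"
  proof -
    have "sqrt (l1 * l2) \<le> sqrt (B * B)" using l B by (intro real_sqrt_le_mono mult_mono) auto
    then show ?thesis using B by simp
  qed
  have wB: "w \<le> \<rho> * h * B" using w(2) mult_left_mono[OF sB, of "\<rho> * h"] \<rho> h by simp
  define C where "C = \<rho> * (B * (1 + B / R)) + \<rho>^2 * B^2 / R + \<rho> * B / sqrt (R/2)"
  have C: "C \<ge> 0" using R \<rho> B by (auto simp: C_def intro!: add_nonneg_nonneg mult_nonneg_nonneg divide_nonneg_nonneg)
  have "\<bar>bdist \<Omega> ?\<eta> - ?D\<bar> \<le> C * h * (sqrt ?D + h)"
  proof (cases "?D \<le> R/2")
    case False
    have "\<bar>bdist \<Omega> ?\<eta> - ?D\<bar> \<le> w" using bdist_lipschitz[OF bd, of ?\<eta> \<xi>] e w by simp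
    also have "\<dots> \<le> (\<rho> * B / sqrt (R/2)) * h * sqrt (R/2)" using wB R by (simp add: mult_ac)
    also have "\<dots> \<le> C * h * (sqrt ?D + h)"
    proof (intro mult_mono)
      show "\<rho> * B / sqrt (R/2) \<le> C" unfolding C_def using \<rho> B R by simp
      show "sqrt (R/2) \<le> sqrt ?D + h" using False h by (intro add_increasing2 real_sqrt_le_mono) auto
    qed (use h C R in auto)
    finally show ?thesis .
  next
    case True
    obtain n where n: "foot_normal R \<Omega> \<xi> n" using foot_normal_exists[OF bd in\<Omega>(2)] by auto
    have s1: "(n \<bullet> e) * sqrt (l1 * l2) \<le> B * (1 + B / R) * sqrt ?D"
      using on l B by (intro slope_along_chord[OF bd n True e l(1,3,2,4) B(2) _ Dl(2)]) auto
    have s2: "(n \<bullet> (-e)) * sqrt (l2 * l1) \<le> B * (1 + B / R) * sqrt ?D"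
    proof (rule slope_along_chord[OF bd n True _ l(2,4,1,3) B(2) _ Dl(1)])
      show "norm (-e) = 1" using e by simp
      show "\<xi> + u *\<^sub>R (-e) \<in> \<Omega>" if "u \<in> {0..l1}" for u using on[of "-u"] that l by auto
    qed
    have s: "\<bar>n \<bullet> e\<bar> * sqrt (l1 * l2) \<le> B * (1 + B / R) * sqrt ?D"
      using s1 s2 by (auto simp: abs_if mult.commute)
    have "\<bar>n \<bullet> (w *\<^sub>R e)\<bar> = \<bar>n \<bullet> e\<bar> * w" using w by (simp add: abs_mult mult.commute)
    also have "\<dots> \<le> \<bar>n \<bullet> e\<bar> * (\<rho> * h * sqrt (l1 * l2))" using w by (intro mult_left_mono) auto
    also have "\<dots> = (\<rho> * h) * (\<bar>n \<bullet> e\<bar> * sqrt (l1 * l2))" by simp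
    also have "\<dots> \<le> (\<rho> * h) * (B * (1 + B / R) * sqrt ?D)" using s \<rho> h by (intro mult_left_mono) auto
    finally have 1: "\<bar>n \<bullet> (w *\<^sub>R e)\<bar> \<le> (\<rho> * (B * (1 + B / R))) * h * sqrt ?D" by (simp add: algebra_simps)
    have "(norm (w *\<^sub>R e))^2 \<le> (\<rho> * h * B)^2" using wB w e by (intro power_mono) auto
    then have 2: "(norm (w *\<^sub>R e))^2 / R \<le> (\<rho>^2 * B^2 / R) * h * h"
      using R by (simp add: field_simps power2_eq_square)
    have "\<bar>bdist \<Omega> ?\<eta> - ?D\<bar> \<le> \<bar>n \<bullet> (w *\<^sub>R e)\<bar> + (norm (w *\<^sub>R e))^2 / R"
      using foot_normal_inner[OF bd n True in\<Omega>(1)] by linarith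
    also have "\<dots> \<le> (\<rho> * (B * (1 + B / R))) * h * sqrt ?D + (\<rho>^2 * B^2 / R) * h * h" using 1 2 by linarith
    also have "\<dots> \<le> C * h * sqrt ?D + C * h * h"
      using \<rho> B R h D0 by (intro add_mono mult_right_mono) (auto simp: C_def)
    finally show ?thesis by (simp add: algebra_simps)
  qed
  then show ?thesis unfolding C_def[symmetric]
    using C h D0 by (intro sqrt_diff_le) (auto simp: infdist_nonneg)
qed

section \<open>Integration along chords\<close>

lemma expanding_preimage_interval:
  fixes \<psi> :: "real \<Rightarrow> real"
  assumes exp: "\<And>v w. v \<in> X \<Longrightarrow> w \<in> X \<Longrightarrow> \<bar>v - w\<bar> \<le> 2 * \<bar>\<psi> v - \<psi> w\<bar>" and ab: "a \<le> b"
    and m: "X \<inter> \<psi> -` {a..b} \<in> sets borel"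
  shows "emeasure lborel (X \<inter> \<psi> -` {a..b}) \<le> ennreal (2 * (b - a))"
proof (cases "X \<inter> \<psi> -` {a..b} = {}")
  case False
  let ?Y = "X \<inter> \<psi> -` {a..b}"
  obtain x where x: "x \<in> ?Y" using False by blast
  have d: "\<bar>v - w\<bar> \<le> 2 * (b - a)" if "v \<in> ?Y" "w \<in> ?Y" for v w
  proof -
    have "\<bar>\<psi> v - \<psi> w\<bar> \<le> b - a" using that by auto
    then show ?thesis using exp[of v w] that by auto
  qed
  have bb: "bdd_below ?Y" "bdd_above ?Y"
    using d[OF x] by (auto intro!: bdd_belowI[of _ "x - 2 * (b - a)"] bdd_aboveI[of _ "x + 2 * (b - a)"] simp: abs_le_iff; smt (verit))+
  have Y: "?Y \<subseteq> {Inf ?Y..Sup ?Y}" using cInf_lower[OF _ bb(1)] cSup_upper[OF _ bb(2)] by (simp add: subset_eq)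
  have "Sup ?Y \<le> Inf ?Y + 2 * (b - a)"
  proof (rule cSup_least[OF False])
    fix v assume v: "v \<in> ?Y"
    have "v - 2 * (b - a) \<le> Inf ?Y"
    proof (rule cInf_greatest[OF False])
      fix w assume "w \<in> ?Y"
      from d[OF v this] show "v - 2 * (b - a) \<le> w" by linarith
    qed
    then show "v \<le> Inf ?Y + 2 * (b - a)" by linarith
  qed
  have "emeasure lborel ?Y \<le> emeasure lborel {Inf ?Y..Sup ?Y}" using Y by (intro emeasure_mono) auto
  also have "\<dots> \<le> ennreal (2 * (b - a))"
    using \<open>Sup ?Y \<le> Inf ?Y + 2 * (b - a)\<close> ab by (auto simp: emeasure_lborel_Icc_eq intro!: ennreal_leI)
  finally show ?thesis .
qed simp

lemma emeasure_distr_density_indicator: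
  fixes \<psi> :: "'a::euclidean_space \<Rightarrow> 'b::euclidean_space"
  assumes [measurable]: "X \<in> sets borel" "\<psi> \<in> borel_measurable borel" "B \<in> sets borel"
  shows "emeasure (distr (density lborel (indicator X)) borel \<psi>) B = emeasure lborel (X \<inter> \<psi> -` B)"
proof -
  have pm: "\<psi> -` B \<in> sets borel" by (rule measurable_sets_borel) measurable
  have "emeasure (distr (density lborel (indicator X)) borel \<psi>) B
      = emeasure (density lborel (indicator X)) (\<psi> -` B)"
    by (subst emeasure_distr) auto
  also have "\<dots> = (\<integral>\<^sup>+w. indicator X w * indicator (\<psi> -` B) w \<partial>lborel)"
    using pm by (subst emeasure_density) auto
  also have "\<dots> = (\<integral>\<^sup>+w. indicator (X \<inter> \<psi> -` B) w \<partial>lborel)"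
    by (intro nn_integral_cong) (auto simp: indicator_def)
  finally show ?thesis using pm by simp
qed

lemma expanding_preimage_le:
  fixes \<psi> :: "real \<Rightarrow> real"
  assumes exp: "\<And>v w. v \<in> X \<Longrightarrow> w \<in> X \<Longrightarrow> \<bar>v - w\<bar> \<le> 2 * \<bar>\<psi> v - \<psi> w\<bar>"
    and X: "X \<in> sets borel" and \<psi>: "\<psi> \<in> borel_measurable borel"
    and bnd: "\<And>w. w \<in> X \<Longrightarrow> \<bar>\<psi> w\<bar> \<le> M" and A: "A \<in> sets borel"
  shows "emeasure lborel (X \<inter> \<psi> -` A) \<le> 2 * emeasure lborel A"
proof -
  define \<nu> where "\<nu> = distr (density lborel (indicator X)) borel \<psi>"
  have [measurable]: "X \<in> sets borel" "\<psi> \<in> borel_measurable borel" by fact+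
  have \<psi>m: "\<psi> -` B \<in> sets borel" if "B \<in> sets borel" for B
    using measurable_sets_borel[OF \<psi> that] .
  have \<nu>: "emeasure \<nu> B = emeasure lborel (X \<inter> \<psi> -` B)" if "B \<in> sets borel" for B
    unfolding \<nu>_def by (rule emeasure_distr_density_indicator[OF X \<psi> that])
  have sets\<nu>: "sets \<nu> = sets borel" by (simp add: \<nu>_def)
  have ivl: "emeasure \<nu> {a..b} \<le> ennreal (2 * (b - a))" if "a \<le> b" for a b
    unfolding \<nu>[OF borel_closed[OF closed_atLeastAtMost]]
    using \<psi>m[of "{a..b}"] by (intro expanding_preimage_interval exp that) auto
  define A' where "A' = A \<inter> {-M..M}"
  have A': "A' \<in> sets borel" "A' \<subseteq> cbox (-M) M" using A by (auto simp: A'_def)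
  have "bounded A'" using A' bounded_cbox bounded_subset by blast
  then have lm: "A' \<in> lmeasurable" using A' by (simp add: bounded_set_imp_lmeasurable)
  have eA': "emeasure \<nu> A' \<le> 2 * emeasure lborel A'"
  proof (rule ennreal_le_epsilon)
    fix \<epsilon> :: real assume \<epsilon>: "0 < \<epsilon>"
    obtain \<D> where D: "countable \<D>" "\<And>K. K \<in> \<D> \<Longrightarrow> K \<subseteq> cbox (-M) M \<and> K \<noteq> {} \<and> (\<exists>c d. K = cbox c d)"
      "pairwise (\<lambda>A B. interior A \<inter> interior B = {}) \<D>" "A' \<subseteq> \<Union>\<D>" "\<Union>\<D> \<in> lmeasurable"
      "measure lebesgue (\<Union>\<D>) \<le> measure lebesgue A' + \<epsilon> / 2"
      using measurable_outer_intervals_bounded[OF lm A'(2), of "\<epsilon>/2"] \<epsilon> by (metis half_gt_zero)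
    define I where "I = (\<Union>K\<in>\<D>. interior K)"
    define N where "N = (\<Union>K\<in>\<D>. {Inf K, Sup K})"
    have K: "\<exists>c d. c \<le> d \<and> K = {c..d} \<and> interior K = {c<..<d} \<and> Inf K = c \<and> Sup K = d" if "K \<in> \<D>" for K
      using D(2)[OF that] by (auto simp: interior_atLeastAtMost_real)
    have "\<Union>\<D> \<subseteq> I \<union> N"
    proof
      fix x assume "x \<in> \<Union>\<D>"
      then obtain K where k: "K \<in> \<D>" "x \<in> K" by auto
      obtain c d where "K = {c..d}" "interior K = {c<..<d}" "Inf K = c" "Sup K = d" using K[OF k(1)] by auto
      then have "x \<in> interior K \<or> x \<in> {Inf K, Sup K}" using k(2) by auto
      then show "x \<in> I \<union> N" using k(1) unfolding I_def N_def by blast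
    qed
    have cN: "countable N" unfolding N_def using D(1) by auto
    have mI: "I \<in> sets borel" unfolding I_def by (intro borel_open open_UN) auto
    have mN: "N \<in> sets borel" using null_setsD2[OF countable_imp_null_set_lborel[OF cN]] by simp
    have \<nu>N: "emeasure \<nu> N = 0"
    proof -
      have "emeasure \<nu> {x} = 0" for x using ivl[of x x] by simp
      then have "(\<lambda>x. emeasure \<nu> {x}) = (\<lambda>_. 0)" by auto
      have "emeasure \<nu> (\<Union>x\<in>N. {x}) = (\<integral>\<^sup>+x. emeasure \<nu> {x} \<partial>count_space N)"
        using cN by (intro emeasure_UN_countable) (auto simp: disjoint_family_on_def sets\<nu>)
      then show ?thesis using \<open>(\<lambda>x. emeasure \<nu> {x}) = (\<lambda>_. 0)\<close> by simp
    qed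
    have disj: "disjoint_family_on interior \<D>"
      using D(3) by (auto simp: disjoint_family_on_def pairwise_def)
    have "emeasure \<nu> I = (\<integral>\<^sup>+K. emeasure \<nu> (interior K) \<partial>count_space \<D>)"
      unfolding I_def using D(1) disj by (intro emeasure_UN_countable) (auto simp: sets\<nu>)
    also have "\<dots> \<le> (\<integral>\<^sup>+K. 2 * emeasure lborel (interior K) \<partial>count_space \<D>)"
    proof (rule nn_integral_mono)
      fix K assume "K \<in> space (count_space \<D>)"
      then obtain c d where cd: "c \<le> d" "K = {c..d}" "interior K = {c<..<d}" using K by fastforce
      have "emeasure \<nu> (interior K) \<le> emeasure \<nu> K"
        using cd by (intro emeasure_mono) (auto simp: sets\<nu>)
      also have "\<dots> \<le> ennreal (2 * (d - c))" using ivl cd by simp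
      also have "\<dots> = ennreal 2 * ennreal (d - c)" using cd by (intro ennreal_mult) auto
      also have "\<dots> = 2 * emeasure lborel (interior K)" using cd(1) unfolding cd(3) by simp
      finally show "emeasure \<nu> (interior K) \<le> 2 * emeasure lborel (interior K)" .
    qed
    also have "\<dots> = 2 * emeasure lborel I"
      unfolding I_def using D(1) disj by (subst emeasure_UN_countable) (auto simp: nn_integral_cmult)
    also have "\<dots> \<le> 2 * (emeasure lborel A' + ennreal (\<epsilon>/2))"
    proof (rule mult_left_mono)
      have "emeasure lborel I = emeasure lebesgue I" using mI by simp
      also have "\<dots> \<le> emeasure lebesgue (\<Union>\<D>)"
        unfolding I_def using D(5) interior_subset by (intro emeasure_mono) (auto simp: fmeasurable_def)
      also have "\<dots> = ennreal (measure lebesgue (\<Union>\<D>))" using D(5) by (simp add: emeasure_eq_measure2)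
      also have "\<dots> \<le> ennreal (measure lebesgue A' + \<epsilon>/2)" using D(6) by (rule ennreal_leI)
      also have "\<dots> = emeasure lebesgue A' + ennreal (\<epsilon>/2)"
        using lm \<epsilon> by (simp add: emeasure_eq_measure2)
      finally show "emeasure lborel I \<le> emeasure lborel A' + ennreal (\<epsilon>/2)" using A' by simp
    qed simp
    finally have 1: "emeasure \<nu> I \<le> 2 * emeasure lborel A' + ennreal \<epsilon>"
      using \<epsilon> by (simp add: distrib_left ennreal_mult'[symmetric] flip: ennreal_numeral)
    have "emeasure \<nu> A' \<le> emeasure \<nu> (I \<union> N)"
      using D(4) \<open>\<Union>\<D> \<subseteq> I \<union> N\<close> mI mN by (intro emeasure_mono) (auto simp: sets\<nu>)
    also have "\<dots> \<le> emeasure \<nu> I + emeasure \<nu> N" using mI mN by (intro emeasure_subadditive) (auto simp: sets\<nu>)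
    finally show "emeasure \<nu> A' \<le> 2 * emeasure lborel A' + ennreal \<epsilon>" using 1 \<nu>N by simp
  qed
  have "X \<inter> \<psi> -` A = X \<inter> \<psi> -` A'" using bnd by (fastforce simp: A'_def abs_le_iff)
  then have "emeasure lborel (X \<inter> \<psi> -` A) = emeasure \<nu> A'" using \<nu>[OF A'(1)] by simp
  also note eA'
  also have "2 * emeasure lborel A' \<le> 2 * emeasure lborel A"
    using A by (intro mult_left_mono emeasure_mono) (auto simp: A'_def)
  finally show ?thesis .
qed

lemma nn_integral_expanding_le:
  fixes \<psi> :: "real \<Rightarrow> real"
  assumes exp: "\<And>v w. v \<in> X \<Longrightarrow> w \<in> X \<Longrightarrow> \<bar>v - w\<bar> \<le> 2 * \<bar>\<psi> v - \<psi> w\<bar>"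
    and X: "X \<in> sets borel" and \<psi>: "\<psi> \<in> borel_measurable borel"
    and bnd: "\<And>w. w \<in> X \<Longrightarrow> \<bar>\<psi> w\<bar> \<le> M" and G: "G \<in> borel_measurable borel"
  shows "(\<integral>\<^sup>+w\<in>X. G (\<psi> w) \<partial>lborel) \<le> 2 * (\<integral>\<^sup>+w. G w \<partial>lborel)"
proof -
  define \<nu> where "\<nu> = distr (density lborel (indicator X)) borel \<psi>"
  have [measurable]: "X \<in> sets borel" "\<psi> \<in> borel_measurable borel" "G \<in> borel_measurable borel" by fact+
  have "(\<integral>\<^sup>+w\<in>X. G (\<psi> w) \<partial>lborel) = nn_integral \<nu> G"
    unfolding \<nu>_def by (subst nn_integral_distr, simp, simp, subst nn_integral_density) (auto simp: mult.commute)
  also have "\<dots> \<le> nn_integral (scale_measure 2 lborel) G"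
  proof (rule nn_integral_mono_measure)
    show s: "sets \<nu> = sets (scale_measure 2 lborel)" by (simp add: \<nu>_def)
    show "\<nu> \<le> scale_measure 2 lborel"
    proof -
      have "emeasure \<nu> B \<le> emeasure (scale_measure 2 lborel) B" for B      proof (cases "B \<in> sets borel")
        case True
        have "emeasure \<nu> B = emeasure lborel (X \<inter> \<psi> -` B)"
          unfolding \<nu>_def by (rule emeasure_distr_density_indicator[OF X \<psi> True])
        also have "\<dots> \<le> 2 * emeasure lborel B" by (rule expanding_preimage_le[OF exp X \<psi> bnd True])
        finally show ?thesis by simp
      qed (simp add: \<nu>_def emeasure_notin_sets)
      then show ?thesis
        using s sets_eq_imp_space_eq[OF s] by (simp add: le_measure_iff le_fun_def)
    qed
  qed
  also have "\<dots> = 2 * (\<integral>\<^sup>+w. G w \<partial>lborel)" by (simp add: nn_integral_scale_measure)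
  finally show ?thesis .
qed

lemma chord_shift:
  fixes \<Omega> :: "'a::euclidean_space set"
  assumes ch: "chord \<Omega> e \<xi> l1 l2" and s: "-l1 \<le> s" "s \<le> l2"
  shows "chord \<Omega> e (\<xi> + s *\<^sub>R e) (l1 + s) (l2 - s)"
proof -
  have l: "0 \<le> l1" "0 \<le> l2" and on: "\<And>u. u \<in> {-l1..l2} \<Longrightarrow> \<xi> + u *\<^sub>R e \<in> \<Omega>"
    and mx: "\<And>b. 0 \<le> b \<Longrightarrow> (\<forall>u\<in>{0..b}. \<xi> + u *\<^sub>R e \<in> \<Omega>) \<Longrightarrow> b \<le> l2"
     "\<And>a. 0 \<le> a \<Longrightarrow> (\<forall>u\<in>{-a..0}. \<xi> + u *\<^sub>R e \<in> \<Omega>) \<Longrightarrow> a \<le> l1"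
    and fr: "\<xi> + l2 *\<^sub>R e \<in> frontier \<Omega>" "\<xi> - l1 *\<^sub>R e \<in> frontier \<Omega>"
    using ch unfolding chord_def by blast+
  have sh: "\<xi> + s *\<^sub>R e + u *\<^sub>R e = \<xi> + (s + u) *\<^sub>R e" for u by (simp add: algebra_simps)
  show ?thesis unfolding chord_def
  proof (intro conjI allI impI ballI)
    show "0 \<le> l1 + s" "0 \<le> l2 - s" using s by auto
    show "\<xi> + s *\<^sub>R e + u *\<^sub>R e \<in> \<Omega>" if "u \<in> {-(l1 + s)..l2 - s}" for u
      unfolding sh using that by (intro on) auto
    show "\<xi> + s *\<^sub>R e + (l2 - s) *\<^sub>R e \<in> frontier \<Omega>" unfolding sh using fr by simp
    show "\<xi> + s *\<^sub>R e - (l1 + s) *\<^sub>R e \<in> frontier \<Omega>" using fr by (simp add: algebra_simps)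
    fix b assume b: "0 \<le> b" "\<forall>u\<in>{0..b}. \<xi> + s *\<^sub>R e + u *\<^sub>R e \<in> \<Omega>"
    have "max 0 (s + b) \<le> l2"
    proof (rule mx(1), simp, intro ballI)
      fix u assume u: "u \<in> {0..max 0 (s + b)}"
      show "\<xi> + u *\<^sub>R e \<in> \<Omega>"
      proof (cases "u \<le> l2")
        case True then show ?thesis using u l by (intro on) auto
      next
        case False
        then have "u - s \<in> {0..b}" using u s l by (auto simp: max_def split: if_splits)
        from bspec[OF b(2) this] show ?thesis unfolding sh by simp
      qed
    qed
    then show "b \<le> l2 - s" by simp
  next
    fix a assume a: "0 \<le> a" "\<forall>u\<in>{-a..0}. \<xi> + s *\<^sub>R e + u *\<^sub>R e \<in> \<Omega>"
    have "max 0 (a - s) \<le> l1"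
    proof (rule mx(2), simp, intro ballI)
      fix u assume u: "u \<in> {- max 0 (a - s)..0}"
      show "\<xi> + u *\<^sub>R e \<in> \<Omega>"
      proof (cases "-l1 \<le> u")
        case True then show ?thesis using u l by (intro on) auto
      next
        case False
        then have "u - s \<in> {-a..0}" using u s l by (auto simp: max_def split: if_splits)
        from bspec[OF a(2) this] show ?thesis unfolding sh by simp
      qed
    qed
    then show "a \<le> l1 + s" by simp
  qed
qed

text \<open>\<open>A, B\<close> and \<open>A + s, B - s\<close> are the two parts of a chord cut at two of its points; the inequality
  bounds the derivative of \<open>w \<mapsto> w + c \<phi>(w)\<close> from below by \<open>1/2\<close> in difference form.\<close>

lemma chord_shift_expands:
  fixes A B s c :: real
  assumes "0 < A" "0 < s" "s < B" "0 \<le> c" and le: "c * sqrt ((A + s) * (B - s)) \<le> B - s"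
  shows "s \<le> 2 * (s + c * sqrt ((A + s) * (B - s)) - c * sqrt (A * B))"
proof -
  define A' B' where "A' = A + s" and "B' = B - s"
  have p: "A' > 0" "B' > 0" "B > 0" "A \<le> A'" "B' \<le> B" using assms by (auto simp: A'_def B'_def)
  have c: "c^2 * A' \<le> B'"
  proof -
    have "(c * sqrt (A' * B'))^2 \<le> B'^2" using le assms p by (intro power_mono) (auto simp: A'_def B'_def)
    then have "c^2 * (A' * B') \<le> B' * B'" using p by (simp only: power_mult_distrib) (simp add: power2_eq_square)
    then have "(c^2 * A') * B' \<le> B' * B'" by (simp add: mult.assoc)
    then show ?thesis using p(2) by (simp only: mult_le_cancel_right_pos)
  qed
  have "(c * A)^2 \<le> A * B"
  proof -
    have "(c * A)^2 = c^2 * A * A" by (simp add: power2_eq_square)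
    also have "\<dots> \<le> (c^2 * A') * A" using assms p by (intro mult_right_mono mult_left_mono) auto
    also have "\<dots> \<le> B * A" using c p assms by (intro mult_right_mono) auto
    finally show ?thesis by (simp add: mult.commute)
  qed
  then have 1: "c * A \<le> sqrt (A * B)" by (rule real_le_rsqrt)
  have "(c * A)^2 \<le> A' * B'"
  proof -
    have "(c * A)^2 = c^2 * A * A" by (simp add: power2_eq_square)
    also have "\<dots> \<le> (c^2 * A') * A'" using assms p by (intro mult_mono mult_left_mono) auto
    also have "\<dots> \<le> B' * A'" using c p assms by (intro mult_right_mono) auto
    finally show ?thesis by (simp add: mult.commute)
  qed
  then have 2: "c * A \<le> sqrt (A' * B')" by (rule real_le_rsqrt)
  have S: "sqrt (A * B) + sqrt (A' * B') > 0" using assms p by (intro add_pos_pos) auto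
  have d: "(sqrt (A * B) - sqrt (A' * B')) * (sqrt (A * B) + sqrt (A' * B')) = s * (A - B')"
  proof -
    have "(sqrt (A * B) - sqrt (A' * B')) * (sqrt (A * B) + sqrt (A' * B')) = A * B - A' * B'"
      using assms p by (simp add: algebra_simps)
    then show ?thesis by (simp add: A'_def B'_def algebra_simps)
  qed
  have "2 * (c * (sqrt (A * B) - sqrt (A' * B'))) * (sqrt (A * B) + sqrt (A' * B')) = s * (2 * (c * (A - B')))"
  proof -
    have "2 * (c * X) * Y = 2 * c * (X * Y)" for X Y :: real by simp
    then show ?thesis by (simp only: d) simp
  qed
  also have "\<dots> \<le> s * (sqrt (A * B) + sqrt (A' * B'))"
  proof (rule mult_left_mono)
    have "c * (A - B') \<le> c * A" using assms p by (intro mult_left_mono) auto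
    then show "2 * (c * (A - B')) \<le> sqrt (A * B) + sqrt (A' * B')" using 1 2 by linarith
  qed (use assms in auto)
  finally have "2 * (c * (sqrt (A * B) - sqrt (A' * B'))) \<le> s" using S by simp
  then show ?thesis by (simp add: A'_def B'_def algebra_simps)
qed

definition phi0 :: "'a::euclidean_space set \<Rightarrow> 'a \<Rightarrow> 'a \<Rightarrow> real" where
  "phi0 \<Omega> e \<xi> = (if \<xi> \<in> \<Omega> then phi \<Omega> e \<xi> else 0)"

lemma phi0_nonneg: "compact \<Omega> \<Longrightarrow> e \<noteq> 0 \<Longrightarrow> 0 \<le> phi0 \<Omega> e \<xi>"
  unfolding phi0_def using chord_exists phi_chord by (auto simp: chord_def) (metis chord_def chord_exists mult_nonneg_nonneg phi_chord real_sqrt_ge_zero)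

lemma measurable_phi0 [measurable]:
  fixes \<Omega> :: "'a::euclidean_space set"
  assumes \<Omega>: "compact \<Omega>" and e: "norm e = 1"
  shows "phi0 \<Omega> e \<in> borel_measurable borel"
proof (rule borel_measurableI_ge)
  fix c :: real
  have cl: "closed \<Omega>" using \<Omega> by (rule compact_imp_closed)
  have e0: "e \<noteq> 0" using e by auto
  obtain B where B: "\<And>x. x \<in> \<Omega> \<Longrightarrow> norm x \<le> B" using \<Omega> compact_imp_bounded bounded_iff by metis
  show "{x \<in> space borel. c \<le> phi0 \<Omega> e x} \<in> sets borel"
  proof (cases "c \<le> 0")
    case True
    then have "{x \<in> space borel. c \<le> phi0 \<Omega> e x} = UNIV" using phi0_nonneg[OF \<Omega> e0] by (auto intro: order_trans)
    then show ?thesis by simp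
  next
    case False
    define S where "S = {p. fst p \<in> \<Omega> \<and> fst (snd p) \<in> {0..2*B} \<and> snd (snd p) \<in> {0..2*B} \<and>
      closed_segment (fst p - fst (snd p) *\<^sub>R e) (fst p + snd (snd p) *\<^sub>R e) \<subseteq> \<Omega> \<and> c \<le> sqrt (fst (snd p) * snd (snd p))}"
    have "S = (\<Omega> \<times> {0..2*B} \<times> {0..2*B}) \<inter> ((\<lambda>p. (fst p - fst (snd p) *\<^sub>R e, fst p + snd (snd p) *\<^sub>R e)) -` {p. closed_segment (fst p) (snd p) \<subseteq> \<Omega>}
      \<inter> {p. c \<le> sqrt (fst (snd p) * snd (snd p))})"
      by (auto simp: S_def)
    moreover have "closed ((\<lambda>p. (fst p - fst (snd p) *\<^sub>R e, fst p + snd (snd p) *\<^sub>R e)) -` {p. closed_segment (fst p) (snd p) \<subseteq> \<Omega>})"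
      by (intro closed_vimage closed_segments_subset[OF cl] continuous_intros)
    moreover have "closed {p::'a \<times> real \<times> real. c \<le> sqrt (fst (snd p) * snd (snd p))}"
      by (intro closed_Collect_le continuous_intros)
    moreover have "compact (\<Omega> \<times> {0..2*B} \<times> {0..2*B})" using \<Omega> by (intro compact_Times) auto
    ultimately have "compact S" by (simp add: compact_Int_closed closed_Int)
    then have "compact (fst ` S)" by (intro compact_continuous_image continuous_intros)
    moreover have "{x \<in> space borel. c \<le> phi0 \<Omega> e x} = fst ` S"
    proof (intro set_eqI iffI)
      fix x assume "x \<in> {x \<in> space borel. c \<le> phi0 \<Omega> e x}"
      then have x: "x \<in> \<Omega>" "c \<le> phi \<Omega> e x" using False by (auto simp: phi0_def split: if_splits)
      obtain l1 l2 where ch: "chord \<Omega> e x l1 l2" using chord_exists[OF \<Omega> e0 x(1)] by auto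
      have l: "0 \<le> l1" "0 \<le> l2" "l1 \<le> 2*B" "l2 \<le> 2*B" using chord_bounded[OF ch cl e B] ch by (auto simp: chord_def)
      have "closed_segment (x - l1 *\<^sub>R e) (x + l2 *\<^sub>R e) \<subseteq> \<Omega>"
        using closed_segment_line[of "-l1" l2 x e] l ch by (auto simp: chord_def)
      then have "(x, l1, l2) \<in> S" using x l phi_chord[OF ch] by (simp add: S_def)
      then show "x \<in> fst ` S" by force
    next
      fix x assume "x \<in> fst ` S"
      then obtain a b where s: "(x, a, b) \<in> S" by auto
      then have x: "x \<in> \<Omega>" by (simp add: S_def)
      obtain l1 l2 where ch: "chord \<Omega> e x l1 l2" using chord_exists[OF \<Omega> e0 x] by auto
      have ab: "0 \<le> a" "0 \<le> b" "\<And>u. u \<in> {-a..b} \<Longrightarrow> x + u *\<^sub>R e \<in> \<Omega>"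
        using s closed_segment_line[of "-a" b x e] by (auto simp: S_def image_subset_iff)
      have "a \<le> l1" "b \<le> l2" using ch ab unfolding chord_def by auto
      then have "sqrt (a * b) \<le> sqrt (l1 * l2)" using ab by (intro real_sqrt_le_mono mult_mono) auto
      moreover have "c \<le> sqrt (a * b)" using s by (simp add: S_def)
      ultimately have "c \<le> sqrt (l1 * l2)" by linarith
      then show "x \<in> {x \<in> space borel. c \<le> phi0 \<Omega> e x}" using x phi_chord[OF ch] by (simp add: phi0_def)
    qed
    ultimately show ?thesis by (simp add: borel_compact)
  qed
qed

definition DT_dom :: "'a::euclidean_space set \<Rightarrow> 'a \<Rightarrow> real \<Rightarrow> 'a set" where
  "DT_dom \<Omega> e \<rho> = {\<xi> \<in> \<Omega>. closed_segment \<xi> (\<xi> + (\<rho> * phi0 \<Omega> e \<xi>) *\<^sub>R e) \<subseteq> \<Omega>}"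

lemma measurable_DT_dom:
  fixes \<Omega> :: "'a::euclidean_space set"
  assumes \<Omega>: "compact \<Omega>" and e: "norm e = 1"
  shows "DT_dom \<Omega> e \<rho> \<in> sets borel"
proof -
  have cl: "closed \<Omega>" using \<Omega> by (rule compact_imp_closed)
  note [measurable] = measurable_phi0[OF \<Omega> e] measurable_segment_pred[OF cl]
  have [measurable]: "\<Omega> \<in> sets borel" using cl by simp
  show ?thesis unfolding DT_dom_def by measurable
qed

lemma DT_dom_chord:
  fixes \<Omega> :: "'a::euclidean_space set"
  assumes \<xi>: "\<xi> \<in> DT_dom \<Omega> e \<rho>" and ch: "chord \<Omega> e \<xi> l1 l2" and "0 \<le> \<rho>"
  shows "phi0 \<Omega> e \<xi> = sqrt (l1 * l2)" "0 \<le> sqrt (l1 * l2)" "\<rho> * sqrt (l1 * l2) \<le> l2"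
proof -
  show p: "phi0 \<Omega> e \<xi> = sqrt (l1 * l2)" using \<xi> phi_chord[OF ch] by (simp add: phi0_def DT_dom_def)
  have l: "0 \<le> l1" "0 \<le> l2" using ch by (simp_all add: chord_def)
  show s: "0 \<le> sqrt (l1 * l2)" using l by simp
  have "closed_segment (\<xi> + 0 *\<^sub>R e) (\<xi> + (\<rho> * sqrt (l1 * l2)) *\<^sub>R e) \<subseteq> \<Omega>"
    using \<xi> p by (simp add: DT_dom_def)
  then have "\<forall>u\<in>{0..\<rho> * sqrt (l1 * l2)}. \<xi> + u *\<^sub>R e \<in> \<Omega>"
    using closed_segment_line[of 0 "\<rho> * sqrt (l1 * l2)" \<xi> e] s assms(3) by (simp add: image_subset_iff)
  moreover have "0 \<le> \<rho> * sqrt (l1 * l2)" using assms(3) s by simp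
  ultimately show "\<rho> * sqrt (l1 * l2) \<le> l2" using ch unfolding chord_def by blast
qed

lemma line_integral_DT:
  fixes \<Omega> :: "'a::euclidean_space set"
  assumes \<Omega>: "compact \<Omega>" and e: "norm e = 1" and c: "0 \<le> c" "c \<le> \<rho>"
    and G: "G \<in> borel_measurable borel"
  shows "(\<integral>\<^sup>+w. G (w + c * phi0 \<Omega> e (x + w *\<^sub>R e)) * indicator (DT_dom \<Omega> e \<rho>) (x + w *\<^sub>R e) \<partial>lborel)
     \<le> 3 * (\<integral>\<^sup>+w. G w \<partial>(lborel :: real measure))"
proof -
  have cl: "closed \<Omega>" using \<Omega> by (rule compact_imp_closed)
  have e0: "e \<noteq> 0" using e by auto
  define p where "p w = x + w *\<^sub>R e" for w
  define ph where "ph w = phi0 \<Omega> e (p w)" for w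
  define \<psi> where "\<psi> w = w + c * ph w" for w
  define X0 where "X0 = p -` DT_dom \<Omega> e \<rho>"
  obtain B where B: "\<And>x. x \<in> \<Omega> \<Longrightarrow> norm x \<le> B" using \<Omega> compact_imp_bounded bounded_iff by metis
  have [measurable]: "phi0 \<Omega> e \<in> borel_measurable borel" "DT_dom \<Omega> e \<rho> \<in> sets borel" "G \<in> borel_measurable borel"
    using measurable_phi0[OF \<Omega> e] measurable_DT_dom[OF \<Omega> e] G by auto
  have [measurable]: "p \<in> borel_measurable borel" unfolding p_def by measurable
  have X0 [measurable]: "X0 \<in> sets borel" unfolding X0_def
    using measurable_sets_borel[of p borel "DT_dom \<Omega> e \<rho>"] by simp
  have ph [measurable]: "ph \<in> borel_measurable borel" unfolding ph_def by measurable
  have \<psi> [measurable]: "\<psi> \<in> borel_measurable borel" unfolding \<psi>_def by measurable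
  obtain qr :: "nat \<Rightarrow> rat" where qr: "surj qr" using uncountable_def[of "UNIV::rat set"] countable_rat by auto
  define q where "q n = real_of_rat (qr n)" for n
  define C where "C n = {w. closed_segment (p w) (p (q n)) \<subseteq> \<Omega>}" for n
  define D where "D = disjointed C"
  have C [measurable]: "C n \<in> sets borel" for n
  proof -
    note [measurable] = measurable_segment_pred[OF cl]
    show ?thesis unfolding C_def by measurable
  qed
  have Dm [measurable]: "D n \<in> sets borel" for n
    using sets.range_disjointed_sets[of C borel] C unfolding D_def by blast
  have segp: "closed_segment (p a) (p b) = p ` closed_segment a b" for a b
  proof -
    have "closed_segment (p a) (p b) = p ` {a..b}" if "a \<le> b" for a b
      unfolding p_def using closed_segment_line[OF that] by auto
    from this[of a b] this[of b a] show ?thesis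
      by (metis closed_segment_commute closed_segment_eq_real_ivl linear)
  qed
  have Cmem: "w \<in> C n \<longleftrightarrow> (\<forall>u\<in>closed_segment w (q n). p u \<in> \<Omega>)" for w n
    unfolding C_def segp by auto
  have Cmove: "v \<in> C n" if "w \<in> C n" "\<forall>u\<in>closed_segment w v. p u \<in> \<Omega>" for v w n
    unfolding Cmem
  proof
    fix u assume "u \<in> closed_segment v (q n)"
    then have "u \<in> closed_segment w v \<or> u \<in> closed_segment w (q n)"
      by (auto simp: closed_segment_eq_real_ivl split: if_splits)
    then show "p u \<in> \<Omega>" using that Cmem by blast
  qed
  have Dmove: "v \<in> D n" if "w \<in> D n" "\<forall>u\<in>closed_segment w v. p u \<in> \<Omega>" for v w n
    using that Cmove[of w _ v] Cmove[of v _ w] unfolding D_def disjointed_def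
    by (auto simp: closed_segment_commute)
  define X where "X n = X0 \<inter> D n \<inter> {w. ph w > 0}" for n
  have Xm [measurable]: "X n \<in> sets borel" for n unfolding X_def by measurable
  have ch: "\<exists>l1 l2. chord \<Omega> e (p w) l1 l2 \<and> ph w = sqrt (l1 * l2) \<and> \<rho> * ph w \<le> l2 \<and> 0 \<le> ph w" if w: "w \<in> X0" for w
  proof -
    have d: "p w \<in> DT_dom \<Omega> e \<rho>" using w by (simp add: X0_def)
    have "p w \<in> \<Omega>" using d by (simp add: DT_dom_def)
    then obtain l1 l2 where ch: "chord \<Omega> e (p w) l1 l2" using chord_exists[OF \<Omega> e0] by blast
    show ?thesis using DT_dom_chord[OF d ch] c ch by (auto simp: ph_def)
  qed
  have on: "p v \<in> \<Omega>" if "chord \<Omega> e (p w) l1 l2" "v - w \<in> {-l1..l2}" for v w l1 l2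
  proof -
    have "p w + (v - w) *\<^sub>R e \<in> \<Omega>" using that unfolding chord_def by blast
    then show ?thesis by (simp add: p_def algebra_simps)
  qed
  have \<psi>on: "\<forall>u\<in>closed_segment w (\<psi> w). p u \<in> \<Omega>" if w: "w \<in> X0" for w
  proof
    fix u assume u: "u \<in> closed_segment w (\<psi> w)"
    obtain l1 l2 where l: "chord \<Omega> e (p w) l1 l2" "\<rho> * ph w \<le> l2" "0 \<le> ph w" using ch[OF w] by auto
    have "c * ph w \<le> l2" using l mult_right_mono[OF c(2) l(3)] by linarith
    then show "p u \<in> \<Omega>" using u l c by (intro on[OF l(1)]) (auto simp: \<psi>_def closed_segment_eq_real_ivl chord_def)
  qed
  have cover: "\<exists>n. w \<in> X n" if w: "w \<in> X0" "ph w > 0" for w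
  proof -
    obtain l1 l2 where l: "chord \<Omega> e (p w) l1 l2" "ph w = sqrt (l1 * l2)" using ch[OF w(1)] by auto
    have l0: "l1 \<ge> 0" "l2 \<ge> 0" using l by (auto simp: chord_def)
    have "l2 > 0" using w(2) l(2) l0 by (cases "l2 = 0") auto
    then obtain s where s: "s \<in> \<rat>" "w < s" "s < w + l2" using Rats_dense_in_real[of w "w + l2"] by auto
    then obtain n where n: "q n = s" using qr unfolding q_def by (metis Rats_cases surjD)
    have "w \<in> C n" unfolding Cmem n using s l0 by (auto intro!: on[OF l(1)] simp: closed_segment_eq_real_ivl)
    then have "w \<in> (\<Union>n. D n)" unfolding D_def UN_disjointed_eq by auto
    then show ?thesis using w by (auto simp: X_def)
  qed
  have expand: "\<bar>v - w\<bar> \<le> 2 * \<bar>\<psi> v - \<psi> w\<bar>" if vw: "v \<in> X n" "w \<in> X n" for v w n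
  proof -
    have *: "\<bar>v - w\<bar> \<le> 2 * \<bar>\<psi> v - \<psi> w\<bar>" if vw: "v \<in> X n" "w \<in> X n" and lt: "v < w" for v w
    proof -
      have in': "v \<in> X0" "w \<in> X0" "ph v > 0" "ph w > 0" "v \<in> C n" "w \<in> C n"
        using vw disjointed_subset[of C n] by (auto simp: X_def D_def)
      obtain l1 l2 where l: "chord \<Omega> e (p v) l1 l2" "ph v = sqrt (l1 * l2)" using ch[OF in'(1)] by auto
      obtain m1 m2 where m: "chord \<Omega> e (p w) m1 m2" "ph w = sqrt (m1 * m2)" "\<rho> * ph w \<le> m2" using ch[OF in'(2)] by auto
      define s where "s = w - v"
      have s: "s > 0" using lt by (simp add: s_def)
      have seg: "p u \<in> \<Omega>" if "u \<in> closed_segment v w" for u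
      proof -
        have "u \<in> closed_segment v (q n) \<or> u \<in> closed_segment w (q n)"
          using that by (auto simp: closed_segment_eq_real_ivl split: if_splits)
        then show ?thesis using in'(5,6) Cmem by blast
      qed
      have "\<forall>u\<in>{0..s}. p v + u *\<^sub>R e \<in> \<Omega>"
      proof
        fix u assume "u \<in> {0..s}"
        then have "p (v + u) \<in> \<Omega>" by (intro seg) (auto simp: closed_segment_eq_real_ivl s_def)
        then show "p v + u *\<^sub>R e \<in> \<Omega>" by (simp add: p_def algebra_simps)
      qed
      then have sl: "s \<le> l2" using l(1) s unfolding chord_def by auto
      have l0: "l1 \<ge> 0" "l2 \<ge> 0" using l by (auto simp: chord_def)
      have "chord \<Omega> e (p v + s *\<^sub>R e) (l1 + s) (l2 - s)" using sl l0 s by (intro chord_shift[OF l(1)]) auto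
      moreover have "p v + s *\<^sub>R e = p w" by (simp add: p_def s_def algebra_simps)
      ultimately have m': "m1 = l1 + s" "m2 = l2 - s" using chord_unique[OF m(1)] by auto
      have pos: "0 < l1" "s < l2" using in'(3,4) l(2) m(2) m' l0 sl by (auto simp: less_le)
      have "c * ph w \<le> l2 - s" using m(3) m' mult_right_mono[OF c(2), of "ph w"] in'(4) by linarith
      then have "s \<le> 2 * (s + c * sqrt ((l1 + s) * (l2 - s)) - c * sqrt (l1 * l2))"
        using m(2) m' by (intro chord_shift_expands[OF pos(1) s pos(2) c(1)]) simp
      also have "s + c * sqrt ((l1 + s) * (l2 - s)) - c * sqrt (l1 * l2) = \<psi> w - \<psi> v"
        using m(2) m' l(2) by (simp add: \<psi>_def s_def)
      finally show ?thesis using s by (simp add: s_def)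
    qed
    show ?thesis using *[OF vw] *[OF vw(2,1)] by (cases v w rule: linorder_cases) (auto simp: abs_minus_commute)
  qed
  have bnd: "\<bar>\<psi> w\<bar> \<le> B + norm x" if w: "w \<in> X0" for w
  proof -
    have "p (\<psi> w) \<in> \<Omega>" using \<psi>on[OF w] by auto
    then have "norm (x + \<psi> w *\<^sub>R e) \<le> B" using B by (simp add: p_def)
    then show ?thesis using norm_triangle_ineq4[of "x + \<psi> w *\<^sub>R e" x] e by simp
  qed
  have part: "(\<integral>\<^sup>+w\<in>X n. G (\<psi> w) \<partial>lborel) \<le> 2 * (\<integral>\<^sup>+w\<in>D n. G w \<partial>lborel)" for n
  proof -
    have "(\<integral>\<^sup>+w\<in>X n. G (\<psi> w) \<partial>lborel) = (\<integral>\<^sup>+w\<in>X n. (G (\<psi> w) * indicator (D n) (\<psi> w)) \<partial>lborel)"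
    proof (rule nn_integral_cong)
      fix w
      show "G (\<psi> w) * indicator (X n) w = G (\<psi> w) * indicator (D n) (\<psi> w) * indicator (X n) w"
      proof (cases "w \<in> X n")
        case True
        then have "\<psi> w \<in> D n" using Dmove[of w n "\<psi> w"] \<psi>on[of w] by (auto simp: X_def)
        then show ?thesis by simp
      qed simp
    qed
    also have "\<dots> \<le> 2 * (\<integral>\<^sup>+w\<in>D n. G w \<partial>lborel)"
    proof (rule nn_integral_expanding_le[where M = "B + norm x" and G = "\<lambda>w. G w * indicator (D n) w"])
      show "\<bar>\<psi> w\<bar> \<le> B + norm x" if "w \<in> X n" for w using that bnd by (simp add: X_def)
    qed (use expand in auto)
    finally show ?thesis .
  qed
  have disjD: "disjoint_family D" unfolding D_def by (rule disjoint_family_disjointed)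
  have "(\<integral>\<^sup>+w. G (w + c * phi0 \<Omega> e (x + w *\<^sub>R e)) * indicator (DT_dom \<Omega> e \<rho>) (x + w *\<^sub>R e) \<partial>lborel)
     = (\<integral>\<^sup>+w\<in>X0. G (\<psi> w) \<partial>lborel)"
    by (intro nn_integral_cong) (simp add: \<psi>_def ph_def p_def X0_def indicator_def)
  also have "\<dots> \<le> (\<integral>\<^sup>+w. G w + (\<Sum>n. G (\<psi> w) * indicator (X n) w) \<partial>lborel)"
  proof (rule nn_integral_mono)
    fix w
    show "G (\<psi> w) * indicator X0 w \<le> G w + (\<Sum>n. G (\<psi> w) * indicator (X n) w)"
    proof (cases "w \<in> X0")
      case True
      show ?thesis
      proof (cases "ph w > 0")
        case pos: True
        obtain n where n: "w \<in> X n" using cover[OF True pos] by auto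
        have "G (\<psi> w) * indicator X0 w = (\<Sum>m\<in>{n}. G (\<psi> w) * indicator (X m) w)" using n True by simp
        also have "\<dots> \<le> (\<Sum>n. G (\<psi> w) * indicator (X n) w)" by (intro sum_le_suminf) auto
        finally show ?thesis by (rule order_trans) simp
      next
        case False
        then have "ph w = 0" using ch[OF True] by force
        then show ?thesis using True by (simp add: \<psi>_def)
      qed
    qed simp
  qed
  also have "\<dots> = (\<integral>\<^sup>+w. G w \<partial>lborel) + (\<Sum>n. \<integral>\<^sup>+w\<in>X n. G (\<psi> w) \<partial>lborel)"
  proof -
    have "(\<integral>\<^sup>+w. (\<Sum>n. G (\<psi> w) * indicator (X n) w) \<partial>lborel) = (\<Sum>n. \<integral>\<^sup>+w\<in>X n. G (\<psi> w) \<partial>lborel)"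
      by (rule nn_integral_suminf) measurable
    moreover have "(\<integral>\<^sup>+w. G w + (\<Sum>n. G (\<psi> w) * indicator (X n) w) \<partial>lborel)
      = (\<integral>\<^sup>+w. G w \<partial>lborel) + (\<integral>\<^sup>+w. (\<Sum>n. G (\<psi> w) * indicator (X n) w) \<partial>lborel)"
      by (rule nn_integral_add) measurable
    ultimately show ?thesis by simp
  qed
  also have "\<dots> \<le> (\<integral>\<^sup>+w. G w \<partial>lborel) + (\<Sum>n. 2 * (\<integral>\<^sup>+w\<in>D n. G w \<partial>lborel))"
    using part by (intro add_left_mono suminf_le) auto
  also have "(\<Sum>n. 2 * (\<integral>\<^sup>+w\<in>D n. G w \<partial>lborel)) = 2 * (\<integral>\<^sup>+w. (\<Sum>n. G w * indicator (D n) w) \<partial>lborel)"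
  proof -
    have "(\<integral>\<^sup>+w. (\<Sum>n. G w * indicator (D n) w) \<partial>lborel) = (\<Sum>n. \<integral>\<^sup>+w\<in>D n. G w \<partial>lborel)"
      by (rule nn_integral_suminf) measurable
    then show ?thesis by (simp only: ennreal_suminf_cmult)
  qed
  also have "\<dots> \<le> 2 * (\<integral>\<^sup>+w. G w \<partial>lborel)"
  proof (intro mult_left_mono nn_integral_mono)
    fix w
    have "(\<Sum>n. G w * indicator (D n) w) = G w * indicator (\<Union>n. D n) w"
      using suminf_indicator[OF disjD, of w] by simp
    then show "(\<Sum>n. G w * indicator (D n) w) \<le> G w" by (simp add: indicator_def)
  qed simp
  also have "(\<integral>\<^sup>+w. G w \<partial>lborel) + 2 * (\<integral>\<^sup>+w. G w \<partial>lborel) = 3 * (\<integral>\<^sup>+w. G w \<partial>lborel)"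
    by (metis distrib_right mult_1 numeral_Bit1 numeral_One add.commute one_add_one numeral_plus_one)
  finally show ?thesis by (simp add: add_mono)
qed

text \<open>Averaging over the translates by \<open>w e\<close> with \<open>\<bar>w\<bar> \<le> B\<close> reduces the integral over the whole space
  to integrals over lines in direction \<open>e\<close>.\<close>

lemma integral_DT:
  fixes \<Omega> :: "'a::euclidean_space set"
  assumes \<Omega>: "compact \<Omega>" and e: "norm e = 1" and c: "0 \<le> c" "c \<le> \<rho>" and G: "G \<in> borel_measurable borel"
  shows "(\<integral>\<^sup>+\<xi>\<in>DT_dom \<Omega> e \<rho>. G (\<xi> + (c * phi0 \<Omega> e \<xi>) *\<^sub>R e) \<partial>lborel) \<le> 6 * (\<integral>\<^sup>+\<xi>. G \<xi> \<partial>lborel)"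
proof -
  have cl: "closed \<Omega>" using \<Omega> by (rule compact_imp_closed)
  have e0: "e \<noteq> 0" using e by auto
  obtain B0 where B0: "\<And>x. x \<in> \<Omega> \<Longrightarrow> norm x \<le> B0" using \<Omega> compact_imp_bounded bounded_iff by metis
  define B where "B = max 1 (2 * B0)"
  have B: "B \<ge> 1" "2 * B0 \<le> B" by (auto simp: B_def)
  define F where "F \<xi> = G (\<xi> + (c * phi0 \<Omega> e \<xi>) *\<^sub>R e) * indicator (DT_dom \<Omega> e \<rho>) \<xi>" for \<xi>
  have [measurable]: "phi0 \<Omega> e \<in> borel_measurable borel" "DT_dom \<Omega> e \<rho> \<in> sets borel" "G \<in> borel_measurable borel"
    using measurable_phi0[OF \<Omega> e] measurable_DT_dom[OF \<Omega> e] G by auto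
  have F [measurable]: "F \<in> borel_measurable borel" unfolding F_def by measurable
  have step: "\<bar>c * phi0 \<Omega> e \<xi>\<bar> \<le> B" if d: "\<xi> \<in> DT_dom \<Omega> e \<rho>" for \<xi>
  proof -
    have "\<xi> \<in> \<Omega>" using d by (simp add: DT_dom_def)
    then obtain l1 l2 where ch: "chord \<Omega> e \<xi> l1 l2" using chord_exists[OF \<Omega> e0] by blast
    have r: "0 \<le> \<rho>" using c by simp
    have "c * phi0 \<Omega> e \<xi> \<le> l2" "0 \<le> c * phi0 \<Omega> e \<xi>"
      using DT_dom_chord[OF d ch r] mult_right_mono[OF c(2), of "phi0 \<Omega> e \<xi>"] c by auto
    moreover have "l2 \<le> B" using chord_bounded(2)[OF ch cl e B0] B by simp
    ultimately show ?thesis by simp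
  qed
  let ?I = "\<lambda>A. \<lambda>w::real. indicator {-A..A} w :: ennreal"
  have line: "(\<integral>\<^sup>+w. F (x + w *\<^sub>R e) * ?I B w \<partial>lborel) \<le> 3 * (\<integral>\<^sup>+w. G (x + w *\<^sub>R e) * ?I (2*B) w \<partial>lborel)" for x
  proof -
    have "(\<integral>\<^sup>+w. F (x + w *\<^sub>R e) * ?I B w \<partial>lborel) \<le>
      (\<integral>\<^sup>+w. (\<lambda>v. G (x + v *\<^sub>R e) * ?I (2*B) v) (w + c * phi0 \<Omega> e (x + w *\<^sub>R e)) * indicator (DT_dom \<Omega> e \<rho>) (x + w *\<^sub>R e) \<partial>lborel)"
    proof (rule nn_integral_mono)
      fix w
      show "F (x + w *\<^sub>R e) * ?I B w \<le> (\<lambda>v. G (x + v *\<^sub>R e) * ?I (2*B) v) (w + c * phi0 \<Omega> e (x + w *\<^sub>R e)) * indicator (DT_dom \<Omega> e \<rho>) (x + w *\<^sub>R e)"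
      proof (cases "x + w *\<^sub>R e \<in> DT_dom \<Omega> e \<rho> \<and> w \<in> {-B..B}")
        case True
        then have "\<bar>w\<bar> \<le> B" "\<bar>c * phi0 \<Omega> e (x + w *\<^sub>R e)\<bar> \<le> B" using step by auto
        then have "w + c * phi0 \<Omega> e (x + w *\<^sub>R e) \<in> {-(2*B)..2*B}" by auto
        then show ?thesis using True by (simp add: F_def algebra_simps)
      qed (auto simp: F_def)
    qed
    also have "\<dots> \<le> 3 * (\<integral>\<^sup>+w. G (x + w *\<^sub>R e) * ?I (2*B) w \<partial>lborel)"
      by (rule line_integral_DT[OF \<Omega> e c]) measurable
    finally show ?thesis .
  qed
  have fub: "(\<integral>\<^sup>+x. (\<integral>\<^sup>+w. K (x + w *\<^sub>R e) * ?I A w \<partial>lborel) \<partial>lborel) = ennreal (2 * A) * (\<integral>\<^sup>+x. K x \<partial>lborel)"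
    if [measurable]: "K \<in> borel_measurable borel" and A: "0 \<le> A" for A and K :: "'a \<Rightarrow> ennreal"
  proof -
    have "(\<integral>\<^sup>+x. (\<integral>\<^sup>+w. K (x + w *\<^sub>R e) * ?I A w \<partial>lborel) \<partial>lborel) = (\<integral>\<^sup>+w. (\<integral>\<^sup>+x. K (x + w *\<^sub>R e) * ?I A w \<partial>lborel) \<partial>lborel)"
      by (rule lborel_pair.Fubini'[symmetric]) measurable
    also have "\<dots> = (\<integral>\<^sup>+w. (\<integral>\<^sup>+x. K x \<partial>lborel) * ?I A w \<partial>lborel)"
    proof (rule nn_integral_cong)
      fix w
      have "(\<integral>\<^sup>+x. K (x + w *\<^sub>R e) * ?I A w \<partial>lborel) = (\<integral>\<^sup>+x. K (w *\<^sub>R e + x) \<partial>lborel) * ?I A w"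
        by (subst nn_integral_multc) (auto simp: add.commute)
      then show "(\<integral>\<^sup>+x. K (x + w *\<^sub>R e) * ?I A w \<partial>lborel) = (\<integral>\<^sup>+x. K x \<partial>lborel) * ?I A w"
        by (simp add: nn_integral_lborel_translate)
    qed
    also have "\<dots> = ennreal (2 * A) * (\<integral>\<^sup>+x. K x \<partial>lborel)"
      using A by (subst nn_integral_cmult_indicator) (auto simp: mult.commute)
    finally show ?thesis .
  qed
  have "ennreal (2 * B) * (\<integral>\<^sup>+x. F x \<partial>lborel) = (\<integral>\<^sup>+x. (\<integral>\<^sup>+w. F (x + w *\<^sub>R e) * ?I B w \<partial>lborel) \<partial>lborel)"
    using B by (intro fub[symmetric]) auto
  also have "\<dots> \<le> (\<integral>\<^sup>+x. 3 * (\<integral>\<^sup>+w. G (x + w *\<^sub>R e) * ?I (2*B) w \<partial>lborel) \<partial>lborel)"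
    by (intro nn_integral_mono line)
  also have "\<dots> = 3 * (\<integral>\<^sup>+x. (\<integral>\<^sup>+w. G (x + w *\<^sub>R e) * ?I (2*B) w \<partial>lborel) \<partial>lborel)"
    by (rule nn_integral_cmult) measurable
  also have "\<dots> = 3 * (ennreal (2 * (2 * B)) * (\<integral>\<^sup>+x. G x \<partial>lborel))" using B by (subst fub) auto
  also have "\<dots> = ennreal (2 * B) * (6 * (\<integral>\<^sup>+x. G x \<partial>lborel))"
  proof -
    have "ennreal (2 * (2 * B)) = ennreal 2 * ennreal (2 * B)" using B by (intro ennreal_mult) auto
    moreover have "(3::ennreal) * ennreal 2 = 6" by (simp flip: ennreal_numeral ennreal_mult')
    ultimately show ?thesis by (metis (no_types, lifting) mult.assoc mult.commute)
  qed
  finally have "(\<integral>\<^sup>+x. F x \<partial>lborel) \<le> 6 * (\<integral>\<^sup>+x. G x \<partial>lborel)"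
    using B by (subst (asm) ennreal_mult_le_mult_iff) auto
  then show ?thesis by (simp add: F_def)
qed

section \<open>The Ditzian--Totik part\<close>

lemma bdist_measurable [measurable]:
  fixes \<Omega> :: "'a::euclidean_space set"
  assumes [measurable]: "F \<in> borel_measurable M"
  shows "(\<lambda>x. bdist \<Omega> (F x)) \<in> borel_measurable M"
proof -
  have "(\<lambda>x. bdist \<Omega> x) \<in> borel_measurable borel"
    by (intro borel_measurable_continuous_onI continuous_intros)
  then show ?thesis by measurable
qed

lemma rho_measurable [measurable]:
  fixes \<Omega> :: "'a::euclidean_space set"
  assumes [measurable]: "F \<in> borel_measurable M" "G \<in> borel_measurable M"
  shows "(\<lambda>x. rho \<Omega> (F x) (G x)) \<in> borel_measurable M"
  unfolding rho_def by measurable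

lemma measurable_local_modulus:
  fixes \<Omega> :: "'a::euclidean_space set"
  assumes \<Omega>: "closed \<Omega>" and q: "q \<noteq> \<infinity>" and f: "f \<in> borel_measurable borel"
  shows "(\<lambda>\<xi>. local_modulus \<Omega> r f \<xi> \<delta> q) \<in> borel_measurable borel"
proof -
  have [measurable]: "\<Omega> \<in> sets borel" using \<Omega> by simp
  have U: "emeasure lebesgue (rho_ball \<Omega> \<xi> \<delta>) = (\<integral>\<^sup>+\<eta>. indicator (rho_ball \<Omega> \<xi> \<delta>) \<eta> \<partial>lborel)" for \<xi>
    using closed_rho_ball[OF \<Omega>] by simp
  have ind: "(\<lambda>p. indicator (rho_ball \<Omega> (fst p) \<delta>) (snd p) :: ennreal) \<in> borel_measurable (borel \<Otimes>\<^sub>M borel)"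
  proof -
    have "(\<lambda>p. indicator (rho_ball \<Omega> (fst p) \<delta>) (snd p) :: ennreal) = indicator {p. snd p \<in> \<Omega> \<and> rho \<Omega> (fst p) (snd p) \<le> \<delta>}"
      by (auto simp: indicator_def rho_ball_def fun_eq_iff)
    moreover have "{p \<in> space (borel \<Otimes>\<^sub>M borel). snd p \<in> \<Omega> \<and> rho \<Omega> (fst p) (snd p) \<le> \<delta>} \<in> sets (borel \<Otimes>\<^sub>M borel)"
      by measurable
    ultimately show ?thesis by (simp add: space_pair_measure)
  qed
  have ld: "(\<lambda>p. ldiff \<Omega> r f (fst p) (snd p)) \<in> borel_measurable (borel \<Otimes>\<^sub>M borel)"
    by (rule measurable_ldiff[OF \<Omega> f]) auto
  have 1: "(\<lambda>\<xi>. \<integral>\<^sup>+\<eta>. epow (ldiff \<Omega> r f \<xi> \<eta>) (enn2real q) * indicator (rho_ball \<Omega> \<xi> \<delta>) \<eta> \<partial>lborel) \<in> borel_measurable borel"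
  proof (rule lborel.borel_measurable_nn_integral)
    have "(\<lambda>p. epow (ldiff \<Omega> r f (fst p) (snd p)) (enn2real q) * indicator (rho_ball \<Omega> (fst p) \<delta>) (snd p)) \<in> borel_measurable (borel \<Otimes>\<^sub>M borel)"
      using ind ld by measurable
    then show "(\<lambda>(\<xi>, \<eta>). epow (ldiff \<Omega> r f \<xi> \<eta>) (enn2real q) * indicator (rho_ball \<Omega> \<xi> \<delta>) \<eta>) \<in> borel_measurable (borel \<Otimes>\<^sub>M lborel)"
      by (simp add: case_prod_unfold cong: measurable_cong_sets)
  qed
  have 2: "(\<lambda>\<xi>. \<integral>\<^sup>+\<eta>. indicator (rho_ball \<Omega> \<xi> \<delta>) \<eta> \<partial>lborel) \<in> borel_measurable borel"
    using ind by (intro lborel.borel_measurable_nn_integral) (simp add: case_prod_unfold cong: measurable_cong_sets)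
  show ?thesis unfolding local_modulus_fin[OF q] U using 1 2 by measurable
qed

lemma fdiff_on_cong:
  assumes "\<And>j. j \<le> r \<Longrightarrow> \<eta> + real j *\<^sub>R \<xi> \<in> \<Omega> \<Longrightarrow> f (\<eta> + real j *\<^sub>R \<xi>) = g (\<eta> + real j *\<^sub>R \<xi>)"
  shows "fdiff_on r \<xi> f \<Omega> \<eta> = fdiff_on r \<xi> g \<Omega> \<eta>"
proof (cases "closed_segment \<eta> (\<eta> + real r *\<^sub>R \<xi>) \<subseteq> \<Omega>")
  case True
  have "f (\<eta> + real j *\<^sub>R \<xi>) = g (\<eta> + real j *\<^sub>R \<xi>)" if j: "j \<le> r" for j
  proof (rule assms[OF j])
    have "\<eta> + real j *\<^sub>R \<xi> \<in> closed_segment \<eta> (\<eta> + real r *\<^sub>R \<xi>)"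
    proof (cases "r = 0")
      case False
      then show ?thesis using j unfolding closed_segment_mem
        by (intro image_eqI[of _ _ "real j / real r"]) auto
    qed (use j in simp)
    then show "\<eta> + real j *\<^sub>R \<xi> \<in> \<Omega>" using True by blast
  qed
  then show ?thesis by (simp add: fdiff_on_def fdiff_def)
qed (simp add: fdiff_on_def)

lemma null_affine_preimage:
  fixes N :: "'a::euclidean_space set"
  assumes N: "N \<in> null_sets lborel" and c: "c \<noteq> 0"
  shows "AE x in lborel. a + c *\<^sub>R x \<notin> N"
proof -
  have [measurable]: "N \<in> sets borel" using N by auto
  have "ennreal (\<bar>c\<bar> ^ DIM('a)) * (\<integral>\<^sup>+x. indicator N (a + c *\<^sub>R x) \<partial>lborel) = (\<integral>\<^sup>+x. indicator N x \<partial>lborel)"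
    by (rule nn_integral_lborel_affine[symmetric]) (use c in auto)
  also have "\<dots> = 0" using N by auto
  finally have "(\<integral>\<^sup>+x. indicator N (a + c *\<^sub>R x) \<partial>lborel) = 0" using c by simp
  then have "AE x in lborel. (indicator N (a + c *\<^sub>R x) :: ennreal) = 0"
    by (subst (asm) nn_integral_0_iff_AE) auto
  then show ?thesis by eventually_elim (auto simp: indicator_def split: if_splits)
qed

lemma local_modulus_cong_null:
  fixes \<Omega> :: "'a::euclidean_space set"
  assumes N: "N \<in> null_sets lborel" "q = \<infinity> \<Longrightarrow> N = {}" and fg: "\<And>x. x \<in> \<Omega> - N \<Longrightarrow> f x = g x"
    and \<xi>: "\<xi> \<in> \<Omega> - N" and r: "1 \<le> r"
  shows "local_modulus \<Omega> r f \<xi> \<delta> q = local_modulus \<Omega> r g \<xi> \<delta> q"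
proof -
  have eq: "ldiff \<Omega> r f \<xi> \<eta> = ldiff \<Omega> r g \<xi> \<eta>" if *: "\<And>j. j \<in> {1..r} \<Longrightarrow> \<xi> + (real j / real r) *\<^sub>R (\<eta> - \<xi>) \<notin> N" for \<eta>
  proof -
    have "fdiff_on r ((\<eta> - \<xi>) /\<^sub>R real r) f \<Omega> \<xi> = fdiff_on r ((\<eta> - \<xi>) /\<^sub>R real r) g \<Omega> \<xi>"
    proof (rule fdiff_on_cong)
      fix j assume j: "j \<le> r" "\<xi> + real j *\<^sub>R ((\<eta> - \<xi>) /\<^sub>R real r) \<in> \<Omega>"
      have "\<xi> + real j *\<^sub>R ((\<eta> - \<xi>) /\<^sub>R real r) \<notin> N"
      proof (cases "j = 0")
        case False
        then show ?thesis using *[of j] j by (simp add: divide_inverse)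
      qed (use \<xi> in simp)
      then show "f (\<xi> + real j *\<^sub>R ((\<eta> - \<xi>) /\<^sub>R real r)) = g (\<xi> + real j *\<^sub>R ((\<eta> - \<xi>) /\<^sub>R real r))"
        using j fg by blast
    qed
    then show ?thesis by (simp add: ldiff_def)
  qed
  show ?thesis
  proof (cases "q = \<infinity>")
    case True
    then show ?thesis using N eq unfolding True local_modulus_top by simp
  next
    case False
    have "AE \<eta> in lborel. \<forall>j\<in>{1..r}. \<xi> + (real j / real r) *\<^sub>R (\<eta> - \<xi>) \<notin> N"
    proof (rule AE_finite_allI)
      fix j assume "j \<in> {1..r}"
      then have "real j / real r \<noteq> 0" by auto
      from null_affine_preimage[OF N(1) this, of "\<xi> - (real j / real r) *\<^sub>R \<xi>"]
      show "AE \<eta> in lborel. \<xi> + (real j / real r) *\<^sub>R (\<eta> - \<xi>) \<notin> N" by (simp add: algebra_simps)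
    qed simp
    then have "AE \<eta> in lborel. ldiff \<Omega> r f \<xi> \<eta> = ldiff \<Omega> r g \<xi> \<eta>"
      by eventually_elim (blast intro: eq)
    then have "(\<integral>\<^sup>+\<eta>\<in>rho_ball \<Omega> \<xi> \<delta>. epow (ldiff \<Omega> r f \<xi> \<eta>) (enn2real q) \<partial>lborel)
       = (\<integral>\<^sup>+\<eta>\<in>rho_ball \<Omega> \<xi> \<delta>. epow (ldiff \<Omega> r g \<xi> \<eta>) (enn2real q) \<partial>lborel)"
      by (intro nn_integral_cong_AE) (auto elim: eventually_mono)
    then show ?thesis unfolding local_modulus_fin[OF False] by simp
  qed
qed

lemma Lp_norm_top: "Lp_norm \<infinity> S F = (SUP x\<in>S. F x)"
  by (simp add: Lp_norm_def)

lemma Lp_norm_fin: "p \<noteq> \<infinity> \<Longrightarrow> Lp_norm p S F = epow (\<integral>\<^sup>+x\<in>S. epow (F x) (enn2real p) \<partial>lborel) (1 / enn2real p)"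
  by (simp add: Lp_norm_def nn_integral_completion)

lemma Lp_norm_cong_AE:
  assumes "p = \<infinity> \<Longrightarrow> \<forall>x\<in>S. F x = G x" "p \<noteq> \<infinity> \<Longrightarrow> AE x in lborel. x \<in> S \<longrightarrow> F x = G x"
  shows "Lp_norm p S F = Lp_norm p S G"
proof (cases "p = \<infinity>")
  case True
  show ?thesis unfolding True Lp_norm_top using assms(1)[OF True] by (intro SUP_cong) auto
next
  case False
  have "(\<integral>\<^sup>+x\<in>S. epow (F x) (enn2real p) \<partial>lborel) = (\<integral>\<^sup>+x\<in>S. epow (G x) (enn2real p) \<partial>lborel)"
    using assms(2)[OF False] by (intro nn_integral_cong_AE) (auto elim!: eventually_mono simp: indicator_def)
  then show ?thesis by (simp add: Lp_norm_fin[OF False])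
qed

lemma avg_modulus_cong_null:
  fixes \<Omega> :: "'a::euclidean_space set"
  assumes N: "N \<in> null_sets lborel" "p = \<infinity> \<Longrightarrow> N = {}" and fg: "\<And>x. x \<in> \<Omega> - N \<Longrightarrow> f x = g x"
    and r: "1 \<le> r" and q: "q \<le> p"
  shows "avg_modulus \<Omega> r f \<delta> p q = avg_modulus \<Omega> r g \<delta> p q"
proof -
  have qN: "q = \<infinity> \<Longrightarrow> N = {}" using q N(2) by (simp add: top_unique)
  have eq: "local_modulus \<Omega> r f x \<delta> q = local_modulus \<Omega> r g x \<delta> q" if "x \<in> \<Omega> - N" for x
    using local_modulus_cong_null[OF N(1) qN fg that r] .
  show ?thesis unfolding avg_modulus_def
  proof (rule Lp_norm_cong_AE)
    show "AE x in lborel. x \<in> \<Omega> \<longrightarrow> local_modulus \<Omega> r f x \<delta> q = local_modulus \<Omega> r g x \<delta> q"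
      using AE_not_in[OF N(1)] by eventually_elim (use eq in blast)
  qed (use eq N in blast)
qed

definition dominated :: "'a::euclidean_space set \<Rightarrow> nat \<Rightarrow> ennreal \<Rightarrow> real \<Rightarrow> nat \<Rightarrow> real \<Rightarrow> real \<Rightarrow> ('a \<Rightarrow> real) \<Rightarrow> bool" where
  "dominated \<Omega> r q K N c C f \<longleftrightarrow> 1 \<le> N \<and> 0 < C \<and> (\<forall>\<xi> h t.
      0 < t \<longrightarrow> t \<le> 1 \<longrightarrow> norm h \<le> K * t \<longrightarrow> (\<forall>a\<in>{0..real r}. \<xi> + a *\<^sub>R h \<in> \<Omega>) \<longrightarrow>
      (\<forall>a\<in>{0..real r}. \<bar>sqrt (bdist \<Omega> (\<xi> + a *\<^sub>R h)) - sqrt (bdist \<Omega> \<xi>)\<bar> \<le> K * t) \<longrightarrow>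
      (\<exists>k\<le>r * N. ennreal \<bar>fdiff r h f \<xi>\<bar>
         \<le> ennreal C * local_modulus \<Omega> r f (\<xi> + (real k / real N) *\<^sub>R h) (c * t) q))"

lemma dominatedD:
  assumes "dominated \<Omega> r q K N c C f" "0 < t" "t \<le> 1" "norm h \<le> K * t" "\<And>a. a\<in>{0..real r} \<Longrightarrow> \<xi> + a *\<^sub>R h \<in> \<Omega>"
   "\<And>a. a\<in>{0..real r} \<Longrightarrow> \<bar>sqrt (bdist \<Omega> (\<xi> + a *\<^sub>R h)) - sqrt (bdist \<Omega> \<xi>)\<bar> \<le> K * t"
  shows "\<exists>k\<le>r * N. ennreal \<bar>fdiff r h f \<xi>\<bar> \<le> ennreal C * local_modulus \<Omega> r f (\<xi> + (real k / real N) *\<^sub>R h) (c * t) q"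
  using assms unfolding dominated_def by blast

lemma epow_const_mult:
  assumes "0 < p" "0 \<le> C" shows "epow (ennreal C * x) (1 / p) = ennreal (C powr (1/p)) * epow x (1/p)"
  using assms by (simp add: epow_mult)

lemma DT_dominated:
  fixes \<Omega> :: "'a::euclidean_space set"
  assumes bd: "ball_domain R \<Omega>" and B: "\<And>x. x \<in> \<Omega> \<Longrightarrow> norm x \<le> B / 2" "1 \<le> B"
    and e: "norm e = 1" and r: "1 \<le> r" and h: "0 \<le> h" "h \<le> t" "0 < t" "t \<le> 1"
    and K: "2 * (real r * (B * (1 + B / R)) + (real r)^2 * B^2 / R + real r * B / sqrt (R/2)) + 1 \<le> K" "B \<le> K"
    and dom: "dominated \<Omega> r q K N c C f" and \<xi>: "\<xi> \<in> DT_dom \<Omega> e (r * h)"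
  shows "\<exists>k\<le>r * N. ennreal \<bar>fdiff r ((h * phi0 \<Omega> e \<xi>) *\<^sub>R e) f \<xi>\<bar>
     \<le> ennreal C * local_modulus \<Omega> r f (\<xi> + (real k / real N * h * phi0 \<Omega> e \<xi>) *\<^sub>R e) (c * t) q"
proof -
  have R: "R > 0" using bd_facts(4)[OF bd] .
  have e0: "e \<noteq> 0" using e by auto
  have \<xi>\<Omega>: "\<xi> \<in> \<Omega>" using \<xi> by (simp add: DT_dom_def)
  obtain l1 l2 where ch: "chord \<Omega> e \<xi> l1 l2" using chord_exists[OF bd_facts(1)[OF bd] e0 \<xi>\<Omega>] by blast
  have l: "0 \<le> l1" "0 \<le> l2" "l1 \<le> B" "l2 \<le> B"
    using ch chord_bounded[OF ch bd_facts(2)[OF bd] e, of "B/2"] B by (auto simp: chord_def)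
  have rh: "0 \<le> real r * h" using h by simp
  note d = DT_dom_chord[OF \<xi> ch rh]
  let ?\<phi> = "sqrt (l1 * l2)"
  have \<phi>B: "?\<phi> \<le> B"
  proof -
    have "sqrt (l1 * l2) \<le> sqrt (B * B)" using l B by (intro real_sqrt_le_mono mult_mono) auto
    then show ?thesis using B by simp
  qed
  have sc: "\<xi> + a *\<^sub>R ((h * ?\<phi>) *\<^sub>R e) = \<xi> + (a * h * ?\<phi>) *\<^sub>R e" for a by (simp add: mult.assoc)
  have on: "\<xi> + u *\<^sub>R e \<in> \<Omega>" if "u \<in> {-l1..l2}" for u using ch that unfolding chord_def by blast
  have w: "0 \<le> a * h * ?\<phi>" "a * h * ?\<phi> \<le> r * h * ?\<phi>" if "a \<in> {0..real r}" for a
    using that h d(2) by (auto intro!: mult_right_mono)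
  have "\<exists>k\<le>r * N. ennreal \<bar>fdiff r ((h * ?\<phi>) *\<^sub>R e) f \<xi>\<bar>
      \<le> ennreal C * local_modulus \<Omega> r f (\<xi> + (real k / real N) *\<^sub>R ((h * ?\<phi>) *\<^sub>R e)) (c * t) q"
  proof (rule dominatedD[OF dom h(3,4)])
    have "norm ((h * ?\<phi>) *\<^sub>R e) = h * ?\<phi>" using e h d(2) by simp
    also have "\<dots> \<le> t * B" using h \<phi>B d(2) by (intro mult_mono) auto
    also have "\<dots> \<le> K * t" using K h by (simp add: mult.commute mult_left_mono)
    finally show "norm ((h * ?\<phi>) *\<^sub>R e) \<le> K * t" .
    fix a assume a: "a \<in> {0..real r}"
    show "\<xi> + a *\<^sub>R ((h * ?\<phi>) *\<^sub>R e) \<in> \<Omega>" unfolding sc using w[OF a] d(3) l by (intro on) auto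
    have "\<bar>sqrt (bdist \<Omega> (\<xi> + (a * h * ?\<phi>) *\<^sub>R e)) - sqrt (bdist \<Omega> \<xi>)\<bar>
      \<le> (2 * (real r * (B * (1 + B / R)) + (real r)^2 * B^2 / R + real r * B / sqrt (R/2)) + 1) * h"
      using bdist_along_chord[OF bd B e ch, of "real r" h "a * h * ?\<phi>"] h w[OF a] d(3) by auto
    also have "\<dots> \<le> K * t"
    proof (rule mult_mono[OF K(1) h(2)])
      show "0 \<le> K" using K B by simp
    qed (use h in simp)
    finally show "\<bar>sqrt (bdist \<Omega> (\<xi> + a *\<^sub>R ((h * ?\<phi>) *\<^sub>R e))) - sqrt (bdist \<Omega> \<xi>)\<bar> \<le> K * t" unfolding sc .
  qed
  then show ?thesis unfolding d(1) sc .
qed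

lemma phi0_flip: 
  fixes \<Omega> :: "'a::euclidean_space set"
  assumes "compact \<Omega>" "e \<noteq> 0" shows "phi0 \<Omega> (-e) \<xi> = phi0 \<Omega> e \<xi>"
proof (cases "\<xi> \<in> \<Omega>")
  case True
  obtain l1 l2 where ch: "chord \<Omega> e \<xi> l1 l2" using chord_exists[OF assms True] by blast
  show ?thesis using phi_chord[OF ch] phi_chord[OF chord_flip[OF ch]] by (simp add: phi0_def mult.commute)
qed (simp add: phi0_def)

lemma DT_dir_bound_pos:
  fixes \<Omega> :: "'a::euclidean_space set"
  assumes bd: "ball_domain R \<Omega>" and B: "\<And>x. x \<in> \<Omega> \<Longrightarrow> norm x \<le> B / 2" "1 \<le> B"
    and e: "norm e = 1" and r: "1 \<le> r" and h: "0 \<le> h" "h \<le> t" "0 < t" "t \<le> 1"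
    and K: "2 * (real r * (B * (1 + B / R)) + (real r)^2 * B^2 / R + real r * B / sqrt (R/2)) + 1 \<le> K" "B \<le> K"
    and dom: "dominated \<Omega> r q K N c C g" and g: "g \<in> borel_measurable borel"
    and p: "0 < q" "q \<le> p"
    and Z: "Z \<in> null_sets lborel" "p = \<infinity> \<Longrightarrow> Z = {}" and fg: "\<And>x. x \<in> \<Omega> - Z \<Longrightarrow> f x = g x"
  shows "Lp_norm p \<Omega> (\<lambda>\<xi>. ennreal \<bar>fdiff_on r ((h * phi0 \<Omega> e \<xi>) *\<^sub>R e) f \<Omega> \<xi>\<bar>)
     \<le> ennreal (C * real (6 * (r * N + 1)) powr (1 / enn2real p)) * avg_modulus \<Omega> r g (c * t) p q"
proof -
  let ?v = "\<lambda>\<xi>. (h * phi0 \<Omega> e \<xi>) *\<^sub>R e"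
  let ?X = "DT_dom \<Omega> e (r * h)"
  let ?W = "\<lambda>\<xi>. local_modulus \<Omega> r g \<xi> (c * t) q"
  let ?y = "\<lambda>k \<xi>. \<xi> + (real k / real N * h * phi0 \<Omega> e \<xi>) *\<^sub>R e"
  have cl: "closed \<Omega>" and co: "compact \<Omega>" using bd_facts[OF bd] by auto
  have N: "1 \<le> N" and C: "0 < C" using dom by (auto simp: dominated_def)
  have Xeq: "\<xi> \<in> ?X \<longleftrightarrow> \<xi> \<in> \<Omega> \<and> closed_segment \<xi> (\<xi> + real r *\<^sub>R ?v \<xi>) \<subseteq> \<Omega>" for \<xi>
    by (simp add: DT_dom_def mult.assoc)
  have kr: "0 \<le> real k / real N * h" "real k / real N * h \<le> real r * h" if "k \<le> r * N" for k
  proof -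
    have "real k \<le> real (r * N)" using that by (simp only: of_nat_le_iff)
    then have "real k / real N \<le> r" using N by (simp add: field_simps)
    then show "0 \<le> real k / real N * h" "real k / real N * h \<le> real r * h"
      using h mult_right_mono[of "real k / real N" "real r" h] by simp_all
  qed
  have y\<Omega>: "?y k \<xi> \<in> \<Omega>" if \<xi>: "\<xi> \<in> ?X" and k: "k \<le> r * N" for k \<xi>
  proof -
    have "closed_segment (\<xi> + 0 *\<^sub>R e) (\<xi> + (real r * h * phi0 \<Omega> e \<xi>) *\<^sub>R e) \<subseteq> \<Omega>" using \<xi> by (simp add: DT_dom_def)
    moreover have "e \<noteq> 0" using e by auto
    then have ph: "0 \<le> phi0 \<Omega> e \<xi>" by (rule phi0_nonneg[OF co])
    ultimately have "(\<lambda>u. \<xi> + u *\<^sub>R e) ` {0..real r * h * phi0 \<Omega> e \<xi>} \<subseteq> \<Omega>"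
      using closed_segment_line[of 0 "real r * h * phi0 \<Omega> e \<xi>" \<xi> e] h by simp
    moreover have "real k / real N * h * phi0 \<Omega> e \<xi> \<in> {0..real r * h * phi0 \<Omega> e \<xi>}"
      using mult_right_mono[OF kr(2)[OF k] ph] mult_nonneg_nonneg[OF kr(1)[OF k] ph] by simp
    ultimately show ?thesis by blast
  qed
  have pt: "\<exists>k\<le>r * N. ennreal \<bar>fdiff_on r (?v \<xi>) g \<Omega> \<xi>\<bar> \<le> ennreal C * ?W (?y k \<xi>)" if \<xi>: "\<xi> \<in> ?X" for \<xi>
    using DT_dominated[OF bd B e r h K dom \<xi>] \<xi> by (simp add: fdiff_on_def Xeq)
  have z: "fdiff_on r (?v \<xi>) f' \<Omega> \<xi> = 0" if "\<xi> \<in> \<Omega>" "\<xi> \<notin> ?X" for \<xi> f'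
    using that by (simp add: fdiff_on_def Xeq)
  have "Lp_norm p \<Omega> (\<lambda>\<xi>. ennreal \<bar>fdiff_on r (?v \<xi>) f \<Omega> \<xi>\<bar>) = Lp_norm p \<Omega> (\<lambda>\<xi>. ennreal \<bar>fdiff_on r (?v \<xi>) g \<Omega> \<xi>\<bar>)"
  proof (rule Lp_norm_cong_AE)
    assume "p = \<infinity>"
    then have "Z = {}" by (rule Z)
    have "fdiff_on r (?v \<xi>) f \<Omega> \<xi> = fdiff_on r (?v \<xi>) g \<Omega> \<xi>" for \<xi>
      by (rule fdiff_on_cong) (use fg \<open>Z = {}\<close> in auto)
    then show "\<forall>\<xi>\<in>\<Omega>. ennreal \<bar>fdiff_on r (?v \<xi>) f \<Omega> \<xi>\<bar> = ennreal \<bar>fdiff_on r (?v \<xi>) g \<Omega> \<xi>\<bar>" by simp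
  next
    have [measurable]: "phi0 \<Omega> e \<in> borel_measurable borel" "?X \<in> sets borel" "Z \<in> sets borel"
      using measurable_phi0[OF co e] measurable_DT_dom[OF co e] Z by auto
    have "AE \<xi> in lborel. \<forall>j\<in>{..r}. \<xi> \<in> ?X \<longrightarrow> \<xi> + (real j * h * phi0 \<Omega> e \<xi>) *\<^sub>R e \<notin> Z"
    proof (rule AE_finite_allI)
      fix j assume j: "j \<in> {..r}"
      have "(\<integral>\<^sup>+\<xi>\<in>?X. indicator Z (\<xi> + (real j * h * phi0 \<Omega> e \<xi>) *\<^sub>R e) \<partial>lborel) \<le> 6 * (\<integral>\<^sup>+\<xi>. indicator Z \<xi> \<partial>lborel)"
        using j h by (intro integral_DT[OF co e]) (auto intro: mult_right_mono)
      also have "\<dots> = 0" using Z(1) by auto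
      finally have "(\<integral>\<^sup>+\<xi>\<in>?X. indicator Z (\<xi> + (real j * h * phi0 \<Omega> e \<xi>) *\<^sub>R e) \<partial>lborel) = 0" by simp
      then have "AE \<xi> in lborel. indicator Z (\<xi> + (real j * h * phi0 \<Omega> e \<xi>) *\<^sub>R e) * indicator ?X \<xi> = (0::ennreal)"
        by (subst (asm) nn_integral_0_iff_AE) measurable
      then show "AE \<xi> in lborel. \<xi> \<in> ?X \<longrightarrow> \<xi> + (real j * h * phi0 \<Omega> e \<xi>) *\<^sub>R e \<notin> Z"
        by eventually_elim (auto simp: indicator_def split: if_splits)
    qed simp
    then show "AE \<xi> in lborel. \<xi> \<in> \<Omega> \<longrightarrow> ennreal \<bar>fdiff_on r (?v \<xi>) f \<Omega> \<xi>\<bar> = ennreal \<bar>fdiff_on r (?v \<xi>) g \<Omega> \<xi>\<bar>"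
    proof eventually_elim
      case (elim \<xi>)
      show ?case
      proof
        assume \<xi>: "\<xi> \<in> \<Omega>"
        show "ennreal \<bar>fdiff_on r (?v \<xi>) f \<Omega> \<xi>\<bar> = ennreal \<bar>fdiff_on r (?v \<xi>) g \<Omega> \<xi>\<bar>"
        proof (cases "\<xi> \<in> ?X")
          case True
          have "fdiff_on r (?v \<xi>) f \<Omega> \<xi> = fdiff_on r (?v \<xi>) g \<Omega> \<xi>"
          proof (rule fdiff_on_cong)
            fix j assume j: "j \<le> r" "\<xi> + real j *\<^sub>R ?v \<xi> \<in> \<Omega>"
            have "\<xi> + (real j * h * phi0 \<Omega> e \<xi>) *\<^sub>R e \<notin> Z" using elim j True by blast
            then show "f (\<xi> + real j *\<^sub>R ?v \<xi>) = g (\<xi> + real j *\<^sub>R ?v \<xi>)" using j(2) fg by (simp add: mult.assoc)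
          qed
          then show ?thesis by simp
        qed (use z \<xi> in simp)
      qed
    qed
  qed
  also have "\<dots> \<le> ennreal (C * real (6 * (r * N + 1)) powr (1 / enn2real p)) * avg_modulus \<Omega> r g (c * t) p q"
  proof (cases "p = \<infinity>")
    case True
    have *: "ennreal \<bar>fdiff_on r (?v \<xi>) g \<Omega> \<xi>\<bar> \<le> ennreal C * (SUP x\<in>\<Omega>. ?W x)" if \<xi>: "\<xi> \<in> \<Omega>" for \<xi>
    proof (cases "\<xi> \<in> ?X")
      case True
      obtain k where k: "k \<le> r * N" "ennreal \<bar>fdiff_on r (?v \<xi>) g \<Omega> \<xi>\<bar> \<le> ennreal C * ?W (?y k \<xi>)" using pt[OF True] by blast
      have "?W (?y k \<xi>) \<le> (SUP x\<in>\<Omega>. ?W x)" using y\<Omega>[OF True k(1)] by (rule SUP_upper)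
      then show ?thesis by (rule order_trans[OF k(2) mult_left_mono]) simp
    qed (simp add: z \<xi>)
    have "real (6 * (r * N + 1)) \<noteq> 0" by (simp only: of_nat_eq_0_iff) simp
    then have c1: "C * real (6 * (r * N + 1)) powr (1 / enn2real p) = C" using True by simp
    show ?thesis unfolding c1 unfolding True Lp_norm_top avg_modulus_def
      by (rule SUP_least) (rule *)
  next
    case False
    let ?p = "enn2real p"
    have "p > 0" using p by (rule less_le_trans)
    then have p0: "?p > 0" using False by (simp add: enn2real_positive_iff less_top)
    have qf: "q \<noteq> \<infinity>" using p False by (auto simp: top_unique)
    have W [measurable]: "?W \<in> borel_measurable borel" by (rule measurable_local_modulus[OF cl qf g])
    have [measurable]: "phi0 \<Omega> e \<in> borel_measurable borel" "?X \<in> sets borel" "\<Omega> \<in> sets borel"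
      using measurable_phi0[OF co e] measurable_DT_dom[OF co e] cl by auto
    let ?G = "\<lambda>\<xi>. epow (?W \<xi>) ?p * indicator \<Omega> \<xi>"
    have "(\<integral>\<^sup>+\<xi>\<in>\<Omega>. epow (ennreal \<bar>fdiff_on r (?v \<xi>) g \<Omega> \<xi>\<bar>) ?p \<partial>lborel)
       \<le> (\<integral>\<^sup>+\<xi>. ennreal (C powr ?p) * (\<Sum>k\<le>r*N. ?G (?y k \<xi>) * indicator ?X \<xi>) \<partial>lborel)"
    proof (rule nn_integral_mono)
      fix \<xi>
      show "epow (ennreal \<bar>fdiff_on r (?v \<xi>) g \<Omega> \<xi>\<bar>) ?p * indicator \<Omega> \<xi>
        \<le> ennreal (C powr ?p) * (\<Sum>k\<le>r*N. ?G (?y k \<xi>) * indicator ?X \<xi>)"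
      proof (cases "\<xi> \<in> ?X")
        case True
        obtain k where k: "k \<le> r * N" "ennreal \<bar>fdiff_on r (?v \<xi>) g \<Omega> \<xi>\<bar> \<le> ennreal C * ?W (?y k \<xi>)" using pt[OF True] by blast
        have "epow (ennreal \<bar>fdiff_on r (?v \<xi>) g \<Omega> \<xi>\<bar>) ?p * indicator \<Omega> \<xi> \<le> epow (ennreal C * ?W (?y k \<xi>)) ?p"
          using epow_mono[OF _ k(2), of ?p] p0 by (simp add: indicator_def)
        also have "\<dots> = ennreal (C powr ?p) * (?G (?y k \<xi>) * indicator ?X \<xi>)"
          using y\<Omega>[OF True k(1)] True C p0 by (simp add: epow_mult)
        also have "\<dots> \<le> ennreal (C powr ?p) * (\<Sum>k\<le>r*N. ?G (?y k \<xi>) * indicator ?X \<xi>)"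
          using k(1) by (intro mult_left_mono member_le_sum) auto
        finally show ?thesis .
      next
        case False
        then show ?thesis using z[of \<xi> g] p0 by (cases "\<xi> \<in> \<Omega>") auto
      qed
    qed
    also have "\<dots> = ennreal (C powr ?p) * (\<Sum>k\<le>r*N. \<integral>\<^sup>+\<xi>\<in>?X. ?G (?y k \<xi>) \<partial>lborel)"
    proof -
      have m: "(\<lambda>\<xi>. ?G (?y k \<xi>) * indicator ?X \<xi>) \<in> borel_measurable lborel" for k by measurable
      show ?thesis unfolding nn_integral_sum[OF m, symmetric]
        by (rule nn_integral_cmult) (intro borel_measurable_sum m)
    qed
    also have "\<dots> \<le> ennreal (C powr ?p) * (\<Sum>k\<le>r*N. 6 * (\<integral>\<^sup>+\<xi>\<in>\<Omega>. epow (?W \<xi>) ?p \<partial>lborel))"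
    proof (intro mult_left_mono sum_mono)
      fix k assume "k \<in> {..r*N}"
      then have "k \<le> r * N" by simp
      show "(\<integral>\<^sup>+\<xi>\<in>?X. ?G (?y k \<xi>) \<partial>lborel) \<le> 6 * (\<integral>\<^sup>+\<xi>\<in>\<Omega>. epow (?W \<xi>) ?p \<partial>lborel)"
        using kr[OF \<open>k \<le> r * N\<close>] by (intro integral_DT[OF co e, of _ _ ?G]) auto
    qed simp
    also have "\<dots> = ennreal (C powr ?p * real (6 * (r * N + 1))) * (\<integral>\<^sup>+\<xi>\<in>\<Omega>. epow (?W \<xi>) ?p \<partial>lborel)"
    proof -
      have "(\<Sum>k\<le>r*N. 6 * (\<integral>\<^sup>+\<xi>\<in>\<Omega>. epow (?W \<xi>) ?p \<partial>lborel)) = of_nat (6 * (r * N + 1)) * (\<integral>\<^sup>+\<xi>\<in>\<Omega>. epow (?W \<xi>) ?p \<partial>lborel)"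
        by (simp add: algebra_simps)
      moreover have "ennreal (C powr ?p * real (6 * (r * N + 1))) = ennreal (C powr ?p) * of_nat (6 * (r * N + 1))"
        by (subst ennreal_of_nat_eq_real_of_nat, subst ennreal_mult[symmetric]) auto
      ultimately show ?thesis by (simp add: mult.assoc)
    qed
    finally have "Lp_norm p \<Omega> (\<lambda>\<xi>. ennreal \<bar>fdiff_on r (?v \<xi>) g \<Omega> \<xi>\<bar>)
       \<le> epow (ennreal (C powr ?p * real (6 * (r * N + 1))) * (\<integral>\<^sup>+\<xi>\<in>\<Omega>. epow (?W \<xi>) ?p \<partial>lborel)) (1 / ?p)"
      unfolding Lp_norm_fin[OF False] using p0 by (intro epow_mono) auto
    also have "\<dots> = ennreal ((C powr ?p * real (6 * (r * N + 1))) powr (1/?p)) * avg_modulus \<Omega> r g (c * t) p q"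
      unfolding avg_modulus_def Lp_norm_fin[OF False] using p0 by (intro epow_const_mult) auto
    also have "(C powr ?p * real (6 * (r * N + 1))) powr (1/?p) = C * real (6 * (r * N + 1)) powr (1/?p)"
      using p0 C by (simp add: powr_mult powr_powr)
    finally show ?thesis .
  qed
  finally show ?thesis .
qed

lemma DT_dir_bound:
  fixes \<Omega> :: "'a::euclidean_space set"
  assumes bd: "ball_domain R \<Omega>" and B: "\<And>x. x \<in> \<Omega> \<Longrightarrow> norm x \<le> B / 2" "1 \<le> B"
    and e: "norm e = 1" and r: "1 \<le> r" and t: "0 < t" "t \<le> 1"
    and K: "2 * (real r * (B * (1 + B / R)) + (real r)^2 * B^2 / R + real r * B / sqrt (R/2)) + 1 \<le> K" "B \<le> K"
    and dom: "dominated \<Omega> r q K N c C g" and g: "g \<in> borel_measurable borel"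
    and p: "0 < q" "q \<le> p"
    and Z: "Z \<in> null_sets lborel" "p = \<infinity> \<Longrightarrow> Z = {}" and fg: "\<And>x. x \<in> \<Omega> - Z \<Longrightarrow> f x = g x"
  shows "DT_modulus_dir \<Omega> r f t e p
     \<le> ennreal (C * real (6 * (r * N + 1)) powr (1 / enn2real p)) * avg_modulus \<Omega> r f (c * t) p q"
proof -
  have av: "avg_modulus \<Omega> r f (c * t) p q = avg_modulus \<Omega> r g (c * t) p q"
    by (rule avg_modulus_cong_null[OF Z fg r p(2)])
  show ?thesis unfolding DT_modulus_dir_def av
  proof (rule SUP_least)
    fix h :: real assume h: "h \<in> {h. \<bar>h\<bar> \<le> min t 1}"
    define e' where "e' = (if 0 \<le> h then e else - e)"
    have e': "norm e' = 1" using e by (simp add: e'_def)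
    have e0: "e \<noteq> 0" using e by auto
    have eq: "(h * phi \<Omega> e \<xi>) *\<^sub>R e = (\<bar>h\<bar> * phi0 \<Omega> e' \<xi>) *\<^sub>R e'" if "\<xi> \<in> \<Omega>" for \<xi>
      using that phi0_flip[OF bd_facts(1)[OF bd] e0, of \<xi>] by (auto simp: e'_def phi0_def)
    have "Lp_norm p \<Omega> (\<lambda>\<xi>. ennreal \<bar>fdiff_on r ((h * phi \<Omega> e \<xi>) *\<^sub>R e) f \<Omega> \<xi>\<bar>)
       = Lp_norm p \<Omega> (\<lambda>\<xi>. ennreal \<bar>fdiff_on r ((\<bar>h\<bar> * phi0 \<Omega> e' \<xi>) *\<^sub>R e') f \<Omega> \<xi>\<bar>)"
      by (rule Lp_norm_cong_AE) (auto simp: eq)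
    also have "\<dots> \<le> ennreal (C * real (6 * (r * N + 1)) powr (1 / enn2real p)) * avg_modulus \<Omega> r g (c * t) p q"
    proof -
      have h': "0 \<le> \<bar>h\<bar>" "\<bar>h\<bar> \<le> t" using h by auto
      show ?thesis by (rule DT_dir_bound_pos[OF bd B e' r h' t K dom g p Z fg])
    qed
    finally show "Lp_norm p \<Omega> (\<lambda>\<xi>. ennreal \<bar>fdiff_on r ((h * phi \<Omega> e \<xi>) *\<^sub>R e) f \<Omega> \<xi>\<bar>)
       \<le> ennreal (C * real (6 * (r * N + 1)) powr (1 / enn2real p)) * avg_modulus \<Omega> r g (c * t) p q" .
  qed
qed

section \<open>The tangential part\<close>

lemma coord_swap_None [simp]: "coord_swap None = id"
  by (auto simp: fun_eq_iff)

lemma sd_standard_sets: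
  assumes "sd_standard H"
  shows "sd_set H = {(x, y). x \<in> cube (sd_base H) \<and> sd_graph H x - sd_param H * sd_base H < y \<and> y \<le> sd_graph H x}"
    "sd_bdry H = {(x, y). x \<in> cube (sd_base H) \<and> y = sd_graph H x}"
  using assms by (auto simp: sd_standard_def sd_set_def sd_bdry_def sd_transport_def sd_orient_def zero_prod_def image_def)

lemma has_derivative_partial:
  fixes g :: "real ^ 'd::finite \<Rightarrow> real"
  assumes "g differentiable_on UNIV"
  shows "(g has_derivative (\<lambda>h. \<Sum>j\<in>UNIV. h $ j * partial j g u)) (at u)"
proof -
  have d: "(g has_derivative frechet_derivative g (at u)) (at u)"
    using assms frechet_derivative_works by (auto simp: differentiable_on_def)
  then have lin: "linear (frechet_derivative g (at u))" by (rule has_derivative_linear)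
  have "frechet_derivative g (at u) h = (\<Sum>j\<in>UNIV. h $ j * partial j g u)" for h
  proof -
    have "h = (\<Sum>j\<in>UNIV. h $ j *\<^sub>R axis j 1)"
      using basis_expansion[of h] by (simp add: scalar_mult_eq_scaleR)
    then have "frechet_derivative g (at u) h = frechet_derivative g (at u) (\<Sum>j\<in>UNIV. h $ j *\<^sub>R axis j 1)" by simp
    also have "\<dots> = (\<Sum>j\<in>UNIV. h $ j * partial j g u)"
      by (simp add: linear_sum[OF lin] linear_scale[OF lin] partial_def)
    finally show ?thesis .
  qed
  then have "frechet_derivative g (at u) = (\<lambda>h. \<Sum>j\<in>UNIV. h $ j * partial j g u)" by auto
  with d show ?thesis by metis
qed

lemma C2_fun_derivative:
  fixes g :: "real ^ 'd::finite \<Rightarrow> real"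
  assumes "C2_fun g"
  shows "(g has_derivative (\<lambda>h. \<Sum>j\<in>UNIV. h $ j * partial j g u)) (at u)"
  using assms by (intro has_derivative_partial) (simp add: C2_fun_def)

lemma lipschitz_if_partials_bounded:
  fixes g :: "real ^ 'd::finite \<Rightarrow> real"
  assumes g: "g differentiable_on UNIV" and S: "convex S" and M: "\<And>j u. u \<in> S \<Longrightarrow> \<bar>partial j g u\<bar> \<le> B j"
    and uv: "u \<in> S" "v \<in> S"
  shows "\<bar>g u - g v\<bar> \<le> (\<Sum>j\<in>UNIV. \<bar>B j\<bar>) * norm (u - v)"
proof -
  have "norm (g u - g v) \<le> (\<Sum>j\<in>UNIV. \<bar>B j\<bar>) * norm (u - v)"
  proof (rule differentiable_bound[OF S _ _ uv])
    fix x assume x: "x \<in> S"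
    show "(g has_derivative (\<lambda>h. \<Sum>j\<in>UNIV. h $ j * partial j g x)) (at x within S)"
      using has_derivative_partial[OF g] by (rule has_derivative_at_withinI)
    show "onorm (\<lambda>h. \<Sum>j\<in>UNIV. h $ j * partial j g x) \<le> (\<Sum>j\<in>UNIV. \<bar>B j\<bar>)"
    proof (rule onorm_le)
      fix h :: "real ^ 'd"
      have "norm (\<Sum>j\<in>UNIV. h $ j * partial j g x) \<le> (\<Sum>j\<in>UNIV. norm (h $ j * partial j g x))" by (rule norm_sum)
      also have "\<dots> \<le> (\<Sum>j\<in>UNIV. norm h * \<bar>B j\<bar>)"
        using M[OF x] component_le_norm_cart[of h]
        by (intro sum_mono) (auto simp: abs_mult intro!: mult_mono intro: order_trans[OF _ abs_ge_self])
      also have "\<dots> = (\<Sum>j\<in>UNIV. \<bar>B j\<bar>) * norm h" by (simp add: sum_distrib_left[symmetric])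
      finally show "norm (\<Sum>j\<in>UNIV. h $ j * partial j g x) \<le> (\<Sum>j\<in>UNIV. \<bar>B j\<bar>) * norm h" .
    qed
  qed
  then show ?thesis by simp
qed

lemma C2_fun_continuous:
  assumes "C2_fun g" shows "continuous_on S g" "continuous_on S (partial j g)" "continuous_on S (partial k (partial j g))"
  using assms unfolding C2_fun_def
  by (auto intro: continuous_on_subset[OF differentiable_imp_continuous_on] continuous_on_subset)

lemma C2_fun_lipschitz:
  fixes g :: "real ^ 'd::finite \<Rightarrow> real"
  assumes g: "C2_fun g" and S: "compact S" "convex S"
  shows "\<exists>M>0. (\<forall>j. \<forall>u\<in>S. \<bar>partial j g u\<bar> \<le> M) \<and> (\<forall>u\<in>S. \<forall>v\<in>S. \<bar>g u - g v\<bar> \<le> M * norm (u - v))"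
proof -
  have "\<exists>B. \<forall>u\<in>S. \<bar>partial j g u\<bar> \<le> B" for j
  proof -
    have "compact (partial j g ` S)" using C2_fun_continuous(2)[OF g] S(1) by (rule compact_continuous_image)
    then have "bounded (partial j g ` S)" by (rule compact_imp_bounded)
    then show ?thesis by (auto simp: bounded_iff)
  qed
  then obtain B where B: "\<And>j u. u \<in> S \<Longrightarrow> \<bar>partial j g u\<bar> \<le> B j" by metis
  define M where "M = 1 + (\<Sum>j\<in>UNIV. \<bar>B j\<bar>)"
  have M: "M > 0" by (auto simp: M_def intro: add_pos_nonneg sum_nonneg)
  have BM: "\<bar>B j\<bar> \<le> M" for j
  proof -
    have "\<bar>B j\<bar> \<le> (\<Sum>j\<in>UNIV. \<bar>B j\<bar>)" by (rule member_le_sum) auto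
    then show ?thesis by (simp add: M_def)
  qed
  have "\<bar>g u - g v\<bar> \<le> M * norm (u - v)" if uv: "u \<in> S" "v \<in> S" for u v
  proof -
    have "g differentiable_on UNIV" using g by (simp add: C2_fun_def)
    from lipschitz_if_partials_bounded[OF this S(2) B uv]
    have "\<bar>g u - g v\<bar> \<le> (\<Sum>j\<in>UNIV. \<bar>B j\<bar>) * norm (u - v)" .
    also have "\<dots> \<le> M * norm (u - v)" by (intro mult_right_mono) (auto simp: M_def)
    finally show ?thesis .
  qed
  moreover have "\<bar>partial j g u\<bar> \<le> M" if "u \<in> S" for j u
    using B[OF that, of j] BM[of j] by linarith
  ultimately show ?thesis using M by auto
qed

lemma tangent_orthogonal:
  fixes \<Omega> :: "'d::finite pt set"
  assumes R: "0 < R" and g: "C2_fun g" and U: "open U" "u \<in> U"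
    and graph: "\<And>v. v \<in> U \<Longrightarrow> (v, g v) \<in> \<Omega>" and n: "touching_normal R \<Omega> (u, g u) n"
  shows "n \<bullet> tangent_vec g j u = 0"
proof -
  define w where "w s = (s *\<^sub>R axis j (1::real), g (u + s *\<^sub>R axis j 1) - g u)" for s :: real
  define F where "F s = (norm (w s))^2 - 2 * R * (n \<bullet> w s)" for s
  have w0: "w 0 = 0" by (simp add: w_def zero_prod_def)
  have tv: "tangent_vec g j u = (axis j 1, partial j g u)"
    by (simp add: tangent_vec_def)
  have dg: "((\<lambda>s. g (u + s *\<^sub>R axis j 1)) has_derivative (\<lambda>s. s * partial j g u)) (at 0)"
  proof -
    have "((\<lambda>s. u + s *\<^sub>R axis j 1) has_derivative (\<lambda>s. s *\<^sub>R axis j 1)) (at (0::real))"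
      by (auto intro!: derivative_eq_intros)
    moreover have "(g has_derivative (\<lambda>h. \<Sum>i\<in>UNIV. h $ i * partial i g u)) (at (u + 0 *\<^sub>R axis j 1))"
      using C2_fun_derivative[OF g] by simp
    ultimately have "((\<lambda>s. g (u + s *\<^sub>R axis j 1)) has_derivative (\<lambda>s. \<Sum>i\<in>UNIV. (s *\<^sub>R axis j 1) $ i * partial i g u)) (at 0)"
      by (rule has_derivative_compose)
    moreover have "(\<lambda>s. \<Sum>i\<in>UNIV. (s *\<^sub>R axis j 1) $ i * partial i g u) = (\<lambda>s. s * partial j g u)"
    proof
      fix s :: real
      have "(s *\<^sub>R axis j 1) $ i * partial i g u = (if i = j then s * partial j g u else 0)" for i
        by (auto simp: axis_def)
      then show "(\<Sum>i\<in>UNIV. (s *\<^sub>R axis j 1) $ i * partial i g u) = s * partial j g u" by simp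
    qed
    ultimately show ?thesis by simp
  qed
  have dw: "(w has_derivative (\<lambda>s. s *\<^sub>R tangent_vec g j u)) (at 0)"
    unfolding w_def tv by (auto intro!: derivative_eq_intros dg simp: fun_eq_iff)
  have "((\<lambda>s. w s \<bullet> w s - 2 * R * (n \<bullet> w s)) has_derivative (\<lambda>s. - (2 * R * (n \<bullet> tangent_vec g j u)) * s)) (at 0)"
    using dw by (auto intro!: derivative_eq_intros simp: w0 fun_eq_iff)
  then have D: "DERIV F 0 :> - (2 * R * (n \<bullet> tangent_vec g j u))"
    unfolding F_def[abs_def] power2_norm_eq_inner
    by (rule has_derivative_imp_has_field_derivative) simp
  obtain d where d: "d > 0" "ball u d \<subseteq> U" using U openE by blast
  have "- (2 * R * (n \<bullet> tangent_vec g j u)) = 0"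
  proof (rule DERIV_local_min[OF D d(1)], intro allI impI)
    fix s :: real assume s: "\<bar>0 - s\<bar> < d"
    have nn: "n \<bullet> n = 1" using n by (simp add: touching_normal_def norm_eq_1)
    have "u + s *\<^sub>R axis j 1 \<in> ball u d" using s by (simp add: dist_norm)
    then have "(u, g u) + w s \<in> \<Omega>" using graph d by (auto simp: w_def)
    then have "(u, g u) + w s \<notin> ball ((u, g u) + R *\<^sub>R n) R" using n unfolding touching_normal_def by blast
    then have "R \<le> norm (((u, g u) + R *\<^sub>R n) - ((u, g u) + w s))" unfolding mem_ball dist_norm by linarith
    moreover have "((u, g u) + R *\<^sub>R n) - ((u, g u) + w s) = R *\<^sub>R n - w s" by (rule add_diff_cancel_left)
    ultimately have "R \<le> norm (R *\<^sub>R n - w s)" by simp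
    then have "R^2 \<le> (norm (R *\<^sub>R n - w s))^2" using R by (intro power_mono) auto
    also have "\<dots> = R^2 - 2 * R * (n \<bullet> w s) + (norm (w s))^2"
      unfolding power2_norm_eq_inner
      by (simp add: inner_diff inner_commute nn power2_eq_square algebra_simps)
    finally show "F 0 \<le> F s" by (simp add: F_def w0)
  qed
  then show ?thesis using R by simp
qed

lemma tang_condition:
  fixes \<Omega> :: "'d::finite pt set" and H :: "'d special_data"
  assumes bd: "ball_domain R \<Omega>" and H: "sd_standard H" and fr: "sd_bdry H \<subseteq> frontier \<Omega>"
    and sub: "sd_set H \<subseteq> \<Omega>" and \<delta>: "0 < \<delta>" and M0: "0 \<le> M0"
    and near: "\<And>\<xi>. \<xi> \<in> sd_set H \<Longrightarrow> bdist \<Omega> \<xi> < \<delta> \<Longrightarrow> \<exists>z\<in>sd_bdry H. dist \<xi> z \<le> M0 * bdist \<Omega> \<xi>"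
  shows "\<exists>K. \<forall>\<xi>\<in>sd_set H. \<forall>u\<in>cube (sd_base H). \<forall>t s j \<rho>. 0 < s \<longrightarrow> s \<le> t \<longrightarrow> t \<le> 1 \<longrightarrow> norm (u - fst \<xi>) \<le> t * sd_base H \<longrightarrow>
     norm (s *\<^sub>R tangent_vec (sd_graph H) j u) \<le> K * t \<and>
     (\<forall>a\<in>{0..\<rho>}. \<rho> \<le> real r \<longrightarrow> \<xi> + a *\<^sub>R (s *\<^sub>R tangent_vec (sd_graph H) j u) \<in> \<Omega> \<longrightarrow>
       \<bar>sqrt (bdist \<Omega> (\<xi> + a *\<^sub>R (s *\<^sub>R tangent_vec (sd_graph H) j u))) - sqrt (bdist \<Omega> \<xi>)\<bar> \<le> K * t)"
proof -
  let ?g = "sd_graph H" and ?b = "sd_base H"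
  have R: "R > 0" using bd_facts(4)[OF bd] .
  have g: "C2_fun ?g" and b: "?b > 0" using H by (auto simp: sd_standard_def sd_ok_def)
  have cc: "cube ?b \<subseteq> ccube ?b" unfolding cube_def ccube_def by (rule box_subset_cbox)
  have "compact (ccube ?b :: (real ^ 'd) set)" "convex (ccube ?b :: (real ^ 'd) set)" by (simp_all add: ccube_def)
  from C2_fun_lipschitz[OF g this] obtain M where M: "M > 0" "\<And>j u. u \<in> ccube ?b \<Longrightarrow> \<bar>partial j ?g u\<bar> \<le> M"
    "\<And>u v. u \<in> ccube ?b \<Longrightarrow> v \<in> ccube ?b \<Longrightarrow> \<bar>?g u - ?g v\<bar> \<le> M * norm (u - v)" by blast
  let ?\<tau> = "tangent_vec ?g"
  have \<tau>: "norm (?\<tau> j u) \<le> 1 + M" if "u \<in> cube ?b" for j u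
  proof -
    have "norm (?\<tau> j u) \<le> norm (axis j (1::real), 0::real) + norm (partial j ?g u *\<^sub>R ((0::real^'d), 1::real))"
      unfolding tangent_vec_def by (simp only: basis_vec.simps norm_triangle_ineq)
    also have "\<dots> \<le> 1 + M" using M(2)[of u j] that cc by (auto simp: norm_Pair1 norm_Pair2 simp del: scaleR_Pair)
    finally show ?thesis .
  qed
  define \<delta>' where "\<delta>' = min \<delta> (R/2)"
  have \<delta>': "\<delta>' > 0" "\<delta>' \<le> \<delta>" "\<delta>' \<le> R/2" using \<delta> R by (auto simp: \<delta>'_def)
  define Q where "Q = (1 + M0 + (1 + M) * (M0 + ?b)) / R"
  have Q: "Q \<ge> 0" using M M0 b R by (simp add: Q_def)
  define C where "C = r * (1 + M) / sqrt \<delta>' + r * (Q * (1 + M)) * (sqrt (R/2) + 1) + r^2 * (1 + M)^2 / R"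
  have C: "C \<ge> 0" using M Q R \<delta>' by (auto simp: C_def intro!: add_nonneg_nonneg)
  define K where "K = max (1 + M) (2 * C + 1)"
  show ?thesis
  proof (intro exI[of _ K] ballI allI impI conjI)
    fix \<xi> u t s j \<rho>
    assume \<xi>: "\<xi> \<in> sd_set H" and u: "u \<in> cube ?b" and s: "(0::real) < s" "s \<le> t" "t \<le> 1"
      and ut: "norm (u - fst \<xi>) \<le> t * ?b"
    have "norm (s *\<^sub>R ?\<tau> j u) \<le> t * (1 + M)" using s \<tau>[OF u, of j] M by (auto intro!: mult_mono)
    also have "\<dots> \<le> K * t" using s by (simp add: K_def mult.commute mult_left_mono)
    finally show "norm (s *\<^sub>R ?\<tau> j u) \<le> K * t" .
    fix a assume a: "a \<in> {0..\<rho>}" "\<rho> \<le> real r" and in\<Omega>: "\<xi> + a *\<^sub>R (s *\<^sub>R ?\<tau> j u) \<in> \<Omega>"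
    let ?w = "a *\<^sub>R (s *\<^sub>R ?\<tau> j u)" and ?D = "bdist \<Omega> \<xi>"
    have D0: "?D \<ge> 0" by (rule infdist_nonneg)
    have w: "norm ?w \<le> r * t * (1 + M)"
    proof -
      have "norm ?w = a * s * norm (?\<tau> j u)" using a s by simp
      also have "\<dots> \<le> (r * t) * (1 + M)" using a s \<tau>[OF u, of j] M by (intro mult_mono) auto
      finally show ?thesis by simp
    qed
    have "\<bar>bdist \<Omega> (\<xi> + ?w) - ?D\<bar> \<le> C * t * (sqrt ?D + t)"
    proof (cases "?D < \<delta>'")
      case False
      have "\<bar>bdist \<Omega> (\<xi> + ?w) - ?D\<bar> \<le> norm ?w" using bdist_lipschitz[OF bd, of "\<xi> + ?w" \<xi>] by simp
      also have "\<dots> \<le> (r * (1 + M) / sqrt \<delta>') * t * sqrt \<delta>'" using w \<delta>' by (simp add: mult_ac)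
      also have "\<dots> \<le> C * t * (sqrt ?D + t)"
      proof (intro mult_mono)
        show "r * (1 + M) / sqrt \<delta>' \<le> C" unfolding C_def using M Q R by simp
        show "sqrt \<delta>' \<le> sqrt ?D + t" using False s by (intro add_increasing2 real_sqrt_le_mono) auto
      qed (use s C \<delta>' in auto)
      finally show ?thesis .
    next
      case True
      then have DR: "?D \<le> R/2" using \<delta>' by simp
      obtain n where n: "foot_normal R \<Omega> \<xi> n" using foot_normal_exists[OF bd] \<xi> sub by blast
      let ?z' = "(u, ?g u)"
      have z': "?z' \<in> sd_bdry H" using u by (simp add: sd_standard_sets[OF H])
      obtain n' where n': "touching_normal R \<Omega> ?z' n'" using z' fr bd unfolding ball_domain_def by blast
      have orth: "n' \<bullet> ?\<tau> j u = 0"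
      proof (rule tangent_orthogonal[OF R g _ u _ n'])
        show "open (cube ?b :: (real^'d) set)" unfolding cube_def by (rule open_box)
        show "(v, ?g v) \<in> \<Omega>" if "v \<in> cube ?b" for v
          using that fr bd_facts(6)[OF bd] by (auto simp: sd_standard_sets[OF H])
      qed
      obtain p where p: "p \<in> sd_bdry H" "dist \<xi> p \<le> M0 * ?D" using near[OF \<xi>] True \<delta>' by auto
      obtain x2 where x2: "p = (x2, ?g x2)" "x2 \<in> cube ?b" using p(1) by (auto simp: sd_standard_sets[OF H])
      have "norm (x2 - fst \<xi>) \<le> M0 * ?D"
      proof -
        have "norm (fst (p - \<xi>)) \<le> norm (p - \<xi>)" by (metis norm_fst_le prod.collapse)
        then show ?thesis using p(2) x2 by (simp add: dist_norm norm_minus_commute)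
      qed
      then have xu: "norm (x2 - u) \<le> M0 * ?D + t * ?b"
        using ut norm_triangle_ineq4[of "x2 - fst \<xi>" "u - fst \<xi>"] by simp
      have "norm (p - ?z') \<le> norm (x2 - u) + \<bar>?g x2 - ?g u\<bar>"
        using norm_Pair_le[of "x2 - u" "?g x2 - ?g u"] x2 by simp
      also have "\<dots> \<le> (1 + M) * norm (x2 - u)" using M(3)[of x2 u] x2 u cc by (auto simp: algebra_simps)
      also have "\<dots> \<le> (1 + M) * (M0 * ?D + t * ?b)" using xu M by (intro mult_left_mono) auto
      finally have pz: "norm (p - ?z') \<le> (1 + M) * (M0 * ?D + t * ?b)" .
      have "norm ((\<xi> + ?D *\<^sub>R n) - ?z') \<le> norm (\<xi> - p) + norm (p - ?z') + norm (?D *\<^sub>R n)"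
      proof -
        have "(\<xi> + ?D *\<^sub>R n) - ?z' = (\<xi> - p) + (p - ?z') + ?D *\<^sub>R n" by simp
        then show ?thesis by (metis norm_triangle_ineq norm_triangle_mono order_refl)
      qed
      also have "\<dots> \<le> M0 * ?D + (1 + M) * (M0 * ?D + t * ?b) + ?D"
        using p(2) pz foot_normal_unit[OF bd n] D0 by (intro add_mono) (auto simp: dist_norm)
      also have "\<dots> \<le> (1 + M0 + (1 + M) * (M0 + ?b)) * (?D + t)"
      proof -
        have "0 \<le> t + M0 * t + (1 + M) * M0 * t + (1 + M) * ?b * ?D" using M M0 b D0 s by simp
        then show ?thesis by (simp add: algebra_simps)
      qed
      finally have "norm ((\<xi> + ?D *\<^sub>R n) - ?z') / R \<le> Q * (?D + t)"
        using R by (simp add: Q_def divide_right_mono)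
      then have nn: "norm (n - n') \<le> Q * (?D + t)"
        using touching_normal_close[OF bd n[unfolded foot_normal_def] n'] by linarith
      have "\<bar>n \<bullet> ?\<tau> j u\<bar> = \<bar>(n - n') \<bullet> ?\<tau> j u\<bar>" using orth by (simp add: inner_diff_left)
      also have "\<dots> \<le> norm (n - n') * norm (?\<tau> j u)" by (rule Cauchy_Schwarz_ineq2)
      also have "\<dots> \<le> (Q * (?D + t)) * (1 + M)" using nn \<tau>[OF u, of j] Q D0 s by (intro mult_mono) auto
      finally have nt: "\<bar>n \<bullet> ?\<tau> j u\<bar> \<le> (Q * (1 + M)) * (?D + t)" by (simp add: algebra_simps)
      have Ds: "?D + t \<le> (sqrt (R/2) + 1) * (sqrt ?D + t)"
      proof -
        have "sqrt ?D * sqrt ?D \<le> sqrt (R/2) * sqrt ?D" using DR by (intro mult_right_mono real_sqrt_le_mono) (auto simp: D0)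
        then have "?D \<le> sqrt (R/2) * sqrt ?D" using D0 by simp
        moreover have "0 \<le> sqrt ?D + sqrt (R/2) * t" using D0 R s by simp
        ultimately show ?thesis by (simp add: algebra_simps)
      qed
      have "\<bar>n \<bullet> ?w\<bar> = a * s * \<bar>n \<bullet> ?\<tau> j u\<bar>" using a s by (simp add: abs_mult)
      also have "\<dots> \<le> (r * t) * ((Q * (1 + M)) * ((sqrt (R/2) + 1) * (sqrt ?D + t)))"
      proof (rule mult_mono)
        show "a * s \<le> r * t" using a s by (intro mult_mono) auto
        have "(Q * (1 + M)) * (?D + t) \<le> (Q * (1 + M)) * ((sqrt (R/2) + 1) * (sqrt ?D + t))"
          using Ds Q M by (intro mult_left_mono) auto
        then show "\<bar>n \<bullet> ?\<tau> j u\<bar> \<le> (Q * (1 + M)) * ((sqrt (R/2) + 1) * (sqrt ?D + t))" using nt by linarith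
      qed (use s in auto)
      finally have 1: "\<bar>n \<bullet> ?w\<bar> \<le> (r * (Q * (1 + M)) * (sqrt (R/2) + 1)) * t * (sqrt ?D + t)" by (simp add: mult_ac)
      have "(norm ?w)^2 \<le> (r * t * (1 + M))^2" using w by (intro power_mono) auto
      also have "\<dots> = (r^2 * (1 + M)^2) * t * t" by (simp add: power2_eq_square)
      finally have "(norm ?w)^2 / R \<le> (r^2 * (1 + M)^2 / R) * t * t" using R by (simp add: divide_right_mono)
      also have "\<dots> \<le> (r^2 * (1 + M)^2 / R) * t * (sqrt ?D + t)"
        using R s D0 by (intro mult_left_mono) auto
      finally have 2: "(norm ?w)^2 / R \<le> (r^2 * (1 + M)^2 / R) * t * (sqrt ?D + t)" .
      have "\<bar>bdist \<Omega> (\<xi> + ?w) - ?D\<bar> \<le> \<bar>n \<bullet> ?w\<bar> + (norm ?w)^2 / R"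
        using foot_normal_inner[OF bd n DR in\<Omega>] by linarith
      also have "\<dots> \<le> ((r * (Q * (1 + M)) * (sqrt (R/2) + 1)) + (r^2 * (1 + M)^2 / R)) * t * (sqrt ?D + t)"
        using 1 2 by (simp add: distrib_right)
      also have "\<dots> \<le> C * t * (sqrt ?D + t)"
        using s D0 M \<delta>' by (intro mult_right_mono) (auto simp: C_def)
      finally show ?thesis .
    qed
    then have "\<bar>sqrt (bdist \<Omega> (\<xi> + ?w)) - sqrt ?D\<bar> \<le> (2 * C + 1) * t"
      using C s D0 by (intro sqrt_diff_le) (auto simp: infdist_nonneg)
    also have "\<dots> \<le> K * t" using s by (intro mult_right_mono) (auto simp: K_def)
    finally show "\<bar>sqrt (bdist \<Omega> (\<xi> + ?w)) - sqrt ?D\<bar> \<le> K * t" .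
  qed
qed

lemma measurable_tangent_vec:
  assumes "C2_fun g" shows "tangent_vec g j \<in> borel_measurable borel"
proof -
  have [measurable]: "partial j g \<in> borel_measurable borel"
    using C2_fun_continuous(2)[OF assms, of UNIV j] by (rule borel_measurable_continuous_onI)
  show ?thesis unfolding tangent_vec_def by measurable
qed

lemma tang_null:
  fixes Z :: "'d::finite pt set" and \<tau> :: "real ^ 'd \<Rightarrow> 'd pt"
  assumes Z: "Z \<in> null_sets lborel" and \<tau>: "\<tau> \<in> borel_measurable borel"
  shows "AE \<xi> in lborel. AE u in lborel. \<forall>k\<le>r. \<xi> + real k *\<^sub>R \<tau> u \<notin> Z"
proof -
  have [measurable]: "Z \<in> sets borel" "\<tau> \<in> borel_measurable borel" using Z \<tau> by auto
  have "AE \<xi> in lborel. \<forall>k\<in>{..r}. AE u in lborel. \<xi> + real k *\<^sub>R \<tau> u \<notin> Z"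
  proof (rule AE_finite_allI)
    fix k assume "k \<in> {..r}"
    have "(\<integral>\<^sup>+\<xi>. (\<integral>\<^sup>+u. indicator Z (\<xi> + real k *\<^sub>R \<tau> u) \<partial>lborel) \<partial>lborel)
       = (\<integral>\<^sup>+u. (\<integral>\<^sup>+\<xi>. indicator Z (\<xi> + real k *\<^sub>R \<tau> u) \<partial>lborel) \<partial>lborel)"
      by (rule lborel_pair.Fubini'[symmetric]) measurable
    also have "\<dots> = (\<integral>\<^sup>+u. 0 \<partial>(lborel :: (real^'d) measure))"
    proof (rule nn_integral_cong)
      fix u
      have "(\<integral>\<^sup>+\<xi>. indicator Z (real k *\<^sub>R \<tau> u + \<xi>) \<partial>lborel) = (\<integral>\<^sup>+\<xi>. indicator Z \<xi> \<partial>lborel)"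
        by (rule nn_integral_lborel_translate) measurable
      also have "\<dots> = 0" using Z by auto
      finally show "(\<integral>\<^sup>+\<xi>. indicator Z (\<xi> + real k *\<^sub>R \<tau> u) \<partial>lborel) = 0" by (simp add: add.commute)
    qed
    finally have "(\<integral>\<^sup>+\<xi>. (\<integral>\<^sup>+u. indicator Z (\<xi> + real k *\<^sub>R \<tau> u) \<partial>lborel) \<partial>lborel) = 0" by simp
    then have "AE \<xi> in lborel. (\<integral>\<^sup>+u. indicator Z (\<xi> + real k *\<^sub>R \<tau> u) \<partial>lborel) = (0::ennreal)"
      by (subst (asm) nn_integral_0_iff_AE) measurable
    then show "AE \<xi> in lborel. AE u in lborel. \<xi> + real k *\<^sub>R \<tau> u \<notin> Z"
    proof eventually_elim
      case (elim \<xi>)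
      then have "AE u in lborel. (indicator Z (\<xi> + real k *\<^sub>R \<tau> u) :: ennreal) = 0"
        by (subst (asm) nn_integral_0_iff_AE) measurable
      then show ?case by eventually_elim (auto simp: indicator_def split: if_splits)
    qed
  qed simp
  then show ?thesis
  proof eventually_elim
    case (elim \<xi>)
    then have "AE u in lborel. \<forall>k\<in>{..r}. \<xi> + real k *\<^sub>R \<tau> u \<notin> Z" by (intro AE_finite_allI) auto
    then show ?case unfolding Ball_def atMost_iff .
  qed
qed

lemma tang_integral:
  fixes G :: "'d::finite pt \<Rightarrow> ennreal" and \<tau> :: "real ^ 'd \<Rightarrow> 'd pt"
  assumes G: "G \<in> borel_measurable borel" and \<tau>: "\<tau> \<in> borel_measurable borel"
    and d: "\<And>u. norm (fst (\<tau> u)) \<le> \<sigma>" and \<rho>: "0 \<le> \<rho>" "0 \<le> \<sigma>"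
  shows "(\<integral>\<^sup>+\<xi>. (\<integral>\<^sup>+u. G (\<xi> + \<tau> u) * indicator {u. norm (u - fst \<xi>) \<le> \<rho>} u \<partial>lborel) \<partial>lborel)
    \<le> ennreal (unit_ball_vol (real CARD('d)) * (\<rho> + \<sigma>) ^ CARD('d)) * (\<integral>\<^sup>+\<xi>. G \<xi> \<partial>lborel)"
proof -
  have [measurable]: "G \<in> borel_measurable borel" "\<tau> \<in> borel_measurable borel" by fact+
  have ind: "(indicator {u. norm (u - fst \<xi>) \<le> a} u :: ennreal) = indicator {p. norm (snd p - fst (fst p)) \<le> a} (\<xi>, u)"
    for \<xi> :: "'d pt" and u a by (simp add: indicator_def)
  have [measurable]: "{p. norm (snd p - fst (fst p)) \<le> a} \<in> sets (borel :: ('d pt \<times> (real^'d)) measure)" for a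
    by (intro borel_closed closed_Collect_le continuous_intros)
  have "(\<integral>\<^sup>+\<xi>. (\<integral>\<^sup>+u. G (\<xi> + \<tau> u) * indicator {u. norm (u - fst \<xi>) \<le> \<rho>} u \<partial>lborel) \<partial>lborel)
     = (\<integral>\<^sup>+u. (\<integral>\<^sup>+\<xi>. G (\<xi> + \<tau> u) * indicator {u. norm (u - fst \<xi>) \<le> \<rho>} u \<partial>lborel) \<partial>lborel)"
    unfolding ind by (rule lborel_pair.Fubini'[symmetric]) measurable
  also have "\<dots> \<le> (\<integral>\<^sup>+u. (\<integral>\<^sup>+\<xi>. G \<xi> * indicator {u. norm (u - fst \<xi>) \<le> \<rho> + \<sigma>} u \<partial>lborel) \<partial>lborel)"
  proof (rule nn_integral_mono)
    fix u
    have "(\<integral>\<^sup>+\<xi>. G (\<xi> + \<tau> u) * indicator {u. norm (u - fst \<xi>) \<le> \<rho>} u \<partial>lborel)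
       \<le> (\<integral>\<^sup>+\<xi>. G (\<tau> u + \<xi>) * indicator {v. norm (v - fst (\<tau> u + \<xi>)) \<le> \<rho> + \<sigma>} u \<partial>lborel)"
    proof (rule nn_integral_mono)
      fix \<xi>
      have "norm (u - fst (\<tau> u + \<xi>)) \<le> norm (u - fst \<xi>) + norm (fst (\<tau> u))"
        using norm_triangle_ineq4[of "u - fst \<xi>" "fst (\<tau> u)"] by (simp add: algebra_simps)
      then have "norm (u - fst \<xi>) \<le> \<rho> \<Longrightarrow> norm (u - fst (\<tau> u + \<xi>)) \<le> \<rho> + \<sigma>" using d[of u] by linarith
      then show "G (\<xi> + \<tau> u) * indicator {u. norm (u - fst \<xi>) \<le> \<rho>} u \<le> G (\<tau> u + \<xi>) * indicator {v. norm (v - fst (\<tau> u + \<xi>)) \<le> \<rho> + \<sigma>} u"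
        by (simp add: indicator_def add.commute)
    qed
    also have "\<dots> = (\<integral>\<^sup>+\<xi>. G \<xi> * indicator {u. norm (u - fst \<xi>) \<le> \<rho> + \<sigma>} u \<partial>lborel)"
    proof -
      have m: "(\<lambda>\<xi>. G \<xi> * indicator {u. norm (u - fst \<xi>) \<le> \<rho> + \<sigma>} u) \<in> borel_measurable borel"
        unfolding ind by measurable
      show ?thesis by (rule nn_integral_lborel_translate[OF m])
    qed
    finally show "(\<integral>\<^sup>+\<xi>. G (\<xi> + \<tau> u) * indicator {u. norm (u - fst \<xi>) \<le> \<rho>} u \<partial>lborel)
      \<le> (\<integral>\<^sup>+\<xi>. G \<xi> * indicator {u. norm (u - fst \<xi>) \<le> \<rho> + \<sigma>} u \<partial>lborel)" .
  qed
  also have "\<dots> = (\<integral>\<^sup>+\<xi>. (\<integral>\<^sup>+u. G \<xi> * indicator {u. norm (u - fst \<xi>) \<le> \<rho> + \<sigma>} u \<partial>lborel) \<partial>lborel)"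
    unfolding ind by (rule lborel_pair.Fubini') measurable
  also have "\<dots> = (\<integral>\<^sup>+\<xi>. G \<xi> * ennreal (unit_ball_vol (real CARD('d)) * (\<rho> + \<sigma>) ^ CARD('d)) \<partial>lborel)"
  proof (rule nn_integral_cong)
    fix \<xi> :: "'d pt"
    have c: "{u. norm (u - fst \<xi>) \<le> \<rho> + \<sigma>} = cball (fst \<xi>) (\<rho> + \<sigma>)"
      by (auto simp: dist_norm norm_minus_commute)
    show "(\<integral>\<^sup>+u. G \<xi> * indicator {u. norm (u - fst \<xi>) \<le> \<rho> + \<sigma>} u \<partial>lborel)
      = G \<xi> * ennreal (unit_ball_vol (real CARD('d)) * (\<rho> + \<sigma>) ^ CARD('d))"
      unfolding c using \<rho> by (simp add: nn_integral_cmult_indicator emeasure_cball)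
  qed
  also have "\<dots> = ennreal (unit_ball_vol (real CARD('d)) * (\<rho> + \<sigma>) ^ CARD('d)) * (\<integral>\<^sup>+\<xi>. G \<xi> \<partial>lborel)"
    by (subst nn_integral_multc) (auto simp: mult.commute)
  finally show ?thesis .
qed

lemma tang_bound:
  fixes \<Omega> :: "'d::finite pt set" and H :: "'d special_data"
  assumes cl: "closed \<Omega>" and H: "sd_standard H" and r: "1 \<le> r" and t: "0 < t" "t \<le> 1"
    and cond: "\<And>\<xi> u s j. \<xi> \<in> sd_set H \<Longrightarrow> u \<in> cube (sd_base H) \<Longrightarrow> 0 < s \<Longrightarrow> s \<le> t \<Longrightarrow> norm (u - fst \<xi>) \<le> t * sd_base H \<Longrightarrow>
     norm (s *\<^sub>R tangent_vec (sd_graph H) j u) \<le> K * t \<and>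
     (\<forall>a\<in>{0..real r}. \<xi> + a *\<^sub>R (s *\<^sub>R tangent_vec (sd_graph H) j u) \<in> \<Omega> \<longrightarrow>
       \<bar>sqrt (bdist \<Omega> (\<xi> + a *\<^sub>R (s *\<^sub>R tangent_vec (sd_graph H) j u))) - sqrt (bdist \<Omega> \<xi>)\<bar> \<le> K * t)"
    and dom: "dominated \<Omega> r q K N c C g" and g: "g \<in> borel_measurable borel"
    and p: "0 < q" "q \<le> p"
    and Z: "Z \<in> null_sets lborel" "p = \<infinity> \<Longrightarrow> Z = {}" and fg: "\<And>x. x \<in> \<Omega> - Z \<Longrightarrow> f x = g x"
  shows "tang_modulus_std \<Omega> H r f t A0 p
     \<le> ennreal (C * (real (r * N + 1) * (unit_ball_vol (real CARD('d)) * ((sd_base H + r) / sd_base H) ^ CARD('d))) powr (1 / enn2real p))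
       * avg_modulus \<Omega> r f (c * t) p q"
proof -
  let ?b = "sd_base H" and ?W = "\<lambda>\<xi>. local_modulus \<Omega> r g \<xi> (c * t) q" and ?d = "CARD('d)"
  let ?E = "real (r * N + 1) * (unit_ball_vol (real ?d) * ((?b + r) / ?b) ^ ?d)"
  have av: "avg_modulus \<Omega> r f (c * t) p q = avg_modulus \<Omega> r g (c * t) p q"
    by (rule avg_modulus_cong_null[OF Z fg r p(2)])
  have b: "?b > 0" and C2: "C2_fun (sd_graph H)" using H by (auto simp: sd_standard_def sd_ok_def)
  have N: "1 \<le> N" and C: "0 < C" using dom by (auto simp: dominated_def)
  have E: "?E > 0" using b by (intro mult_pos_pos zero_less_power divide_pos_pos) (auto simp del: of_nat_add of_nat_mult intro!: add_pos_nonneg)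
  let ?v = "\<lambda>s j u. s *\<^sub>R tangent_vec (sd_graph H) j u"
  have pt: "fdiff_on r (?v s j u) g \<Omega> \<xi> = 0 \<or> (\<exists>k\<le>r * N. \<xi> + (real k / real N) *\<^sub>R ?v s j u \<in> \<Omega> \<and>
      ennreal \<bar>fdiff_on r (?v s j u) g \<Omega> \<xi>\<bar> \<le> ennreal C * ?W (\<xi> + (real k / real N) *\<^sub>R ?v s j u))"
    if s: "0 < s" "s \<le> t" and \<xi>: "\<xi> \<in> tang_region H A0 t" and u: "u \<in> base_ball ?b (fst \<xi>) (t * ?b)" for s j \<xi> u
  proof (cases "closed_segment \<xi> (\<xi> + real r *\<^sub>R ?v s j u) \<subseteq> \<Omega>")
    case True
    have \<xi>': "\<xi> \<in> sd_set H" "u \<in> cube ?b" "norm (u - fst \<xi>) \<le> t * ?b"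
      using \<xi> u by (auto simp: tang_region_def base_ball_def)
    have on: "\<xi> + a *\<^sub>R ?v s j u \<in> \<Omega>" if "a \<in> {0..real r}" for a
    proof -
      have "\<xi> + a *\<^sub>R ?v s j u \<in> closed_segment \<xi> (\<xi> + real r *\<^sub>R ?v s j u)"
        unfolding closed_segment_mem using that r by (intro image_eqI[of _ _ "a / real r"]) auto
      then show ?thesis using True by blast
    qed
    note cd = cond[OF \<xi>'(1,2) s \<xi>'(3), of j]
    obtain k where k: "k \<le> r * N" "ennreal \<bar>fdiff r (?v s j u) g \<xi>\<bar> \<le> ennreal C * ?W (\<xi> + (real k / real N) *\<^sub>R ?v s j u)"
      using dominatedD[OF dom t, of "?v s j u" \<xi>] cd on by blast
    have "real k \<le> real (r * N)" using k(1) by (simp only: of_nat_le_iff)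
    then have "real k / real N \<in> {0..real r}" using N by (simp add: field_simps)
    from on[OF this] k show ?thesis using True by (auto simp: fdiff_on_def)
  qed (simp add: fdiff_on_def)
  show ?thesis unfolding av tang_modulus_std_def Let_def
  proof (intro SUP_least)
    fix s and j :: 'd assume "s \<in> {0<..t}"
    then have s: "0 < s" "s \<le> t" by auto
    have \<tau>m [measurable]: "?v s j \<in> borel_measurable borel"
      using measurable_tangent_vec[OF C2, of j] by measurable
    show "(if p = \<infinity> then SUP \<xi>\<in>tang_region H A0 t. SUP u\<in>base_ball ?b (fst \<xi>) (t * ?b). ennreal \<bar>fdiff_on r (?v s j u) f \<Omega> \<xi>\<bar>
        else epow (\<integral>\<^sup>+\<xi>\<in>tang_region H A0 t.
               ((\<integral>\<^sup>+u\<in>base_ball ?b (fst \<xi>) (t * ?b). epow (ennreal \<bar>fdiff_on r (?v s j u) f \<Omega> \<xi>\<bar>) (enn2real p) \<partial>lebesgue)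
                  / ennreal ((?b * t) ^ ?d)) \<partial>lebesgue) (1 / enn2real p))
       \<le> ennreal (C * ?E powr (1 / enn2real p)) * avg_modulus \<Omega> r g (c * t) p q"
    proof (cases "p = \<infinity>")
      case True
      have "?E \<noteq> 0" using E by linarith
      then have "?E powr 0 = 1" by (simp only: powr_zero_eq_one if_False)
      moreover have "1 / enn2real p = 0" using True by simp
      ultimately have c1: "C * ?E powr (1 / enn2real p) = C" by (simp only: mult_1_right)
      have "Z = {}" using True by (rule Z)
      then have fg': "fdiff_on r (?v s j u) f \<Omega> \<xi> = fdiff_on r (?v s j u) g \<Omega> \<xi>" for u \<xi>
        using fg by (intro fdiff_on_cong) auto
      have *: "ennreal \<bar>fdiff_on r (?v s j u) g \<Omega> \<xi>\<bar> \<le> ennreal C * (SUP x\<in>\<Omega>. ?W x)"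
        if "\<xi> \<in> tang_region H A0 t" "u \<in> base_ball ?b (fst \<xi>) (t * ?b)" for \<xi> u
        using pt[OF s that, of j]
      proof
        assume "\<exists>k\<le>r * N. \<xi> + (real k / real N) *\<^sub>R ?v s j u \<in> \<Omega> \<and>
          ennreal \<bar>fdiff_on r (?v s j u) g \<Omega> \<xi>\<bar> \<le> ennreal C * ?W (\<xi> + (real k / real N) *\<^sub>R ?v s j u)"
        then obtain k where k: "\<xi> + (real k / real N) *\<^sub>R ?v s j u \<in> \<Omega>"
          "ennreal \<bar>fdiff_on r (?v s j u) g \<Omega> \<xi>\<bar> \<le> ennreal C * ?W (\<xi> + (real k / real N) *\<^sub>R ?v s j u)" by blast
        have "?W (\<xi> + (real k / real N) *\<^sub>R ?v s j u) \<le> (SUP x\<in>\<Omega>. ?W x)" using k(1) by (rule SUP_upper)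
        then show ?thesis by (rule order_trans[OF k(2) mult_left_mono]) simp
      qed simp
      show ?thesis unfolding c1 fg' unfolding avg_modulus_def True Lp_norm_top if_P[OF refl]
        by (intro SUP_least *)
    next
      case False
      let ?p = "enn2real p"
      have "p > 0" using p by (rule less_le_trans)
      then have p0: "?p > 0" using False by (simp add: enn2real_positive_iff less_top)
      have qf: "q \<noteq> \<infinity>" using p False by (auto simp: top_unique)
      have W [measurable]: "?W \<in> borel_measurable borel" by (rule measurable_local_modulus[OF cl qf g])
      have [measurable]: "\<Omega> \<in> sets borel" using cl by simp
      let ?G = "\<lambda>\<xi>. epow (?W \<xi>) ?p * indicator \<Omega> \<xi>"
      let ?V = "(?b * t) ^ ?d"
      have V: "?V > 0" using b t by simp
      let ?B = "\<lambda>\<xi>. {u. norm (u - fst \<xi>) \<le> t * ?b}"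
      let ?k = "\<lambda>k. real k / real N"
      have [measurable]: "{p. norm (snd p - fst (fst p)) \<le> a} \<in> sets (borel :: ('d pt \<times> (real^'d)) measure)" for a
        by (intro borel_closed closed_Collect_le continuous_intros)
      have ind: "(indicator {u. norm (u - fst \<xi>) \<le> a} u :: ennreal) = indicator {p. norm (snd p - fst (fst p)) \<le> a} (\<xi>, u)"
        for \<xi> :: "'d pt" and u a by (simp add: indicator_def)
      have inner: "(\<integral>\<^sup>+u\<in>base_ball ?b (fst \<xi>) (t * ?b). epow (ennreal \<bar>fdiff_on r (?v s j u) f \<Omega> \<xi>\<bar>) ?p \<partial>lborel)
         \<le> ennreal (C powr ?p) * (\<Sum>k\<le>r*N. \<integral>\<^sup>+u. ?G (\<xi> + ?k k *\<^sub>R ?v s j u) * indicator (?B \<xi>) u \<partial>lborel)"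
        if ae: "AE u in lborel. \<forall>k\<le>r. \<xi> + real k *\<^sub>R ?v s j u \<notin> Z" and \<xi>: "\<xi> \<in> tang_region H A0 t" for \<xi>
      proof -
        have "(\<integral>\<^sup>+u\<in>base_ball ?b (fst \<xi>) (t * ?b). epow (ennreal \<bar>fdiff_on r (?v s j u) f \<Omega> \<xi>\<bar>) ?p \<partial>lborel)
          = (\<integral>\<^sup>+u\<in>base_ball ?b (fst \<xi>) (t * ?b). epow (ennreal \<bar>fdiff_on r (?v s j u) g \<Omega> \<xi>\<bar>) ?p \<partial>lborel)"
        proof (rule nn_integral_cong_AE, use ae in eventually_elim)
          case (elim u)
          have "fdiff_on r (?v s j u) f \<Omega> \<xi> = fdiff_on r (?v s j u) g \<Omega> \<xi>"
            by (rule fdiff_on_cong) (use elim fg in blast)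
          then show ?case by simp
        qed
        also have "\<dots> \<le> (\<integral>\<^sup>+u. ennreal (C powr ?p) * (\<Sum>k\<le>r*N. ?G (\<xi> + ?k k *\<^sub>R ?v s j u) * indicator (?B \<xi>) u) \<partial>lborel)"
        proof (rule nn_integral_mono)
          fix u
          show "epow (ennreal \<bar>fdiff_on r (?v s j u) g \<Omega> \<xi>\<bar>) ?p * indicator (base_ball ?b (fst \<xi>) (t * ?b)) u
            \<le> ennreal (C powr ?p) * (\<Sum>k\<le>r*N. ?G (\<xi> + ?k k *\<^sub>R ?v s j u) * indicator (?B \<xi>) u)"
          proof (cases "u \<in> base_ball ?b (fst \<xi>) (t * ?b)")
            case True
            then have uB: "u \<in> ?B \<xi>" by (simp add: base_ball_def)
            from pt[OF s \<xi> True, of j] show ?thesis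
            proof
              assume "\<exists>k\<le>r * N. \<xi> + ?k k *\<^sub>R ?v s j u \<in> \<Omega> \<and>
                ennreal \<bar>fdiff_on r (?v s j u) g \<Omega> \<xi>\<bar> \<le> ennreal C * ?W (\<xi> + ?k k *\<^sub>R ?v s j u)"
              then obtain k where k: "k \<le> r * N" "\<xi> + ?k k *\<^sub>R ?v s j u \<in> \<Omega>"
                "ennreal \<bar>fdiff_on r (?v s j u) g \<Omega> \<xi>\<bar> \<le> ennreal C * ?W (\<xi> + ?k k *\<^sub>R ?v s j u)" by blast
              have "epow (ennreal \<bar>fdiff_on r (?v s j u) g \<Omega> \<xi>\<bar>) ?p \<le> epow (ennreal C * ?W (\<xi> + ?k k *\<^sub>R ?v s j u)) ?p"
                using k(3) p0 by (intro epow_mono) auto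
              also have "\<dots> = ennreal (C powr ?p) * (?G (\<xi> + ?k k *\<^sub>R ?v s j u) * indicator (?B \<xi>) u)"
                using k(2) uB C p0 by (simp add: epow_mult)
              also have "\<dots> \<le> ennreal (C powr ?p) * (\<Sum>k\<le>r*N. ?G (\<xi> + ?k k *\<^sub>R ?v s j u) * indicator (?B \<xi>) u)"
                using k(1) by (intro mult_left_mono member_le_sum) auto
              finally show ?thesis using True by simp
            qed (use p0 in simp)
          qed simp
        qed
        also have "\<dots> = ennreal (C powr ?p) * (\<Sum>k\<le>r*N. \<integral>\<^sup>+u. ?G (\<xi> + ?k k *\<^sub>R ?v s j u) * indicator (?B \<xi>) u \<partial>lborel)"
        proof -
          have m: "(\<lambda>u. ?G (\<xi> + ?k k *\<^sub>R ?v s j u) * indicator (?B \<xi>) u) \<in> borel_measurable lborel" for k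
            unfolding ind by measurable
          show ?thesis unfolding nn_integral_sum[OF m, symmetric]
            by (rule nn_integral_cmult) (intro borel_measurable_sum m)
        qed
        finally show ?thesis .
      qed
      have "(\<integral>\<^sup>+\<xi>\<in>tang_region H A0 t. ((\<integral>\<^sup>+u\<in>base_ball ?b (fst \<xi>) (t * ?b). epow (ennreal \<bar>fdiff_on r (?v s j u) f \<Omega> \<xi>\<bar>) ?p \<partial>lborel) / ennreal ?V) \<partial>lborel)
         \<le> (\<integral>\<^sup>+\<xi>. ennreal (C powr ?p / ?V) * (\<Sum>k\<le>r*N. \<integral>\<^sup>+u. ?G (\<xi> + ?k k *\<^sub>R ?v s j u) * indicator (?B \<xi>) u \<partial>lborel) \<partial>lborel)"
      proof (rule nn_integral_mono_AE, use tang_null[OF Z(1) \<tau>m, of r] in eventually_elim)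
        case (elim \<xi>)
        show ?case
        proof (cases "\<xi> \<in> tang_region H A0 t")
          case True
          have "ennreal (C powr ?p) * x / ennreal ?V = ennreal (C powr ?p / ?V) * x" for x
          proof -
            have "ennreal (C powr ?p) * x / ennreal ?V = (ennreal (C powr ?p) / ennreal ?V) * x"
              by (simp only: ennreal_times_divide[symmetric] mult.commute ennreal_divide_times)
            then show ?thesis using V by (simp add: divide_ennreal)
          qed
          then show ?thesis using divide_right_mono_ennreal[OF inner[OF elim True], of "ennreal ?V"] True by simp
        qed simp
      qed
      also have "\<dots> = ennreal (C powr ?p / ?V) * (\<Sum>k\<le>r*N. \<integral>\<^sup>+\<xi>. (\<integral>\<^sup>+u. ?G (\<xi> + ?k k *\<^sub>R ?v s j u) * indicator (?B \<xi>) u \<partial>lborel) \<partial>lborel)"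
      proof -
        have m: "(\<lambda>\<xi>. \<integral>\<^sup>+u. ?G (\<xi> + ?k k *\<^sub>R ?v s j u) * indicator (?B \<xi>) u \<partial>lborel) \<in> borel_measurable lborel" for k
          unfolding ind by measurable
        show ?thesis unfolding nn_integral_sum[OF m, symmetric]
          by (rule nn_integral_cmult) (intro borel_measurable_sum m)
      qed
      also have "\<dots> \<le> ennreal (C powr ?p / ?V) * (\<Sum>k\<le>r*N. ennreal (unit_ball_vol (real ?d) * (t * ?b + r * t) ^ ?d) * (\<integral>\<^sup>+\<xi>\<in>\<Omega>. epow (?W \<xi>) ?p \<partial>lborel))"
      proof (intro mult_left_mono sum_mono)
        fix k assume "k \<in> {..r*N}"
        then have "real k \<le> real (r * N)" by (simp only: of_nat_le_iff atMost_iff)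
        then have kr: "?k k \<le> r" using N by (simp add: field_simps)
        show "(\<integral>\<^sup>+\<xi>. (\<integral>\<^sup>+u. ?G (\<xi> + ?k k *\<^sub>R ?v s j u) * indicator (?B \<xi>) u \<partial>lborel) \<partial>lborel)
           \<le> ennreal (unit_ball_vol (real ?d) * (t * ?b + r * t) ^ ?d) * (\<integral>\<^sup>+\<xi>\<in>\<Omega>. epow (?W \<xi>) ?p \<partial>lborel)"
        proof (rule tang_integral[of ?G])
          show "(\<lambda>u. ?k k *\<^sub>R ?v s j u) \<in> borel_measurable borel" by measurable
          fix u
          have "norm (fst (?k k *\<^sub>R ?v s j u)) = ?k k * s" using s by (simp add: tangent_vec_def)
          also have "\<dots> \<le> r * t" using kr s by (intro mult_mono) auto
          finally show "norm (fst (?k k *\<^sub>R ?v s j u)) \<le> r * t" .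
        qed (use b t in auto)
      qed simp
      also have "\<dots> = ennreal (C powr ?p * ?E) * (\<integral>\<^sup>+\<xi>\<in>\<Omega>. epow (?W \<xi>) ?p \<partial>lborel)"
      proof -
        have "(t * ?b + r * t) ^ ?d = ((?b + r) / ?b) ^ ?d * ?V"
        proof -
          have "t * ?b + r * t = ((?b + r) / ?b) * (?b * t)" using b by (simp add: field_simps)
          then show ?thesis by (simp only: power_mult_distrib)
        qed
        then have "C powr ?p * ?E = (C powr ?p / ?V) * (real (r*N+1) * (unit_ball_vol (real ?d) * (t * ?b + r * t) ^ ?d))"
        proof -
          have key: "x * (y * (z * w)) = (x / V) * (y * (z * (w * V)))" if "V > 0" for x y z w V :: real
            using that by simp
          show ?thesis unfolding \<open>(t * ?b + r * t) ^ ?d = _\<close> by (rule key[OF V])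
        qed
        also have "ennreal \<dots> = ennreal (C powr ?p / ?V) * (of_nat (r*N+1) * ennreal (unit_ball_vol (real ?d) * (t * ?b + r * t) ^ ?d))"
          using V b t by (subst ennreal_mult, simp, simp, subst ennreal_mult, simp, simp, subst ennreal_of_nat_eq_real_of_nat) simp
        finally show ?thesis by (simp add: mult.assoc)
      qed
      finally have "epow (\<integral>\<^sup>+\<xi>\<in>tang_region H A0 t.
               ((\<integral>\<^sup>+u\<in>base_ball ?b (fst \<xi>) (t * ?b). epow (ennreal \<bar>fdiff_on r (?v s j u) f \<Omega> \<xi>\<bar>) ?p \<partial>lebesgue)
                  / ennreal ?V) \<partial>lebesgue) (1 / ?p)
         \<le> epow (ennreal (C powr ?p * ?E) * (\<integral>\<^sup>+\<xi>\<in>\<Omega>. epow (?W \<xi>) ?p \<partial>lborel)) (1 / ?p)"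
        unfolding nn_integral_completion using p0 by (intro epow_mono) auto
      also have "\<dots> = ennreal ((C powr ?p * ?E) powr (1/?p)) * avg_modulus \<Omega> r g (c * t) p q"
        unfolding avg_modulus_def Lp_norm_fin[OF False] using p0 E by (intro epow_const_mult) auto
      also have "(C powr ?p * ?E) powr (1/?p) = C * ?E powr (1/?p)"
        using p0 C E by (subst powr_mult) (auto simp: powr_powr)
      finally show ?thesis using False by simp
    qed
  qed
qed

section \<open>Invariance under coordinate maps\<close>

definition rigid :: "('a::euclidean_space \<Rightarrow> 'a) \<Rightarrow> ('a \<Rightarrow> 'a) \<Rightarrow> bool" where
  "rigid T L \<longleftrightarrow> linear L \<and> (\<forall>x. norm (L x) = norm x) \<and> (\<forall>x. T x = T 0 + L x) \<and> distr lborel borel L = lborel"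

lemma distr_lborel_coordinate_permutation:
  fixes S :: "'a::euclidean_space \<Rightarrow> 'a"
  assumes adj: "\<And>x y. S x \<bullet> y = x \<bullet> S y" and S: "\<And>x. S (S x) = x" "S ` Basis = Basis" and lin: "linear S"
  shows "distr lborel borel S = lborel"
proof (rule lborel_eqI[symmetric])
  have [measurable]: "S \<in> borel_measurable borel"
    using lin by (intro borel_measurable_continuous_onI linear_continuous_on linear_conv_bounded_linear[THEN iffD1])
  fix l u :: 'a assume lu: "\<And>b. b \<in> Basis \<Longrightarrow> l \<bullet> b \<le> u \<bullet> b"
  have inj: "inj_on S Basis" using S(1) by (metis inj_onI)
  have SB: "S b \<in> Basis" if "b \<in> Basis" for b using S(2) that by blast
  have "S -` box l u = box (S l) (S u)"
  proof (intro set_eqI iffI)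
    fix x assume "x \<in> S -` box l u"
    then have "l \<bullet> S b < S x \<bullet> S b \<and> S x \<bullet> S b < u \<bullet> S b" if "b \<in> Basis" for b using SB[OF that] by (auto simp: mem_box)
    then show "x \<in> box (S l) (S u)" by (simp add: mem_box adj S(1))
  next
    fix x assume "x \<in> box (S l) (S u)"
    then have "S l \<bullet> S b < x \<bullet> S b \<and> x \<bullet> S b < S u \<bullet> S b" if "b \<in> Basis" for b using SB[OF that] by (auto simp: mem_box)
    then show "x \<in> S -` box l u" by (simp add: mem_box adj S(1))
  qed
  then have "emeasure (distr lborel borel S) (box l u) = emeasure lborel (box (S l) (S u))"
    by (simp add: emeasure_distr)
  also have "\<dots> = (\<Prod>b\<in>Basis. (S u - S l) \<bullet> b)"
    using lu SB by (subst emeasure_lborel_box) (auto simp: adj)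
  also have "(\<Prod>b\<in>Basis. (S u - S l) \<bullet> b) = (\<Prod>b\<in>Basis. (u - l) \<bullet> S b)"
    by (simp add: inner_diff_left adj)
  also have "\<dots> = (\<Prod>b\<in>S ` Basis. (u - l) \<bullet> b)" using inj by (simp add: prod.reindex)
  finally show "emeasure (distr lborel borel S) (box l u) = (\<Prod>b\<in>Basis. (u - l) \<bullet> b)" using S(2) by simp
qed simp

lemma distr_lborel_sign_change:
  fixes S :: "'a::euclidean_space \<Rightarrow> 'a"
  assumes S: "\<And>x b. b \<in> Basis \<Longrightarrow> S x \<bullet> b = c b * (x \<bullet> b)" and c: "\<And>b. b \<in> Basis \<Longrightarrow> \<bar>c b\<bar> = (1::real)"
  shows "distr lborel borel S = lborel"
proof -
  have "S = (\<lambda>x. 0 + (\<Sum>j\<in>Basis. (c j * (x \<bullet> j)) *\<^sub>R j))"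
  proof
    fix x
    have "S x = (\<Sum>j\<in>Basis. (S x \<bullet> j) *\<^sub>R j)" by (simp add: euclidean_representation)
    also have "\<dots> = (\<Sum>j\<in>Basis. (c j * (x \<bullet> j)) *\<^sub>R j)" by (intro sum.cong refl) (simp add: S)
    finally show "S x = 0 + (\<Sum>j\<in>Basis. (c j * (x \<bullet> j)) *\<^sub>R j)" by simp
  qed
  moreover have "\<And>b. b \<in> Basis \<Longrightarrow> c b \<noteq> 0" using c by fastforce
  from lborel_affine_euclidean[of c 0, OF this] have "lborel = density (distr lborel borel (\<lambda>x. 0 + (\<Sum>j\<in>Basis. (c j * (x \<bullet> j)) *\<^sub>R j))) (\<lambda>_. 1)"
    using c by simp
  ultimately show ?thesis by (simp add: density_1)
qed

lemma Basis_pt: "(Basis :: 'd::finite pt set) = insert (0, 1) (range (\<lambda>i. (axis i 1, 0)))"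
  by (auto simp: Basis_prod_def Basis_vec_def)


lemma rigid_coord_swap: "rigid (coord_swap j) (coord_swap j)"
proof -
  have lin: "linear (coord_swap j)"
    by (cases j) (auto intro!: linearI simp: vec_eq_iff)
  have adj: "coord_swap j x \<bullet> y = x \<bullet> coord_swap j y" for x y
  proof (cases j)
    case (Some i)
    have s: "(\<chi> k. if k = i then b else a $ k) \<bullet> c = b * c $ i - a $ i * c $ i + a \<bullet> c" for a c :: "real^'a" and b
    proof -
      have "(\<chi> k. if k = i then b else a $ k) \<bullet> c = (\<Sum>k\<in>UNIV. a $ k * c $ k + (if k = i then b * c $ i - a $ i * c $ i else 0))"
        unfolding inner_vec_def by (intro sum.cong refl) auto
      then show ?thesis by (simp add: sum.distrib inner_vec_def)
    qed
    obtain a b where x: "x = (a, b)" by (cases x)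
    obtain c d where y: "y = (c, d)" by (cases y)
    have "a \<bullet> (\<chi> k. if k = i then d else c $ k) = d * a $ i - c $ i * a $ i + a \<bullet> c"
      by (subst inner_commute, subst s) (simp add: inner_commute)
    then show ?thesis unfolding x y Some by (simp add: s algebra_simps)
  qed simp
  have inv: "coord_swap j (coord_swap j x) = x" for x by (cases j; cases x) (auto simp: vec_eq_iff)
  have b: "coord_swap j ` Basis \<subseteq> Basis"
    by (cases j) (auto simp: Basis_pt vec_eq_iff axis_def image_iff split: if_splits)
  have B: "coord_swap j ` Basis = Basis"
  proof (rule antisym[OF b], rule subsetI)
    fix x :: "'a pt" assume "x \<in> Basis"
    then have "coord_swap j x \<in> Basis" using b by blast
    then show "x \<in> coord_swap j ` Basis" using inv[of x] by (metis imageI)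
  qed
  have nrm: "norm (coord_swap j x) = norm x" for x
    by (simp add: norm_eq_sqrt_inner adj inv)
  show ?thesis unfolding rigid_def linear_0[OF lin] add_0
    by (intro conjI allI lin nrm refl distr_lborel_coordinate_permutation[OF adj inv B lin])
qed

lemma rigid_coord_flip: "rigid (coord_flip j) (coord_flip j)"
proof -
  have lin: "linear (coord_flip j)"
    by (cases j) (auto intro!: linearI simp: vec_eq_iff)
  define c where "c b = (if b = basis_vec j then -1 else 1::real)" for b
  have S: "coord_flip j x \<bullet> b = c b * (x \<bullet> b)" if "b \<in> Basis" for x b
    using that by (cases j; cases x) (auto simp: c_def Basis_pt inner_axis axis_eq_axis split: if_splits)
  have inv: "coord_flip j (coord_flip j x) = x" for x by (cases j; cases x) (auto simp: vec_eq_iff)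
  have nrm: "norm (coord_flip j x) = norm x" for x
    unfolding norm_eq_sqrt_inner
    by (subst (1 2) euclidean_inner) (auto intro!: sum.cong simp: S c_def)
  have d: "distr lborel borel (coord_flip j) = lborel"
    by (rule distr_lborel_sign_change[OF S]) (auto simp: c_def)
  show ?thesis unfolding rigid_def linear_0[OF lin] add_0
    by (intro conjI allI lin nrm refl d)
qed

lemma rigid_compose:
  assumes "rigid S S'" "rigid T T'" shows "rigid (S \<circ> T) (S' \<circ> T')"
proof -
  have m: "S' \<in> borel_measurable borel" "T' \<in> borel_measurable borel"
    using assms[unfolded rigid_def, THEN conjunct1]
    by (auto intro!: borel_measurable_continuous_onI linear_continuous_on linear_conv_bounded_linear[THEN iffD1])
  have "distr lborel borel (S' \<circ> T') = distr (distr lborel borel T') borel S'"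
    using m by (subst distr_distr) auto
  also have "\<dots> = lborel" using assms unfolding rigid_def by metis
  finally have d: "distr lborel borel (S' \<circ> T') = lborel" .
  have "S (T x) = S (T 0) + S' (T' x)" for x
  proof -
    have "S (T x) = S 0 + S' (T 0 + T' x)" using assms unfolding rigid_def by metis
    also have "\<dots> = (S 0 + S' (T 0)) + S' (T' x)"
      using linear_add[of S' "T 0" "T' x"] assms(1) unfolding rigid_def by (metis add.assoc)
    also have "S 0 + S' (T 0) = S (T 0)" using assms unfolding rigid_def by metis
    finally show ?thesis .
  qed
  note e = this
  have lin: "linear (S' \<circ> T')" using assms linear_compose[of T' S'] unfolding rigid_def by blast
  have nrm: "norm (S' (T' x)) = norm x" for x using assms unfolding rigid_def by metis
  show ?thesis unfolding rigid_def o_apply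
    using lin d by (intro conjI allI nrm e) (simp_all only: comp_def)
qed

lemma rigid_translation: "rigid ((+) v) id"
proof -
  have "distr lborel borel id = (lborel :: 'a measure)"
    unfolding id_def by (rule distr_id2) simp
  then show ?thesis by (simp add: rigid_def linear_id)
qed

lemma coord_map_rigid: "coord_map T \<Longrightarrow> \<exists>L. rigid T L"
proof (induction rule: coord_map.induct)
  case coord_map_id
  have "((+) 0 :: 'a pt \<Rightarrow> 'a pt) = id" by auto
  then have "rigid (id :: 'a pt \<Rightarrow> 'a pt) id" using rigid_translation[of "0 :: 'a pt"] by simp
  then show ?case by blast
next
  case (coord_map_translation T v) then show ?case using rigid_compose[OF rigid_translation] by blast
next
  case (coord_map_swap T j) then show ?case using rigid_compose[OF rigid_coord_swap] by blast
next
  case (coord_map_flip T j) then show ?case using rigid_compose[OF rigid_coord_flip] by blast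
qed

context
  fixes T L :: "'a::euclidean_space \<Rightarrow> 'a"
  assumes TL: "rigid T L"
begin

lemma rigid_linear: "linear L" and rigid_norm: "norm (L x) = norm x" and rigid_eq: "T x = T 0 + L x"
  using TL unfolding rigid_def by blast+

lemma rigid_inj_L: "inj L"
proof (rule linear_injective_0[OF rigid_linear, THEN iffD2], intro allI impI)
  fix x assume "L x = 0"
  then show "x = 0" using rigid_norm[of x] by simp
qed

lemma rigid_surj_L: "surj L"
  using linear_injective_imp_surjective[OF rigid_linear rigid_inj_L] by simp

lemma rigid_add: "T (x + v) = T x + L v"
  using rigid_eq[of "x + v"] rigid_eq[of x] linear_add[OF rigid_linear, of x v] by simp

lemma rigid_diff: "T x - T y = L (x - y)"
  using rigid_add[of y "x - y"] by simp

lemma rigid_dist: "dist (T x) (T y) = dist x y"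
  by (simp add: dist_norm rigid_diff rigid_norm)

lemma rigid_bij: "bij T"
proof (rule bijI)
  show "inj T" using rigid_dist by (metis dist_eq_0_iff injI)
  show "surj T"
  proof (rule surjI[of T "\<lambda>y. inv L (y - T 0)"])
    fix y show "T (inv L (y - T 0)) = y"
      by (subst rigid_eq) (simp add: surj_f_inv_f[OF rigid_surj_L])
  qed
qed

lemma rigid_inv [simp]: "inv T (T x) = x" "T (inv T y) = y"
  using rigid_bij by (auto simp: bij_is_inj bij_is_surj surj_f_inv_f)

lemma rigid_continuous: "continuous_on S T" "continuous_on S (inv T)"
proof -
  have "dist (inv T x) (inv T y) = dist x y" for x y using rigid_dist[of "inv T x" "inv T y"] by simp
  then show "continuous_on S (inv T)" by (metis continuous_on_iff)
  show "continuous_on S T" using rigid_dist by (metis continuous_on_iff)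
qed

lemma rigid_measurable: "T \<in> borel_measurable borel" "inv T \<in> borel_measurable borel"
  using rigid_continuous by (auto intro: borel_measurable_continuous_onI)

lemma rigid_nn_integral:
  assumes [measurable]: "g \<in> borel_measurable borel"
  shows "(\<integral>\<^sup>+x. g (T x) \<partial>lborel) = (\<integral>\<^sup>+x. g x \<partial>lborel)"
proof -
  have L [measurable]: "L \<in> borel_measurable borel"
    using rigid_linear by (intro borel_measurable_continuous_onI linear_continuous_on linear_conv_bounded_linear[THEN iffD1])
  have "(\<integral>\<^sup>+x. g (T x) \<partial>lborel) = (\<integral>\<^sup>+x. g (T 0 + L x) \<partial>lborel)" by (subst rigid_eq) simp
  also have "\<dots> = (\<integral>\<^sup>+x. g (T 0 + x) \<partial>distr lborel borel L)" by (subst nn_integral_distr) auto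
  also have "\<dots> = (\<integral>\<^sup>+x. g (T 0 + x) \<partial>lborel)"
  proof -
    have "distr lborel borel L = lborel" using TL unfolding rigid_def by blast
    then show ?thesis by (simp only:)
  qed
  also have "\<dots> = (\<integral>\<^sup>+x. g x \<partial>lborel)" by (rule nn_integral_lborel_translate) measurable
  finally show ?thesis .
qed

lemma rigid_image_vimage: "T ` A = inv T -` A"
  using rigid_bij by (simp add: bij_vimage_eq_inv_image bij_imp_bij_inv inv_inv_eq)

lemma rigid_emeasure:
  assumes "A \<in> sets borel" shows "emeasure lborel (T ` A) = emeasure lborel A"
proof -
  have m: "T ` A \<in> sets borel" unfolding rigid_image_vimage
    using measurable_sets_borel[OF rigid_measurable(2)] assms by simp
  have "emeasure lborel (T ` A) = (\<integral>\<^sup>+x. indicator (T ` A) x \<partial>lborel)" using m by simp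
  also have "\<dots> = (\<integral>\<^sup>+x. indicator (T ` A) (T x) \<partial>lborel)" using m by (intro rigid_nn_integral[symmetric]) auto
  also have "(\<lambda>x. indicator (T ` A) (T x) :: ennreal) = indicator A"
    using rigid_bij by (auto simp: indicator_def bij_is_inj inj_image_mem_iff)
  finally show ?thesis using assms by simp
qed


lemma rigid_frontier: "frontier (T ` A) = T ` frontier A"
proof -
  have op: "open (T ` S)" if "open S" for S
    unfolding rigid_image_vimage by (rule open_vimage[OF that rigid_continuous(2)])
  have op': "open (T -` S)" if "open S" for S
    by (rule open_vimage[OF that rigid_continuous(1)])
  have int: "interior (T ` A) = T ` interior A" for A
  proof (rule antisym)
    show "T ` interior A \<subseteq> interior (T ` A)" using op by (intro interior_maximal) (auto simp: interior_subset image_mono)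
    have "T -` interior (T ` A) \<subseteq> A"
    proof
      fix x assume "x \<in> T -` interior (T ` A)"
      then have "T x \<in> T ` A" using interior_subset[of "T ` A"] by blast
      then show "x \<in> A" using rigid_inv(1) by (metis imageE)
    qed
    then have "T -` interior (T ` A) \<subseteq> interior A" using op' by (intro interior_maximal) auto
    then show "interior (T ` A) \<subseteq> T ` interior A"
    proof (intro subsetI)
      fix y assume *: "T -` interior (T ` A) \<subseteq> interior A" "y \<in> interior (T ` A)"
      then have "inv T y \<in> interior A" using rigid_inv(2)[of y] by auto
      then show "y \<in> T ` interior A" using rigid_inv(2)[of y] by (intro image_eqI[of _ _ "inv T y"]) auto
    qed
  qed
  have co: "- (T ` A) = T ` (- A)" for A by (rule bij_image_Compl_eq[OF rigid_bij, symmetric])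
  have "frontier (T ` A) = - interior (T ` A) \<inter> - interior (T ` (- A))"
    by (simp add: frontier_def closure_interior co[symmetric]) blast
  also have "\<dots> = T ` (- interior A \<inter> - interior (- A))"
    using rigid_bij by (simp add: int co bij_is_inj image_Int)
  also have "- interior A \<inter> - interior (- A) = frontier A" by (simp add: frontier_def closure_interior) blast
  finally show ?thesis .
qed

lemma rigid_infdist: "infdist (T x) (T ` A) = infdist x A"
  by (simp add: infdist_def image_image rigid_dist)

lemma rigid_bdist: "bdist (T ` \<Omega>) (T x) = bdist \<Omega> x"
  by (simp add: rigid_frontier rigid_infdist)

lemma rigid_rho: "rho (T ` \<Omega>) (T x) (T y) = rho \<Omega> x y"
  by (simp add: rho_def rigid_bdist rigid_diff rigid_norm)

lemma rigid_rho_ball: "rho_ball (T ` \<Omega>) (T x) \<delta> = T ` rho_ball \<Omega> x \<delta>"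
  unfolding rho_ball_def by (auto simp: rigid_rho)

lemma rigid_scale: "T (x + a *\<^sub>R v) = T x + a *\<^sub>R L v"
  by (simp add: rigid_add linear_scale[OF rigid_linear])

lemma rigid_segment: "closed_segment (T x) (T y) = T ` closed_segment x y"
  unfolding closed_segment_mem image_image by (simp add: rigid_scale rigid_diff)

lemma rigid_fdiff_on: "fdiff_on r (L v) (f \<circ> inv T) (T ` \<Omega>) (T x) = fdiff_on r v f \<Omega> x"
proof -
  have "closed_segment (T x) (T x + real r *\<^sub>R L v) \<subseteq> T ` \<Omega> \<longleftrightarrow> closed_segment x (x + real r *\<^sub>R v) \<subseteq> \<Omega>"
    unfolding rigid_scale[symmetric] rigid_segment using rigid_bij by (simp add: bij_is_inj inj_image_subset_iff)
  then show ?thesis unfolding fdiff_on_def fdiff_def rigid_scale[symmetric] by simp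
qed

lemma rigid_ldiff: "ldiff (T ` \<Omega>) r (f \<circ> inv T) (T x) (T y) = ldiff \<Omega> r f x y"
proof -
  have "(T y - T x) /\<^sub>R real r = L ((y - x) /\<^sub>R real r)"
    by (simp add: rigid_diff linear_scale[OF rigid_linear])
  then show ?thesis unfolding ldiff_def by (simp only: rigid_fdiff_on)
qed

lemma rigid_local_modulus:
  assumes \<Omega>: "closed \<Omega>" and f: "f \<in> borel_measurable borel"
  shows "local_modulus (T ` \<Omega>) r (f \<circ> inv T) (T x) \<delta> q = local_modulus \<Omega> r f x \<delta> q"
proof (cases "q = \<infinity>")
  case True
  show ?thesis unfolding True local_modulus_top rigid_rho_ball by (simp add: image_image rigid_ldiff)
next
  case False
  have cT: "closed (T ` \<Omega>)" unfolding rigid_image_vimage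
    using rigid_continuous(2) \<Omega> by (intro closed_vimage) 
  have fT: "f \<circ> inv T \<in> borel_measurable borel" using f rigid_measurable by simp
  have U: "rho_ball \<Omega> x \<delta> \<in> sets borel" using closed_rho_ball[OF \<Omega>] by auto
  have UT: "T ` rho_ball \<Omega> x \<delta> \<in> sets borel" using closed_rho_ball[OF cT, of "T x" \<delta>] by (simp add: rigid_rho_ball)
  have [measurable]: "ldiff (T ` \<Omega>) r (f \<circ> inv T) (T x) \<in> borel_measurable borel"
    by (rule measurable_ldiff[OF cT fT]) auto
  have "(\<integral>\<^sup>+\<eta>\<in>T ` rho_ball \<Omega> x \<delta>. epow (ldiff (T ` \<Omega>) r (f \<circ> inv T) (T x) \<eta>) (enn2real q) \<partial>lborel)
    = (\<integral>\<^sup>+y. epow (ldiff (T ` \<Omega>) r (f \<circ> inv T) (T x) (T y)) (enn2real q) * indicator (T ` rho_ball \<Omega> x \<delta>) (T y) \<partial>lborel)"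
    using UT by (intro rigid_nn_integral[symmetric]) auto
  also have "\<dots> = (\<integral>\<^sup>+y\<in>rho_ball \<Omega> x \<delta>. epow (ldiff \<Omega> r f x y) (enn2real q) \<partial>lborel)"
    using rigid_bij by (intro nn_integral_cong) (simp add: rigid_ldiff indicator_def bij_is_inj inj_image_mem_iff)
  finally show ?thesis unfolding local_modulus_fin[OF False] rigid_rho_ball
    using rigid_emeasure[OF U] U UT by simp
qed

lemma rigid_avg_modulus:
  assumes \<Omega>: "closed \<Omega>" and f: "f \<in> borel_measurable borel" and q: "q \<le> p"
  shows "avg_modulus (T ` \<Omega>) r (f \<circ> inv T) \<delta> p q = avg_modulus \<Omega> r f \<delta> p q"
proof (cases "p = \<infinity>")
  case True
  show ?thesis unfolding avg_modulus_def True Lp_norm_top by (simp add: image_image rigid_local_modulus[OF \<Omega> f])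
next
  case False
  then have qf: "q \<noteq> \<infinity>" using q by (auto simp: top_unique)
  have cT: "closed (T ` \<Omega>)" unfolding rigid_image_vimage
    using rigid_continuous(2) \<Omega> by (intro closed_vimage) 
  have fT: "f \<circ> inv T \<in> borel_measurable borel" using f rigid_measurable by simp
  have [measurable]: "(\<lambda>\<xi>. local_modulus (T ` \<Omega>) r (f \<circ> inv T) \<xi> \<delta> q) \<in> borel_measurable borel"
    by (rule measurable_local_modulus[OF cT qf fT])
  have [measurable]: "T ` \<Omega> \<in> sets borel" using cT by simp
  have "(\<integral>\<^sup>+\<xi>\<in>T ` \<Omega>. epow (local_modulus (T ` \<Omega>) r (f \<circ> inv T) \<xi> \<delta> q) (enn2real p) \<partial>lborel)
     = (\<integral>\<^sup>+x. epow (local_modulus (T ` \<Omega>) r (f \<circ> inv T) (T x) \<delta> q) (enn2real p) * indicator (T ` \<Omega>) (T x) \<partial>lborel)"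
    by (intro rigid_nn_integral[symmetric]) measurable
  also have "\<dots> = (\<integral>\<^sup>+x\<in>\<Omega>. epow (local_modulus \<Omega> r f x \<delta> q) (enn2real p) \<partial>lborel)"
    using rigid_bij by (intro nn_integral_cong) (simp add: rigid_local_modulus[OF \<Omega> f] indicator_def bij_is_inj inj_image_mem_iff)
  finally show ?thesis unfolding avg_modulus_def Lp_norm_fin[OF False] by simp
qed

lemma rigid_ball: "T ` ball x a = ball (T x) a"
proof (intro set_eqI iffI)
  fix y assume "y \<in> ball (T x) a"
  then have "dist x (inv T y) < a" using rigid_dist[of x "inv T y"] by simp
  then show "y \<in> T ` ball x a" by (intro image_eqI[of _ _ "inv T y"]) auto
qed (auto simp: rigid_dist)

lemma rigid_ball_domain:
  assumes "ball_domain R \<Omega>" shows "ball_domain R (T ` \<Omega>)"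
proof -
  have "compact (T ` \<Omega>)" using assms rigid_continuous(1) by (auto simp: ball_domain_def intro: compact_continuous_image)
  moreover have "\<exists>n. touching_normal R (T ` \<Omega>) z n" if z: "z \<in> frontier (T ` \<Omega>)" for z
  proof -
    obtain x where x: "x \<in> frontier \<Omega>" "z = T x" using z by (auto simp: rigid_frontier)
    then obtain n where n: "touching_normal R \<Omega> x n" using assms by (auto simp: ball_domain_def)
    have 1: "ball (T x - R *\<^sub>R L n) R = T ` ball (x - R *\<^sub>R n) R" "ball (T x + R *\<^sub>R L n) R = T ` ball (x + R *\<^sub>R n) R"
      using rigid_scale[of x "-R" n] rigid_scale[of x R n] by (simp_all add: rigid_ball)
    have "touching_normal R (T ` \<Omega>) z (L n)"
      using n rigid_bij unfolding touching_normal_def x(2) 1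
      by (simp add: rigid_norm bij_is_inj inj_image_subset_iff image_Int[symmetric])
    then show ?thesis by blast
  qed
  ultimately show ?thesis using assms by (auto simp: ball_domain_def)
qed

end

section \<open>\<open>C\<^sup>2\<close>-domains have interior and exterior balls\<close>

lemma C2_taylor:
  fixes f :: "real ^ 'd::finite \<Rightarrow> real"
  assumes f: "C2_fun f" and M: "\<And>i k u. \<bar>partial i (partial k f) u\<bar> \<le> M"
  shows "\<bar>f (x + w) - f x - grad f x \<bullet> w\<bar> \<le> (real CARD('d))^2 * M * (norm w)^2"
proof -
  have M0: "M \<ge> 0" using M[of undefined undefined 0] by linarith
  have D: "DERIV (\<lambda>s. f (x + s *\<^sub>R w)) s :> (\<Sum>j\<in>UNIV. w $ j * partial j f (x + s *\<^sub>R w))" for s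
  proof -
    have "((\<lambda>s. x + s *\<^sub>R w) has_derivative (\<lambda>s. s *\<^sub>R w)) (at s)"
      by (auto intro!: derivative_eq_intros)
    from has_derivative_compose[OF this C2_fun_derivative[OF f]]
    show ?thesis
      by (rule has_derivative_imp_has_field_derivative) (simp add: sum_distrib_left mult.assoc)
  qed
  obtain \<theta> where \<theta>: "0 < \<theta>" "\<theta> < 1" "f (x + 1 *\<^sub>R w) - f (x + 0 *\<^sub>R w) = (1 - 0) * (\<Sum>j\<in>UNIV. w $ j * partial j f (x + \<theta> *\<^sub>R w))"
    using MVT2[of 0 1 "\<lambda>s. f (x + s *\<^sub>R w)" "\<lambda>s. \<Sum>j\<in>UNIV. w $ j * partial j f (x + s *\<^sub>R w)"] D by auto
  have lip: "\<bar>partial j f (x + \<theta> *\<^sub>R w) - partial j f x\<bar> \<le> (real CARD('d) * M) * norm w" for j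
  proof -
    have "partial j f differentiable_on UNIV" using f by (simp add: C2_fun_def)
    from lipschitz_if_partials_bounded[OF this convex_UNIV, of "\<lambda>_. M" "x + \<theta> *\<^sub>R w" x]
    have "\<bar>partial j f (x + \<theta> *\<^sub>R w) - partial j f x\<bar> \<le> (real CARD('d) * M) * norm (\<theta> *\<^sub>R w)" using M M0 by simp
    also have "\<dots> \<le> (real CARD('d) * M) * norm w" using \<theta> M0 by (intro mult_left_mono) (auto simp: mult_left_le_one_le)
    finally show ?thesis .
  qed
  have "grad f x \<bullet> w = (\<Sum>j\<in>UNIV. w $ j * partial j f x)"
    by (simp add: grad_def inner_vec_def mult.commute)
  then have "f (x + w) - f x - grad f x \<bullet> w = (\<Sum>j\<in>UNIV. w $ j * (partial j f (x + \<theta> *\<^sub>R w) - partial j f x))"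
    using \<theta>(3) by (simp add: right_diff_distrib sum_subtractf)
  also have "\<bar>\<dots>\<bar> \<le> (\<Sum>j\<in>UNIV. \<bar>w $ j * (partial j f (x + \<theta> *\<^sub>R w) - partial j f x)\<bar>)" by (rule sum_abs)
  also have "\<dots> \<le> (\<Sum>(j::'d)\<in>UNIV. norm w * ((real CARD('d) * M) * norm w))"
    unfolding abs_mult by (intro sum_mono mult_mono component_le_norm_cart lip) auto
  also have "\<dots> = (real CARD('d))^2 * M * (norm w)^2" by (simp add: power2_eq_square)
  finally show ?thesis .
qed

lemma C2_domain_ball_domain:
  fixes \<Omega> :: "'d::finite pt set"
  assumes C2: "C2_domain \<Omega>" and cl: "closed \<Omega>" and ne: "\<Omega> \<noteq> {}"
  shows "\<exists>R. ball_domain R \<Omega>"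
proof -
  have bnd: "bounded \<Omega>" using C2 by (simp add: C2_domain_def)
  obtain \<delta> M \<U> where \<delta>: "\<delta> > 0" and M: "M > 0"
    and op': "\<forall>U\<in>\<U>. open U \<and> connected U"
    and near': "\<forall>x\<in>\<Omega>. infdist x (frontier \<Omega>) < \<delta> \<longrightarrow> (\<exists>U\<in>\<U>. x \<in> U \<and> infdist x (frontier U) > \<delta>)"
    and chart': "\<forall>U\<in>\<U>. \<exists>(R :: 'd pt \<Rightarrow> 'd pt) c (f :: real ^ 'd \<Rightarrow> real).
            orthogonal_transformation R \<and> C2_fun f \<and> (\<forall>i k u. \<bar>partial i (partial k f) u\<bar> \<le> M) \<and>
            \<Omega> \<inter> U = {\<xi> \<in> U. snd (R (\<xi> - c)) \<le> f (fst (R (\<xi> - c)))}"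
    using C2 unfolding C2_domain_def by (elim conjE exE) (rule that)
  have op: "open U" if "U \<in> \<U>" for U using op' that by blast
  note near = near'[rule_format] and chart = bspec[OF chart']
  define Q where "Q = (real CARD('d))^2 * M"
  have Q: "Q > 0" using M by (simp add: Q_def)
  define \<rho> where "\<rho> = min (\<delta> / 2) (1 / (2 * Q))"
  have \<rho>: "\<rho> > 0" "2 * \<rho> \<le> \<delta>" "Q \<le> 1 / (2 * \<rho>)"
  proof -
    show 0: "\<rho> > 0" "2 * \<rho> \<le> \<delta>" using \<delta> Q by (auto simp: \<rho>_def)
    have "\<rho> \<le> 1 / (2 * Q)" by (simp add: \<rho>_def)
    then show "Q \<le> 1 / (2 * \<rho>)" using 0 Q by (simp add: field_simps)
  qed
  have "\<exists>n. touching_normal \<rho> \<Omega> z n" if z: "z \<in> frontier \<Omega>" for z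
  proof -
    have z\<Omega>: "z \<in> \<Omega>" using z cl frontier_subset_closed by blast
    obtain U where U: "U \<in> \<U>" "z \<in> U" "infdist z (frontier U) > \<delta>" using near[OF z\<Omega>] z \<delta> by auto
    have ballU: "ball z \<delta> \<subseteq> U"
    proof (rule ccontr)
      assume "\<not> ball z \<delta> \<subseteq> U"
      then obtain y where y: "y \<in> ball z \<delta>" "y \<notin> U" by blast
      have "z \<in> ball z \<delta> \<inter> U" using U \<delta> by simp
      then have "ball z \<delta> \<inter> frontier U \<noteq> {}" using y
        by (intro connected_Int_frontier convex_connected convex_ball) blast+
      then obtain y where "dist z y < \<delta>" "y \<in> frontier U" by auto
      then show False using infdist_le[of y "frontier U" z] U by simp
    qed
    obtain Ro :: "'d pt \<Rightarrow> 'd pt" and c f where Ro: "orthogonal_transformation Ro" and f: "C2_fun f"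
      and fM': "\<forall>i k u. \<bar>partial i (partial k f) u\<bar> \<le> M"
      and gr: "\<Omega> \<inter> U = {\<xi> \<in> U. snd (Ro (\<xi> - c)) \<le> f (fst (Ro (\<xi> - c)))}"
      using chart[OF U(1)] by blast
    have fM: "\<bar>partial i (partial k f) u\<bar> \<le> M" for i k u using fM' by blast
    have lin: "linear Ro" using Ro by (simp add: orthogonal_transformation_def)
    have inner: "Ro v \<bullet> Ro w = v \<bullet> w" for v w using Ro unfolding orthogonal_transformation_def by blast
    have nrm: "norm (Ro v) = norm v" for v by (simp add: norm_eq_sqrt_inner inner)
    obtain x0 y0 where p: "Ro (z - c) = (x0, y0)" by (cases "Ro (z - c)")
    have gr': "\<xi> \<in> \<Omega> \<longleftrightarrow> snd (Ro (\<xi> - c)) \<le> f (fst (Ro (\<xi> - c)))" if "\<xi> \<in> U" for \<xi>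
      using gr that by blast
    have le: "y0 \<le> f x0" using z\<Omega> gr'[OF U(2)] p by simp
    have "y0 = f x0"
    proof (rule ccontr)
      assume "y0 \<noteq> f x0"
      then have lt: "y0 < f x0" using le by simp
      define V where "V = U \<inter> {\<xi>. snd (Ro (\<xi> - c)) < f (fst (Ro (\<xi> - c)))}"
      have cR: "continuous_on UNIV (\<lambda>\<xi>. Ro (\<xi> - c))"
      proof -
        have 1: "continuous_on UNIV Ro"
          using lin by (intro linear_continuous_on) (simp add: linear_conv_bounded_linear)
        have 2: "continuous_on UNIV (\<lambda>\<xi>. \<xi> - c)" by (intro continuous_intros)
        show ?thesis by (rule continuous_on_compose2[OF 1 2]) simp
      qed
      have "continuous_on UNIV (\<lambda>\<xi>. f (fst (Ro (\<xi> - c))))"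
        by (rule continuous_on_compose2[OF C2_fun_continuous(1)[OF f, of UNIV]]) (auto intro!: continuous_intros cR)
      then have "open {\<xi>. snd (Ro (\<xi> - c)) < f (fst (Ro (\<xi> - c)))}"
        using cR by (intro open_Collect_less) (auto intro!: continuous_intros)
      then have "open V" using op[OF U(1)] by (simp add: V_def open_Int)
      moreover have "V \<subseteq> \<Omega>"
      proof
        fix \<xi> assume "\<xi> \<in> V"
        then have "\<xi> \<in> U" "snd (Ro (\<xi> - c)) < f (fst (Ro (\<xi> - c)))" by (simp_all add: V_def)
        then show "\<xi> \<in> \<Omega>" using gr'[of \<xi>] by linarith
      qed
      moreover have "z \<in> V" using lt p U(2) by (simp add: V_def)
      ultimately have "z \<in> interior \<Omega>" using interior_maximal by blast
      then show False using z by (simp add: frontier_def)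
    qed
    define v where "v = (- grad f x0, 1::real)"
    have v1: "norm v \<ge> 1" using norm_snd_le[of "1::real" "- grad f x0"] by (simp add: v_def)
    obtain n where n: "Ro n = v /\<^sub>R norm v" using orthogonal_transformation_surj[OF Ro] by (metis surjD)
    have v0: "norm v \<noteq> 0" using v1 by linarith
    have n1: "norm n = 1" using nrm[of n] v0 unfolding n by simp
    have nn: "n \<bullet> n = 1" using n1 by (simp add: norm_eq_1)
    have key: "(snd (Ro (z + w - c)) - f (fst (Ro (z + w - c))) \<le> norm v * (n \<bullet> w) + Q * (norm w)^2) \<and>
        (norm v * (n \<bullet> w) - Q * (norm w)^2 \<le> snd (Ro (z + w - c)) - f (fst (Ro (z + w - c))))" for w
    proof -
      obtain w' wy where w: "Ro w = (w', wy)" by (cases "Ro w")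
      have "Ro (z + w - c) = Ro (z - c) + Ro w" using linear_add[OF lin, of "z - c" w] by (simp add: algebra_simps)
      then have e: "Ro (z + w - c) = (x0 + w', f x0 + wy)" using p w \<open>y0 = f x0\<close> by simp
      have "norm v * (n \<bullet> w) = norm v * (Ro n \<bullet> Ro w)" by (simp add: inner)
      also have "\<dots> = v \<bullet> (w', wy)" using v0 by (simp add: n w)
      also have "\<dots> = wy - grad f x0 \<bullet> w'" by (simp add: v_def)
      finally have nw: "norm v * (n \<bullet> w) = wy - grad f x0 \<bullet> w'" .
      have "norm w' \<le> norm w" using norm_fst_le[of w' wy] nrm[of w] w by simp
      then have "Q * (norm w')^2 \<le> Q * (norm w)^2" using Q by (intro mult_left_mono power_mono) auto
      moreover have "\<bar>f (x0 + w') - f x0 - grad f x0 \<bullet> w'\<bar> \<le> Q * (norm w')^2"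
        unfolding Q_def by (rule C2_taylor[OF f fM])
      ultimately show ?thesis unfolding e nw fst_conv snd_conv by (intro conjI; linarith)
    qed
    have small: "norm w < \<delta>" if "norm (w - s *\<^sub>R (\<rho> *\<^sub>R n)) < \<rho>" "\<bar>s\<bar> = 1" for w s
    proof -
      have "norm w \<le> norm (w - s *\<^sub>R (\<rho> *\<^sub>R n)) + norm (s *\<^sub>R (\<rho> *\<^sub>R n))"
        using norm_triangle_sub[of w "s *\<^sub>R (\<rho> *\<^sub>R n)"] by linarith
      also have "norm (s *\<^sub>R (\<rho> *\<^sub>R n)) = \<rho>" using n1 \<rho> that(2) by (simp add: abs_mult)
      finally show ?thesis using that(1) \<rho>(2) by linarith
    qed
    have sq: "s * (n \<bullet> w) > (norm w)^2 / (2 * \<rho>)" if "norm (w - s *\<^sub>R (\<rho> *\<^sub>R n)) < \<rho>" "\<bar>s\<bar> = 1" for w s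
    proof -
      have "(norm (w - s *\<^sub>R (\<rho> *\<^sub>R n)))^2 < \<rho>^2" using that \<rho>(1) by (intro power_strict_mono) auto
      moreover have "(norm (w - s *\<^sub>R (\<rho> *\<^sub>R n)))^2 = (norm w)^2 - 2 * \<rho> * (s * (n \<bullet> w)) + \<rho>^2"
      proof -
        have "s * s = 1" using that(2) by (auto simp: abs_if split: if_splits)
        then have "s * (s * x) = x" for x by (metis mult.assoc mult_1)
        then show ?thesis unfolding power2_norm_eq_inner
          by (simp add: inner_diff inner_commute nn power2_eq_square algebra_simps)
      qed
      ultimately show ?thesis using \<rho>(1) by (simp add: field_simps)
    qed
    have Qw: "Q * (norm w)^2 \<le> (norm w)^2 / (2 * \<rho>)" for w :: "'d pt"
      using mult_right_mono[OF \<rho>(3), of "(norm w)^2"] by simp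
    have "touching_normal \<rho> \<Omega> z n" unfolding touching_normal_def
    proof (intro conjI)
      show "norm n = 1" by fact
      show "ball (z - \<rho> *\<^sub>R n) \<rho> \<subseteq> \<Omega>"
      proof
        fix \<xi> assume \<xi>: "\<xi> \<in> ball (z - \<rho> *\<^sub>R n) \<rho>"
        define w where "w = \<xi> - z"
        have w: "norm (w - (-1) *\<^sub>R (\<rho> *\<^sub>R n)) < \<rho>" using \<xi> by (simp add: w_def dist_norm norm_minus_commute algebra_simps)
        have "\<xi> \<in> U" using small[OF w] ballU by (auto simp: w_def dist_norm norm_minus_commute)
        have neg: "n \<bullet> w < - ((norm w)^2 / (2 * \<rho>))" using sq[OF w] by simp
        then have "n \<bullet> w \<le> 0" using \<rho>(1) by (smt (verit) divide_nonneg_pos zero_le_power2)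
        then have "norm v * (n \<bullet> w) \<le> 1 * (n \<bullet> w)" using v1 by (intro mult_right_mono_neg) auto
        then have "snd (Ro (z + w - c)) \<le> f (fst (Ro (z + w - c)))" using key[of w] neg Qw[of w] by linarith
        then show "\<xi> \<in> \<Omega>" using gr'[OF \<open>\<xi> \<in> U\<close>] by (simp add: w_def)
      qed
      show "ball (z + \<rho> *\<^sub>R n) \<rho> \<inter> \<Omega> = {}"
      proof (rule ccontr)
        assume "ball (z + \<rho> *\<^sub>R n) \<rho> \<inter> \<Omega> \<noteq> {}"
        then obtain \<xi> where \<xi>: "\<xi> \<in> ball (z + \<rho> *\<^sub>R n) \<rho>" "\<xi> \<in> \<Omega>" by blast
        define w where "w = \<xi> - z"
        have w: "norm (w - 1 *\<^sub>R (\<rho> *\<^sub>R n)) < \<rho>" using \<xi> by (simp add: w_def dist_norm norm_minus_commute algebra_simps)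
        have "\<xi> \<in> U" using small[OF w] ballU by (auto simp: w_def dist_norm norm_minus_commute)
        have pos: "n \<bullet> w > (norm w)^2 / (2 * \<rho>)" using sq[OF w] by simp
        then have "n \<bullet> w \<ge> 0" using \<rho>(1) by (smt (verit) divide_nonneg_pos zero_le_power2)
        then have "1 * (n \<bullet> w) \<le> norm v * (n \<bullet> w)" using v1 by (intro mult_right_mono) auto
        then have "snd (Ro (z + w - c)) > f (fst (Ro (z + w - c)))" using key[of w] pos Qw[of w] by linarith
        moreover have "snd (Ro (\<xi> - c)) \<le> f (fst (Ro (\<xi> - c)))" using gr'[OF \<open>\<xi> \<in> U\<close>] \<xi>(2) by blast
        ultimately show False by (simp add: w_def)
      qed
    qed
    then show ?thesis by blast
  qed
  then have "ball_domain \<rho> \<Omega>" using \<rho> cl bnd ne by (simp add: ball_domain_def compact_eq_bounded_closed)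
  then show ?thesis by blast
qed

section \<open>Domains of special type\<close>

lemma sd_orient_rigid: "rigid (sd_orient S) (sd_orient S)"
  by (simp add: sd_orient_def rigid_coord_swap rigid_compose[OF rigid_coord_swap rigid_coord_flip])

lemma mem_cube: "x \<in> cube b \<longleftrightarrow> (\<forall>i. \<bar>x $ i\<bar> < b)" and mem_ccube: "x \<in> ccube b \<longleftrightarrow> (\<forall>i. \<bar>x $ i\<bar> \<le> b)"
  by (auto simp: cube_def ccube_def mem_box_cart abs_less_iff abs_le_iff minus_less_iff minus_le_iff)

definition sd_frame :: "'d::finite special_data \<Rightarrow> 'd pt \<Rightarrow> 'd pt" where
  "sd_frame S = (+) (- sd_shift S) \<circ> sd_orient S"

lemma sd_frame_rigid: "rigid (sd_frame S) (id \<circ> sd_orient S)"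
  unfolding sd_frame_def by (rule rigid_compose[OF rigid_translation sd_orient_rigid])

lemma sd_frame_transport: "sd_frame S ` sd_transport S A = A"
proof -
  have shift: "v \<in> (+) z ` A \<longleftrightarrow> - z + v \<in> A" for v z
  proof
    assume "- z + v \<in> A"
    then show "v \<in> (+) z ` A" by (intro image_eqI[of _ _ "- z + v"]) simp_all
  qed (elim imageE, simp)
  have "sd_transport S A = sd_frame S -` A"
    unfolding sd_transport_def sd_frame_def by (intro set_eqI) (simp add: shift)
  then show ?thesis using rigid_bij[OF sd_frame_rigid, of S] by (simp add: bij_is_surj surj_image_vimage_eq)
qed

definition cap :: "(real ^ 'd::finite \<Rightarrow> real) \<Rightarrow> real \<Rightarrow> real \<Rightarrow> 'd pt set" where
  "cap g b a = {(x, y). x \<in> cube b \<and> g x - a < y \<and> y \<le> g x}"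

definition cap_graph :: "(real ^ 'd::finite \<Rightarrow> real) \<Rightarrow> real \<Rightarrow> 'd pt set" where
  "cap_graph g b = {(x, y). x \<in> cube b \<and> y = g x}"

lemma open_cube: "open (cube b :: (real ^ 'd::finite) set)"
  unfolding cube_def by (rule open_box)

lemma cap_frontier:
  fixes g :: "real ^ 'd::finite \<Rightarrow> real"
  assumes g: "continuous_on UNIV g" and a: "0 < a"
  shows "cap g b a \<inter> frontier (cap g b a) = cap_graph g b"
proof (intro set_eqI iffI)
  fix p assume p: "p \<in> cap g b a \<inter> frontier (cap g b a)"
  obtain x y where xy: "p = (x, y)" by (cases p)
  have "\<not> y < g x"
  proof
    assume lt: "y < g x"
    have gc: "continuous_on UNIV (\<lambda>p::'d pt. g (fst p))"
      by (rule continuous_on_compose2[OF g]) (auto intro!: continuous_intros)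
    have "open ((cube b \<times> UNIV) \<inter> ({p::'d pt. g (fst p) - a < snd p} \<inter> {p. snd p < g (fst p)}))"
      by (intro open_Int open_Times open_cube open_UNIV open_Collect_less gc continuous_intros)
    moreover have "(cube b \<times> UNIV) \<inter> ({p::'d pt. g (fst p) - a < snd p} \<inter> {p. snd p < g (fst p)}) \<subseteq> cap g b a"
      by (auto simp: cap_def)
    moreover have "p \<in> (cube b \<times> UNIV) \<inter> ({p::'d pt. g (fst p) - a < snd p} \<inter> {p. snd p < g (fst p)})"
      using p lt by (auto simp: xy cap_def)
    ultimately have "p \<in> interior (cap g b a)" using interior_maximal by blast
    then show False using p by (simp add: frontier_def)
  qed
  then show "p \<in> cap_graph g b" using p by (auto simp: xy cap_def cap_graph_def)
next
  fix p assume "p \<in> cap_graph g b"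
  then obtain x where x: "p = (x, g x)" "x \<in> cube b" by (auto simp: cap_graph_def)
  have pc: "p \<in> cap g b a" using x a by (simp add: cap_def)
  have "p \<notin> interior (cap g b a)"
  proof
    assume "p \<in> interior (cap g b a)"
    then obtain e where e: "e > 0" "ball p e \<subseteq> cap g b a" by (auto simp: mem_interior)
    have "(x, g x + e/2) \<in> ball p e" using e by (simp add: x dist_Pair_Pair dist_real_def)
    then show False using e by (auto simp: cap_def)
  qed
  then show "p \<in> cap g b a \<inter> frontier (cap g b a)" using pc closure_subset by (auto simp: frontier_def)
qed

lemma sd_frame_sets:
  "sd_frame S ` sd_set S = cap (sd_graph S) (sd_base S) (sd_param S * sd_base S)"
  "sd_frame S ` sd_bdry S = cap_graph (sd_graph S) (sd_base S)"
  "sd_frame S ` sd_bdry_star S = cap_graph (sd_graph S) (2 * sd_base S)"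
  by (simp_all add: sd_set_def sd_bdry_def sd_bdry_star_def sd_frame_transport cap_def cap_graph_def)

lemma sd_bdry_eq_frontier:
  assumes "sd_ok S" shows "sd_bdry S = sd_set S \<inter> frontier (sd_set S)"
proof -
  let ?F = "sd_frame S"
  have inj: "inj ?F" using rigid_bij[OF sd_frame_rigid] by (rule bij_is_inj)
  have g: "continuous_on UNIV (sd_graph S)" and a: "0 < sd_param S * sd_base S"
    using assms C2_fun_continuous(1) by (auto simp: sd_ok_def)
  have "?F ` (sd_set S \<inter> frontier (sd_set S)) = ?F ` sd_bdry S"
    unfolding image_Int[OF inj] rigid_frontier[OF sd_frame_rigid, symmetric] sd_frame_sets by (rule cap_frontier[OF g a])
  then show ?thesis using inj by (simp add: inj_image_eq_iff)
qed

lemma sd_attached_near: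
  fixes \<Omega> :: "'d::finite pt set"
  assumes ok: "sd_ok S" and at: "sd_attached \<Omega> S" and \<Omega>: "closed \<Omega>" "frontier \<Omega> \<noteq> {}"
  shows "sd_bdry S \<subseteq> frontier \<Omega>"
    and "\<exists>\<delta>>0. \<exists>M\<ge>0. \<forall>\<xi>\<in>sd_set S. bdist \<Omega> \<xi> < \<delta> \<longrightarrow> (\<exists>z\<in>sd_bdry S. dist \<xi> z \<le> M * bdist \<Omega> \<xi>)"
proof -
  let ?F = "sd_frame S" and ?g = "sd_graph S" and ?b = "sd_base S" and ?a = "sd_param S * sd_base S"
  note rg = sd_frame_rigid[of S]
  have b: "?b > 0" and a: "?a > 0" and C2: "C2_fun ?g" using ok by (auto simp: sd_ok_def)
  have gc: "continuous_on A ?g" for A using C2_fun_continuous(1)[OF C2] .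
  have bij: "bij ?F" using rigid_bij[OF rg] .
  have sub: "cube ?b \<subseteq> cube (2 * ?b)" "ccube ?b \<subseteq> (cube (2 * ?b) :: (real^'d) set)" "cube ?b \<subseteq> ccube ?b" "cube (2*?b) \<subseteq> ccube (2*?b)"
  proof -
    have "\<bar>y\<bar> < 2 * ?b" if "\<bar>y\<bar> \<le> ?b" for y using that b by linarith
    then show "cube ?b \<subseteq> cube (2 * ?b)" "ccube ?b \<subseteq> (cube (2 * ?b) :: (real^'d) set)" "cube ?b \<subseteq> ccube ?b" "cube (2*?b) \<subseteq> ccube (2*?b)"
      by (auto simp: mem_cube mem_ccube less_imp_le)
  qed
  have clos: "closure (sd_set_star S) \<inter> frontier \<Omega> = closure (sd_bdry_star S)" using at by (simp add: sd_attached_def)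
  have "sd_bdry S \<subseteq> sd_bdry_star S" using sub(1) by (auto simp: sd_bdry_def sd_bdry_star_def sd_transport_def)
  also have "\<dots> \<subseteq> frontier \<Omega>" using clos closure_subset[of "sd_bdry_star S"] by blast
  finally show "sd_bdry S \<subseteq> frontier \<Omega>" .
  obtain Q where Q: "open Q" "sd_set_star S = Q \<inter> \<Omega>" using at open_box unfolding sd_attached_def by blast
  define m where "m = (INF u\<in>ccube (2 * ?b). ?g u)"
  have cpt: "compact (ccube c :: (real^'d) set)" for c by (simp add: ccube_def)
  have m: "m \<le> ?g u" if "u \<in> ccube (2 * ?b)" for u unfolding m_def
    using that compact_imp_bounded[OF compact_continuous_image[OF gc cpt], of "2 * ?b"]
    by (intro cINF_lower) (auto simp: bounded_imp_bdd_below)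
  have star: "?F ` sd_set_star S = {(x, y). x \<in> cube (2 * ?b) \<and> m - 4 * sd_param S * ?b < y \<and> y \<le> ?g x}"
    unfolding sd_set_star_def sd_frame_transport m_def ..
  define Kc where "Kc = (\<lambda>p. (fst p, ?g (fst p) - snd p)) ` (ccube ?b \<times> {0..?a})"
  have "compact Kc" unfolding Kc_def
    by (intro compact_continuous_image compact_Times cpt compact_Icc continuous_intros continuous_on_compose2[OF gc[of UNIV]]) auto
  then have Kc: "compact (inv ?F ` Kc)" using rigid_continuous(2)[OF rg] by (intro compact_continuous_image)
  have Kstar: "Kc \<subseteq> ?F ` sd_set_star S"
  proof
    fix p assume "p \<in> Kc"
    then obtain x s where xs: "p = (x, ?g x - s)" "x \<in> ccube ?b" "0 \<le> s" "s \<le> ?a" by (auto simp: Kc_def)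
    have "m \<le> ?g x" using xs(2) sub by (intro m) blast
    then have "m - 4 * sd_param S * ?b < ?g x - s" using xs a by linarith
    then show "p \<in> ?F ` sd_set_star S" unfolding star using xs sub(2) by auto
  qed
  then have "inv ?F ` Kc \<subseteq> sd_set_star S" using bij by (auto simp: bij_is_inj inj_image_mem_iff subset_eq)
  then have KQ: "inv ?F ` Kc \<subseteq> Q" using Q by blast
  obtain \<delta> where \<delta>: "\<delta> > 0" "\<And>x y. x \<in> inv ?F ` Kc \<Longrightarrow> dist y x < \<delta> \<Longrightarrow> y \<in> Q"
  proof -
    obtain e where e: "0 < e" "(\<Union>x\<in>inv ?F ` Kc. ball x e) \<subseteq> Q"
      using compact_subset_open_imp_ball_epsilon_subset[OF Kc Q(1) KQ] by blast
    show thesis by (rule that[OF e(1)]) (use e(2) in \<open>auto simp: dist_commute subset_eq\<close>)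
  qed
  obtain M where M: "M > 0" "\<And>u v. u \<in> ccube (2*?b) \<Longrightarrow> v \<in> ccube (2*?b) \<Longrightarrow> \<bar>?g u - ?g v\<bar> \<le> M * norm (u - v)"
    using C2_fun_lipschitz[OF C2 cpt, of "2*?b"] by (auto simp: ccube_def)
  show "\<exists>\<delta>>0. \<exists>M\<ge>0. \<forall>\<xi>\<in>sd_set S. bdist \<Omega> \<xi> < \<delta> \<longrightarrow> (\<exists>z\<in>sd_bdry S. dist \<xi> z \<le> M * bdist \<Omega> \<xi>)"
  proof (rule exI[of _ \<delta>], rule conjI[OF \<delta>(1)], rule exI[of _ "M + 1"], intro conjI ballI impI)
    show "0 \<le> M + 1" using M by simp
    fix \<xi> assume \<xi>: "\<xi> \<in> sd_set S" and D: "bdist \<Omega> \<xi> < \<delta>"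
    obtain x y where xy: "?F \<xi> = (x, y)" by (cases "?F \<xi>")
    have "?F \<xi> \<in> cap ?g ?b ?a" using \<xi> sd_frame_sets(1)[of S] by blast
    then have x: "x \<in> cube ?b" "?g x - ?a < y" "y \<le> ?g x" by (auto simp: xy cap_def)
    have "?F \<xi> \<in> Kc" unfolding Kc_def xy using x sub(3) by (intro image_eqI[of _ _ "(x, ?g x - y)"]) auto
    then have \<xi>K: "\<xi> \<in> inv ?F ` Kc" using rigid_inv(1)[OF rg, of \<xi>] by (metis imageI)
    obtain z where z: "z \<in> frontier \<Omega>" "bdist \<Omega> \<xi> = dist \<xi> z"
      using infdist_attains_inf[OF frontier_closed \<Omega>(2)] by blast
    have "z \<in> Q" using \<delta>(2)[OF \<xi>K, of z] z D by (simp add: dist_commute)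
    moreover have "z \<in> \<Omega>" using z(1) \<Omega>(1) frontier_subset_closed by blast
    ultimately have zs: "z \<in> sd_set_star S" using Q by blast
    then have "z \<in> closure (sd_bdry_star S)" using z(1) clos closure_subset by blast
    moreover have "closed (?F -` {p. snd p = ?g (fst p)})"
      by (intro closed_vimage closed_Collect_eq rigid_continuous(1)[OF rg] continuous_intros continuous_on_compose2[OF gc[of UNIV]]) auto
    moreover have "sd_bdry_star S \<subseteq> ?F -` {p. snd p = ?g (fst p)}"
      using sd_frame_sets(3)[of S] by (auto simp: cap_graph_def)
    ultimately have zg: "snd (?F z) = ?g (fst (?F z))" using closure_minimal by blast
    obtain x1 where x1: "?F z = (x1, ?g x1)" using zg by (cases "?F z") auto
    have "?F z \<in> ?F ` sd_set_star S" using zs by blast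
    then have x1c: "x1 \<in> cube (2 * ?b)" unfolding star x1 by auto
    have d: "norm ((x, y) - (x1, ?g x1)) = bdist \<Omega> \<xi>"
      using rigid_dist[OF rg, of \<xi> z] z by (simp add: xy x1 dist_norm)
    have d1: "norm (x - x1) \<le> bdist \<Omega> \<xi>" using norm_fst_le[of "x - x1" "y - ?g x1"] d by simp
    have d2: "\<bar>y - ?g x1\<bar> \<le> bdist \<Omega> \<xi>" using norm_snd_le[of "y - ?g x1" "x - x1"] d by simp
    have "\<bar>?g x - ?g x1\<bar> \<le> M * norm (x - x1)" using x(1) x1c sub by (intro M(2)) blast+
    also have "\<dots> \<le> M * bdist \<Omega> \<xi>" using d1 M by (intro mult_left_mono) auto
    finally have "?g x - y \<le> (M + 1) * bdist \<Omega> \<xi>" using d2 by (simp add: algebra_simps abs_le_iff)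
    moreover have "dist (?F \<xi>) (x, ?g x) = ?g x - y" using x(3) by (simp add: xy dist_Pair_Pair dist_real_def)
    moreover have "(x, ?g x) \<in> ?F ` sd_bdry S" unfolding sd_frame_sets using x by (simp add: cap_graph_def)
    then obtain w where w: "w \<in> sd_bdry S" "?F w = (x, ?g x)" by force
    ultimately show "\<exists>z\<in>sd_bdry S. dist \<xi> z \<le> (M + 1) * bdist \<Omega> \<xi>"
      using rigid_dist[OF rg, of \<xi> w] by (intro bexI[of _ w]) auto
  qed
qed

lemma straightened_near:
  fixes \<Omega> :: "'d::finite pt set"
  assumes ok: "sd_ok G" and at: "sd_attached \<Omega> G" and \<Omega>: "closed \<Omega>" "frontier \<Omega> \<noteq> {}"
    and st: "straightens T G H" and T: "rigid T L"
  shows "sd_bdry H \<subseteq> frontier (T ` \<Omega>)"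
    and "\<exists>\<delta>>0. \<exists>M\<ge>0. \<forall>\<xi>\<in>sd_set H. bdist (T ` \<Omega>) \<xi> < \<delta> \<longrightarrow> (\<exists>z\<in>sd_bdry H. dist \<xi> z \<le> M * bdist (T ` \<Omega>) \<xi>)"
proof -
  have H: "sd_ok H" and e: "sd_set H = T ` sd_set G" using st by (auto simp: straightens_def sd_standard_def)
  have inj: "inj T" using rigid_bij[OF T] by (rule bij_is_inj)
  have B: "sd_bdry H = T ` sd_bdry G"
    unfolding sd_bdry_eq_frontier[OF ok] sd_bdry_eq_frontier[OF H] e rigid_frontier[OF T] image_Int[OF inj] ..
  show "sd_bdry H \<subseteq> frontier (T ` \<Omega>)"
    unfolding B rigid_frontier[OF T] using sd_attached_near(1)[OF ok at \<Omega>] by blast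
  obtain \<delta> M where "\<delta> > 0" "M \<ge> 0" and near: "\<And>\<xi>. \<xi> \<in> sd_set G \<Longrightarrow> bdist \<Omega> \<xi> < \<delta> \<Longrightarrow> \<exists>z\<in>sd_bdry G. dist \<xi> z \<le> M * bdist \<Omega> \<xi>"
    using sd_attached_near(2)[OF ok at \<Omega>] by metis
  show "\<exists>\<delta>>0. \<exists>M\<ge>0. \<forall>\<xi>\<in>sd_set H. bdist (T ` \<Omega>) \<xi> < \<delta> \<longrightarrow> (\<exists>z\<in>sd_bdry H. dist \<xi> z \<le> M * bdist (T ` \<Omega>) \<xi>)"
  proof (intro exI conjI ballI impI)
    fix \<xi> assume "\<xi> \<in> sd_set H" "bdist (T ` \<Omega>) \<xi> < \<delta>"
    then obtain x where x: "x \<in> sd_set G" "\<xi> = T x" "bdist \<Omega> x < \<delta>" unfolding e by (auto simp: rigid_bdist[OF T])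
    then obtain z where "z \<in> sd_bdry G" "dist x z \<le> M * bdist \<Omega> x" using near by blast
    then show "\<exists>z\<in>sd_bdry H. dist \<xi> z \<le> M * bdist (T ` \<Omega>) \<xi>"
      unfolding B x(2) rigid_bdist[OF T] by (intro bexI[of _ "T z"]) (auto simp: rigid_dist[OF T])
  qed fact+
qed

section \<open>The comparison theorem\<close>

lemma Lp_space_borel_version:
  fixes \<Omega> :: "'a::euclidean_space set"
  assumes f: "f \<in> Lp_space p \<Omega>" and \<Omega>: "closed \<Omega>"
  shows "\<exists>g Z. g \<in> borel_measurable borel \<and> Z \<in> null_sets lborel \<and> (p = \<infinity> \<longrightarrow> Z = {}) \<and> (\<forall>x\<in>\<Omega> - Z. f x = g x)"
proof (cases "p = \<infinity>")
  case True
  have "continuous_on \<Omega> f" using f True by (simp add: Lp_space_def)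
  then have "(\<lambda>x. indicator \<Omega> x *\<^sub>R f x) \<in> borel_measurable borel"
    using \<Omega> by (intro borel_measurable_continuous_on_indicator) auto
  then show ?thesis using True by (intro exI[of _ "\<lambda>x. indicator \<Omega> x *\<^sub>R f x"] exI[of _ "{}"]) auto
next
  case False
  have "f \<in> borel_measurable (lebesgue_on \<Omega>)" using f False by (simp add: Lp_space_def)
  then have "(\<lambda>x. if x \<in> \<Omega> then f x else 0) \<in> borel_measurable lebesgue"
    using \<Omega> by (subst borel_measurable_if) auto
  from completion_ex_borel_measurable_real[OF this]
  obtain g where g: "g \<in> borel_measurable lborel" "AE x in lborel. (if x \<in> \<Omega> then f x else 0) = g x" by blast
  from AE_E[OF g(2)] obtain Z where Z: "{x \<in> space lborel. \<not> (if x \<in> \<Omega> then f x else 0) = g x} \<subseteq> Z"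
    "emeasure lborel Z = 0" "Z \<in> sets lborel" by blast
  have "f x = g x" if "x \<in> \<Omega> - Z" for x
  proof (rule ccontr)
    assume "f x \<noteq> g x"
    then have "x \<in> {x \<in> space lborel. \<not> (if x \<in> \<Omega> then f x else 0) = g x}" using that by simp
    then have "x \<in> Z" using Z(1) by blast
    then show False using that by simp
  qed
  then show ?thesis using g(1) Z False by (intro exI[of _ g] exI[of _ Z]) (auto simp: null_sets_def)
qed

lemma norm_basis_vec: "norm (basis_vec j) = 1"
  by (cases j) (simp_all add: norm_Pair1 norm_Pair2)

theorem theorem2p13:
  fixes \<Omega> D :: "'d::finite pt set"
    and r m :: nat
    and A0 :: real
    and p q :: ennreal
    and G H :: "nat \<Rightarrow> 'd special_data"
    and T :: "nat \<Rightarrow> 'd pt \<Rightarrow> 'd pt"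
  assumes "open D" and "connected D" and "bounded D" and "D \<noteq> {}"
    and "\<Omega> = closure D" and "C2_domain \<Omega>"
    and "1 \<le> r" and "1 < A0"
    and "0 < q" and "q \<le> p"
    and "\<And>j. j \<in> {1..m} \<Longrightarrow> sd_ok (G j)"
    and "\<And>j. j \<in> {1..m} \<Longrightarrow> sd_set (G j) \<subseteq> \<Omega>"
    and "\<And>j. j \<in> {1..m} \<Longrightarrow> sd_attached \<Omega> (G j)"
    and "frontier \<Omega> \<subseteq> (\<Union>j\<in>{1..m}. sd_set (G j))"
    and "\<And>j. j \<in> {1..m} \<Longrightarrow> straightens (T j) (G j) (H j)"
  shows "\<exists>C c0 :: real. 0 < C \<and> 0 < c0 \<and>
    (\<forall>f\<in>Lp_space p \<Omega>. \<forall>t. 0 < t \<and> t \<le> 1 \<longrightarrow>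
       full_modulus \<Omega> m T H r f t A0 p \<le> ennreal C * avg_modulus \<Omega> r f (c0 * t) p q)"
proof -
  note r = assms(7) and q = assms(9,10)
  have cl: "closed \<Omega>" and ne: "\<Omega> \<noteq> {}" using assms(4,5) by auto
  obtain R where bd: "ball_domain R \<Omega>" using C2_domain_ball_domain[OF assms(6) cl ne] by blast
  have R: "R > 0" and fr: "frontier \<Omega> \<noteq> {}" using bd_facts[OF bd] by auto
  obtain B0 where B0: "\<And>x. x \<in> \<Omega> \<Longrightarrow> norm x \<le> B0"
    using bd_facts(1)[OF bd] compact_imp_bounded bounded_iff by metis
  define B where "B = max 1 (2 * B0)"
  have B: "\<And>x. x \<in> \<Omega> \<Longrightarrow> norm x \<le> B / 2" "1 \<le> B" using B0 by (fastforce simp: B_def)+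
  define K1 where "K1 = 2 * (real r * (B * (1 + B / R)) + (real r)^2 * B^2 / R + real r * B / sqrt (R/2)) + 1"
  have K1: "0 \<le> K1" using B R unfolding K1_def
    by (intro add_nonneg_nonneg mult_nonneg_nonneg divide_nonneg_nonneg) auto
  have "\<exists>L. rigid (T j) L" if "j \<in> {1..m}" for j
    using assms(15)[OF that] coord_map_rigid by (auto simp: straightens_def)
  then obtain L where L: "\<And>j. j \<in> {1..m} \<Longrightarrow> rigid (T j) (L j)" by metis
  have std: "sd_standard (H j)" and HT: "sd_set (H j) \<subseteq> T j ` \<Omega>" if "j \<in> {1..m}" for j
    using image_mono[OF assms(12)[OF that], of "T j"] assms(15)[OF that] by (simp_all add: straightens_def)
  have bdT: "ball_domain R (T j ` \<Omega>)" if "j \<in> {1..m}" for j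
    using rigid_ball_domain[OF L[OF that] bd] .
  define cond where "cond j K \<longleftrightarrow> (\<forall>\<xi>\<in>sd_set (H j). \<forall>u\<in>cube (sd_base (H j)). \<forall>t s i. 0 < s \<longrightarrow> s \<le> t \<longrightarrow> t \<le> 1 \<longrightarrow>
     norm (u - fst \<xi>) \<le> t * sd_base (H j) \<longrightarrow>
     norm (s *\<^sub>R tangent_vec (sd_graph (H j)) i u) \<le> K * t \<and>
     (\<forall>a\<in>{0..real r}. \<xi> + a *\<^sub>R (s *\<^sub>R tangent_vec (sd_graph (H j)) i u) \<in> T j ` \<Omega> \<longrightarrow>
       \<bar>sqrt (bdist (T j ` \<Omega>) (\<xi> + a *\<^sub>R (s *\<^sub>R tangent_vec (sd_graph (H j)) i u))) - sqrt (bdist (T j ` \<Omega>) \<xi>)\<bar> \<le> K * t))" for j K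
  have "\<exists>K. cond j K" if j: "j \<in> {1..m}" for j
  proof -
    note near = straightened_near[OF assms(11)[OF j] assms(13)[OF j] cl fr assms(15)[OF j] L[OF j]]
    obtain \<delta> M where "\<delta> > 0" "M \<ge> 0"
      and *: "\<forall>\<xi>\<in>sd_set (H j). bdist (T j ` \<Omega>) \<xi> < \<delta> \<longrightarrow> (\<exists>z\<in>sd_bdry (H j). dist \<xi> z \<le> M * bdist (T j ` \<Omega>) \<xi>)"
      using near(2) by blast
    from tang_condition[OF bdT[OF j] std[OF j] near(1) HT[OF j] \<open>\<delta> > 0\<close> \<open>M \<ge> 0\<close>, of r] *
    show ?thesis unfolding cond_def by fast
  qed
  then obtain Kf where Kf: "\<And>j. j \<in> {1..m} \<Longrightarrow> cond j (Kf j)" by metis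
  define K where "K = K1 + B + (\<Sum>j=1..m. \<bar>Kf j\<bar>)"
  have s0: "0 \<le> (\<Sum>j=1..m. \<bar>Kf j\<bar>)" by (intro sum_nonneg) auto
  have K: "K1 \<le> K" "B \<le> K" "0 \<le> K" using K1 B s0 by (auto simp: K_def)
  have KfK: "Kf j \<le> K" if "j \<in> {1..m}" for j
  proof -
    have "\<bar>Kf j\<bar> \<le> (\<Sum>j=1..m. \<bar>Kf j\<bar>)" using that by (intro member_le_sum) auto
    then show ?thesis using K1 B by (simp add: K_def)
  qed
  have condK: "cond j K" if j: "j \<in> {1..m}" for j
    unfolding cond_def
  proof (intro ballI allI impI)
    fix \<xi> u t s i
    assume A: "\<xi> \<in> sd_set (H j)" "u \<in> cube (sd_base (H j))" "0 < s" "s \<le> t" "t \<le> 1"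
      "norm (u - fst \<xi>) \<le> t * sd_base (H j)"
    have "Kf j * t \<le> K * t" using KfK[OF j] A by (intro mult_right_mono) auto
    then show "norm (s *\<^sub>R tangent_vec (sd_graph (H j)) i u) \<le> K * t \<and>
     (\<forall>a\<in>{0..real r}. \<xi> + a *\<^sub>R (s *\<^sub>R tangent_vec (sd_graph (H j)) i u) \<in> T j ` \<Omega> \<longrightarrow>
       \<bar>sqrt (bdist (T j ` \<Omega>) (\<xi> + a *\<^sub>R (s *\<^sub>R tangent_vec (sd_graph (H j)) i u))) - sqrt (bdist (T j ` \<Omega>) \<xi>)\<bar> \<le> K * t)"
      using Kf[OF j] A unfolding cond_def by (meson order_trans)
  qed
  obtain N c C where N: "1 \<le> N" "0 < c" "0 < C" and est: "\<And>(\<Omega>::'d pt set) \<xi> h t f. \<lbrakk>ball_domain R \<Omega>; f \<in> borel_measurable borel;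
      0 < t; t \<le> 1; norm h \<le> K * t; \<forall>a\<in>{0..real r}. \<xi> + a *\<^sub>R h \<in> \<Omega>;
      \<forall>a\<in>{0..real r}. \<bar>sqrt (bdist \<Omega> (\<xi> + a *\<^sub>R h)) - sqrt (bdist \<Omega> \<xi>)\<bar> \<le> K * t\<rbrakk> \<Longrightarrow>
      \<exists>k\<le>r * N. ennreal \<bar>fdiff r h f \<xi>\<bar>
         \<le> ennreal C * local_modulus \<Omega> r f (\<xi> + (real k / real N) *\<^sub>R h) (c * t) q"
    using local_estimate[OF r R K(3) q(1), where 'a = "'d pt"] by blast
  have dom: "dominated \<Omega> r q K N c C f" if "ball_domain R \<Omega>" "f \<in> borel_measurable borel" for \<Omega> :: "'d pt set" and f
    unfolding dominated_def using N est[OF that] by blast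
  let ?p = "1 / enn2real p"
  define C1 where "C1 = C * real (6 * (r * N + 1)) powr ?p"
  define C2 where "C2 j = C * (real (r * N + 1) * (unit_ball_vol (real CARD('d)) * ((sd_base (H j) + r) / sd_base (H j)) ^ CARD('d))) powr ?p" for j
  have C1: "C1 > 0"
  proof -
    have "real (6 * (r * N + 1)) > 0" by (simp only: of_nat_0_less_iff) simp
    then show ?thesis using N by (simp add: C1_def)
  qed
  have C2: "C2 j \<ge> 0" for j using N by (simp add: C2_def)
  show ?thesis
  proof (rule exI[of _ "C1 + (\<Sum>j=1..m. C2 j)"], rule exI[of _ c], intro conjI ballI allI impI)
    show "0 < C1 + (\<Sum>j=1..m. C2 j)" using C1 C2 by (intro add_pos_nonneg sum_nonneg) auto
    show "0 < c" by fact
    fix f and t :: real assume f: "f \<in> Lp_space p \<Omega>" and "0 < t \<and> t \<le> 1"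
    then have t: "0 < t" "t \<le> 1" by auto
    let ?A = "avg_modulus \<Omega> r f (c * t) p q"
    obtain g Z where g: "g \<in> borel_measurable borel" and Z: "Z \<in> null_sets lborel" "p = \<infinity> \<Longrightarrow> Z = {}"
      and fg: "\<And>x. x \<in> \<Omega> - Z \<Longrightarrow> f x = g x" using Lp_space_borel_version[OF f cl] by blast
    have DT: "DT_modulus \<Omega> r f t p \<le> ennreal C1 * ?A"
      unfolding DT_modulus_def
    proof (rule Max.boundedI)
      fix x assume "x \<in> range (\<lambda>j. DT_modulus_dir \<Omega> r f t (basis_vec j) p)"
      then obtain j where j: "x = DT_modulus_dir \<Omega> r f t (basis_vec j) p" by blast
      show "x \<le> ennreal C1 * ?A" unfolding j C1_def
        by (rule DT_dir_bound[OF bd B norm_basis_vec r t K(1)[unfolded K1_def] K(2) dom[OF bd g] g q Z fg])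
    qed auto
    have tang: "tang_modulus \<Omega> (T j) (H j) r f t A0 p \<le> ennreal (C2 j) * ?A" if j: "j \<in> {1..m}" for j
    proof -
      let ?T = "T j"
      note rg = L[OF j]
      have gT: "g \<circ> inv ?T \<in> borel_measurable borel" using g rigid_measurable(2)[OF rg] by simp
      have clT: "closed (?T ` \<Omega>)" using bd_facts(2)[OF bdT[OF j]] .
      have ZT: "?T ` Z \<in> null_sets lborel"
      proof -
        have Zb: "Z \<in> sets borel" using Z(1) by auto
        have "?T ` Z \<in> sets borel" unfolding rigid_image_vimage[OF rg]
          using measurable_sets_borel[OF rigid_measurable(2)[OF rg] Zb] .
        then show ?thesis using rigid_emeasure[OF rg Zb] Z(1) by (auto simp: null_sets_def)
      qed
      have ZT': "?T ` Z = {}" if "p = \<infinity>" using Z(2)[OF that] by simp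
      have fgT: "(f \<circ> inv ?T) y = (g \<circ> inv ?T) y" if y: "y \<in> ?T ` \<Omega> - ?T ` Z" for y
      proof -
        obtain x where x: "x \<in> \<Omega>" "y = ?T x" using y by blast
        then have "x \<in> \<Omega> - Z" using y by blast
        then show ?thesis using fg x(2) rigid_inv(1)[OF rg] by simp
      qed
      have "tang_modulus \<Omega> ?T (H j) r f t A0 p \<le> ennreal (C2 j) * avg_modulus (?T ` \<Omega>) r (f \<circ> inv ?T) (c * t) p q"
        unfolding tang_modulus_def C2_def
      proof (rule tang_bound[OF clT std[OF j] r t _ dom[OF bdT[OF j] gT] gT q ZT ZT' fgT])
        fix \<xi> u s i
        assume "\<xi> \<in> sd_set (H j)" "u \<in> cube (sd_base (H j))" "0 < s" "s \<le> t" "norm (u - fst \<xi>) \<le> t * sd_base (H j)"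
        then show "norm (s *\<^sub>R tangent_vec (sd_graph (H j)) i u) \<le> K * t \<and>
          (\<forall>a\<in>{0..real r}. \<xi> + a *\<^sub>R (s *\<^sub>R tangent_vec (sd_graph (H j)) i u) \<in> ?T ` \<Omega> \<longrightarrow>
          \<bar>sqrt (bdist (?T ` \<Omega>) (\<xi> + a *\<^sub>R (s *\<^sub>R tangent_vec (sd_graph (H j)) i u))) - sqrt (bdist (?T ` \<Omega>) \<xi>)\<bar> \<le> K * t)"
          using condK[OF j] t(2) unfolding cond_def by blast
      qed
      also have "avg_modulus (?T ` \<Omega>) r (f \<circ> inv ?T) (c * t) p q = avg_modulus (?T ` \<Omega>) r (g \<circ> inv ?T) (c * t) p q"
        by (rule avg_modulus_cong_null[OF ZT ZT' fgT r q(2)])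
      also have "\<dots> = avg_modulus \<Omega> r g (c * t) p q" by (rule rigid_avg_modulus[OF rg cl g q(2)])
      also have "\<dots> = ?A" by (rule avg_modulus_cong_null[OF Z fg r q(2), symmetric])
      finally show ?thesis .
    qed
    have "full_modulus \<Omega> m T H r f t A0 p \<le> ennreal C1 * ?A + (\<Sum>j=1..m. ennreal (C2 j) * ?A)"
      unfolding full_modulus_def by (intro add_mono DT sum_mono tang)
    also have "\<dots> = ennreal (C1 + (\<Sum>j=1..m. C2 j)) * ?A"
    proof -
      have "(\<Sum>j=1..m. ennreal (C2 j) * ?A) = ennreal (\<Sum>j=1..m. C2 j) * ?A"
        using C2 by (simp add: sum_distrib_right[symmetric])
      then show ?thesis using C1 C2 by (simp add: ennreal_plus sum_nonneg distrib_right)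
    qed
    finally show "full_modulus \<Omega> m T H r f t A0 p \<le> ennreal (C1 + (\<Sum>j=1..m. C2 j)) * ?A" .
  qed
qed

end
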